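(* Let $\Gamma$ and $\Gamma'$ be finite simplicial graphs such that $\Gamma'$ has fewer vertices than $\Gamma$. Then there are no injective homomorphisms $\mathrm{Out}(A_\Gamma) \to \mathrm{Out}(A_{\Gamma'})$.
   Context: For a simplicial graph $\Gamma$ (no loops, no multiple edges), the right-angled Artin group $A_\Gamma$ is the group generated by the vertices of $\Gamma$, with defining relations that two vertices commute if they are joined by an edge of $\Gamma$. $\mathrm{Out}(A_\Gamma)$ is its outer automorphism group. *)

theory Defs
  imports "Graph_Theory.Digraph" "HOL-Algebra.Group_Action"
begin

text \<open>The letter \<open>(s, True)\<close> stands for the generator \<open>s\<close> and \<open>(s, False)\<close> for its formal inverse.\<close>

type_synonym 's word = "('s \<times> bool) list"

definition words :: "'s set \<Rightarrow> 's word set"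
  where "words S = lists (S \<times> UNIV)"

text \<open>A pair \<open>(l, r) \<in> R\<close> is the relation \<open>l = r\<close>. Two words are equivalent iff they represent the
  same element of \<open>\<langle>S | R\<rangle>\<close>; relations that mention letters outside \<open>S\<close> are ignored.\<close>

inductive_set word_rel :: "'s set \<Rightarrow> ('s word \<times> 's word) set \<Rightarrow> ('s word \<times> 's word) set"
  for S :: "'s set" and R :: "('s word \<times> 's word) set" where
  refl: "w \<in> words S \<Longrightarrow> (w, w) \<in> word_rel S R"
| sym: "(v, w) \<in> word_rel S R \<Longrightarrow> (w, v) \<in> word_rel S R"
| trans: "(u, v) \<in> word_rel S R \<Longrightarrow> (v, w) \<in> word_rel S R \<Longrightarrow> (u, w) \<in> word_rel S R"
| cancel: "u \<in> words S \<Longrightarrow> v \<in> words S \<Longrightarrow> s \<in> S \<Longrightarrow>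
    (u @ [(s, b), (s, \<not> b)] @ v, u @ v) \<in> word_rel S R"
| relation: "u \<in> words S \<Longrightarrow> v \<in> words S \<Longrightarrow> (l, r) \<in> R \<Longrightarrow> l \<in> words S \<Longrightarrow> r \<in> words S \<Longrightarrow>
    (u @ l @ v, u @ r @ v) \<in> word_rel S R"

definition presented_group :: "'s set \<Rightarrow> ('s word \<times> 's word) set \<Rightarrow> 's word set monoid"
  where "presented_group S R =
    \<lparr>carrier = words S // word_rel S R,
     monoid.mult = \<lambda>A B. \<Union>x\<in>A. \<Union>y\<in>B. word_rel S R `` {x @ y},
     one = word_rel S R `` {[]}\<rparr>"

lemma words_simps [simp]:
  "[] \<in> words S" "a # w \<in> words S \<longleftrightarrow> fst a \<in> S \<and> w \<in> words S"
  "v @ w \<in> words S \<longleftrightarrow> v \<in> words S \<and> w \<in> words S"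
  by (auto simp: words_def mem_Times_iff)

lemma word_rel_words: "(v, w) \<in> word_rel S R \<Longrightarrow> v \<in> words S \<and> w \<in> words S"
  by (induction rule: word_rel.induct) auto

lemma equiv_word_rel: "equiv (words S) (word_rel S R)"
proof (rule equivI)
  show "word_rel S R \<subseteq> words S \<times> words S" using word_rel_words by fast
  show "refl_on (words S) (word_rel S R)" by (simp add: refl_on_def word_rel.refl)
  show "sym (word_rel S R)" by (rule symI) (rule word_rel.sym)
  show "trans (word_rel S R)" by (rule transI) (rule word_rel.trans)
qed

lemma word_rel_append_left:
  "(v, w) \<in> word_rel S R \<Longrightarrow> u \<in> words S \<Longrightarrow> (u @ v, u @ w) \<in> word_rel S R"
proof (induction rule: word_rel.induct)
  case (cancel x y s b)
  then show ?case using word_rel.cancel[of "u @ x" S y s b R] by simp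
next
  case (relation x y l r)
  then show ?case using word_rel.relation[of "u @ x" S y l r R] by simp
qed (simp add: word_rel.refl, metis word_rel.sym, metis word_rel.trans)

lemma word_rel_append_right:
  "(v, w) \<in> word_rel S R \<Longrightarrow> u \<in> words S \<Longrightarrow> (v @ u, w @ u) \<in> word_rel S R"
proof (induction rule: word_rel.induct)
  case (cancel x y s b)
  then show ?case using word_rel.cancel[of x S "y @ u" s b R] by simp
next
  case (relation x y l r)
  then show ?case using word_rel.relation[of x S "y @ u" l r R] by simp
qed (simp add: word_rel.refl, metis word_rel.sym, metis word_rel.trans)

lemma word_rel_append:
  assumes "(v, w) \<in> word_rel S R" "(v', w') \<in> word_rel S R"
  shows "(v @ v', w @ w') \<in> word_rel S R"
  by (meson assms word_rel.trans word_rel_append_left word_rel_append_right word_rel_words)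

lemma presented_group_mult:
  assumes "v \<in> words S" "w \<in> words S"
  shows "word_rel S R `` {v} \<otimes>\<^bsub>presented_group S R\<^esub> word_rel S R `` {w} = word_rel S R `` {v @ w}"
proof -
  have "(\<Union>x\<in>word_rel S R `` {v}. \<Union>y\<in>word_rel S R `` {w}. word_rel S R `` {x @ y})
      = (\<Union>x\<in>word_rel S R `` {v}. \<Union>y\<in>word_rel S R `` {w}. word_rel S R `` {v @ w})"
    by (intro SUP_cong HOL.refl equiv_class_eq[OF equiv_word_rel, symmetric] word_rel_append) auto
  moreover have "v \<in> word_rel S R `` {v}" "w \<in> word_rel S R `` {w}"
    using assms by (auto intro: word_rel.refl)
  ultimately show ?thesis by (simp add: presented_group_def) blast
qed

definition inv_word :: "'s word \<Rightarrow> 's word"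
  where "inv_word w = rev (map (\<lambda>(s, b). (s, \<not> b)) w)"

lemma inv_word_words [simp]: "inv_word w \<in> words S \<longleftrightarrow> w \<in> words S"
  by (induction w) (auto simp: inv_word_def)

lemma inv_word_cancel: "w \<in> words S \<Longrightarrow> (inv_word w @ w, []) \<in> word_rel S R"
proof (induction w)
  case Nil
  then show ?case by (simp add: inv_word_def word_rel.refl)
next
  case (Cons a w)
  have "(inv_word w @ [(fst a, \<not> snd a), (fst a, \<not> \<not> snd a)] @ w, inv_word w @ w) \<in> word_rel S R"
    using Cons.prems by (intro word_rel.cancel) auto
  moreover have "inv_word (a # w) @ a # w
      = inv_word w @ [(fst a, \<not> snd a), (fst a, \<not> \<not> snd a)] @ w"
    by (cases a) (simp add: inv_word_def)
  ultimately show ?case using Cons by (metis word_rel.trans words_simps(2))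
qed

lemma carrier_presented_group:
  "A \<in> carrier (presented_group S R) \<longleftrightarrow> (\<exists>w\<in>words S. A = word_rel S R `` {w})"
  by (auto simp: presented_group_def quotient_def)

lemma one_presented_group: "\<one>\<^bsub>presented_group S R\<^esub> = word_rel S R `` {[]}"
  by (simp add: presented_group_def)

theorem group_presented_group: "group (presented_group S R)"
proof (rule groupI)
  fix A assume "A \<in> carrier (presented_group S R)"
  then obtain w where w: "w \<in> words S" "A = word_rel S R `` {w}"
    by (auto simp: carrier_presented_group)
  then have "word_rel S R `` {inv_word w} \<otimes>\<^bsub>presented_group S R\<^esub> A = \<one>\<^bsub>presented_group S R\<^esub>"
    using equiv_class_eq[OF equiv_word_rel inv_word_cancel[OF w(1), of R]]
    by (simp add: presented_group_mult one_presented_group)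
  then show "\<exists>B\<in>carrier (presented_group S R). B \<otimes>\<^bsub>presented_group S R\<^esub> A = \<one>\<^bsub>presented_group S R\<^esub>"
    using w(1) by (intro bexI) (auto simp: carrier_presented_group)
qed (auto simp: carrier_presented_group one_presented_group presented_group_mult)

definition eval_word :: "('g, 'm) monoid_scheme \<Rightarrow> ('s \<Rightarrow> 'g) \<Rightarrow> 's word \<Rightarrow> 'g"
  where "eval_word G f w =
    foldr (\<lambda>(s, b) g. (if b then f s else inv\<^bsub>G\<^esub> f s) \<otimes>\<^bsub>G\<^esub> g) w \<one>\<^bsub>G\<^esub>"

context group
begin

lemma eval_word_closed [simp]:
  "f \<in> S \<rightarrow> carrier G \<Longrightarrow> w \<in> words S \<Longrightarrow> eval_word G f w \<in> carrier G"
  by (induction w) (auto simp: eval_word_def Pi_iff)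

lemma eval_word_append:
  assumes "f \<in> S \<rightarrow> carrier G" "v \<in> words S" "w \<in> words S"
  shows "eval_word G f (v @ w) = eval_word G f v \<otimes> eval_word G f w"
  using assms(2)
proof (induction v)
  case Nil
  have "eval_word G f [] = \<one>" by (simp add: eval_word_def)
  then show ?case using assms by simp
next
  case (Cons a v)
  have cons: "eval_word G f (a # u)
      = (if snd a then f (fst a) else inv f (fst a)) \<otimes> eval_word G f u" for u
    by (simp add: eval_word_def case_prod_unfold)
  have "f (fst a) \<in> carrier G" using Cons.prems assms(1) by auto
  then show ?case using Cons assms by (simp add: cons m_assoc)
qed

lemma eval_word_cong:
  assumes f: "f \<in> S \<rightarrow> carrier G"
    and R: "\<And>l r. (l, r) \<in> R \<Longrightarrow> l \<in> words S \<Longrightarrow> r \<in> words S \<Longrightarrow> eval_word G f l = eval_word G f r"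
    and "(v, w) \<in> word_rel S R"
  shows "eval_word G f v = eval_word G f w"
  using assms(3)
proof (induction rule: word_rel.induct)
  case (cancel u v s b)
  have "f s \<in> carrier G" using cancel f by auto
  then have "eval_word G f [(s, b), (s, \<not> b)] = \<one>" by (simp add: eval_word_def)
  then show ?case
    using cancel f by (simp only: eval_word_append[OF f] words_simps fst_conv) simp
next
  case (relation u v l r)
  then show ?case using R[of l r] by (simp add: eval_word_append[OF f])
qed auto

theorem presented_group_universal:
  assumes f: "f \<in> S \<rightarrow> carrier G"
    and R: "\<And>l r. (l, r) \<in> R \<Longrightarrow> l \<in> words S \<Longrightarrow> r \<in> words S \<Longrightarrow> eval_word G f l = eval_word G f r"
  shows "\<exists>h\<in>hom (presented_group S R) G. \<forall>s\<in>S. h (word_rel S R `` {[(s, True)]}) = f s"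
proof -
  define h where "h A = eval_word G f (SOME w. w \<in> A)" for A
  have h: "h (word_rel S R `` {w}) = eval_word G f w" if "w \<in> words S" for w
  proof -
    have "(w, SOME v. v \<in> word_rel S R `` {w}) \<in> word_rel S R"
      using someI[of "\<lambda>v. v \<in> word_rel S R `` {w}" w] that by (auto intro: word_rel.refl)
    then show ?thesis unfolding h_def using eval_word_cong[OF f R] by metis
  qed
  have "h \<in> hom (presented_group S R) G"
    by (rule homI)
      (use f in \<open>auto simp: carrier_presented_group presented_group_mult h eval_word_append[OF f]\<close>)
  moreover have "h (word_rel S R `` {[(s, True)]}) = f s" if "s \<in> S" for s
  proof -
    have "f s \<in> carrier G" using that f by auto
    then show ?thesis using that by (simp add: h) (simp add: eval_word_def)
  qed
  ultimately show ?thesis by blast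
qed

end

text \<open>A simplicial graph is modelled by the locale \<^locale>\<open>graph\<close>: an undirected edge is a pair of
  opposite arcs, without loops or parallel arcs. So \<open>u \<rightarrow>\<^bsub>\<Gamma>\<^esub> v\<close> says that \<open>u\<close> and \<open>v\<close> are joined by an edge.\<close>

definition raag :: "('v, 'e) pre_digraph \<Rightarrow> 'v word set monoid"
  where "raag \<Gamma> = presented_group (verts \<Gamma>)
    {([(u, True), (v, True)], [(v, True), (u, True)]) | u v. u \<rightarrow>\<^bsub>\<Gamma>\<^esub> v}"

lemma group_raag: "group (raag \<Gamma>)"
  unfolding raag_def by (rule group_presented_group)

definition Inn :: "('g, 'm) monoid_scheme \<Rightarrow> ('g \<Rightarrow> 'g) set"
  where "Inn G = (\<lambda>g. \<lambda>h\<in>carrier G. g \<otimes>\<^bsub>G\<^esub> h \<otimes>\<^bsub>G\<^esub> inv\<^bsub>G\<^esub> g) ` carrier G"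

text \<open>\<open>Inn_normal\<close> below justifies the quotient.\<close>

definition OutGroup :: "('g, 'm) monoid_scheme \<Rightarrow> ('g \<Rightarrow> 'g) set monoid"
  where "OutGroup G = AutoGroup G Mod Inn G"

context group
begin

lemma Inn_subset_auto: "Inn G \<subseteq> auto G"
proof
  fix f assume "f \<in> Inn G"
  then obtain g where g: "g \<in> carrier G" "f = (\<lambda>h\<in>carrier G. g \<otimes> h \<otimes> inv g)"
    by (auto simp: Inn_def)
  have "f \<in> carrier (BijGroup (carrier G))"
    using hom_in_carrier[OF conjugation_is_hom g(1)] g(2) by simp
  moreover have "f \<in> hom G G"
    using g by (intro homI) (simp_all add: m_assoc flip: m_assoc[of "inv g" g])
  ultimately show "f \<in> auto G" by (simp add: auto_def BijGroup_def)
qed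

lemma Inn_normal: "Inn G \<lhd> AutoGroup G"
proof -
  interpret Aut: group "AutoGroup G" by (rule AutoGroup)
  interpret Bij: group "BijGroup (carrier G)" by (rule group_BijGroup)
  interpret c: group_hom G "BijGroup (carrier G)" "\<lambda>g. \<lambda>h\<in>carrier G. g \<otimes> h \<otimes> inv g"
    using conjugation_is_hom by unfold_locales
  have carr: "carrier (AutoGroup G) = auto G" by (simp add: AutoGroup_def)
  have sub: "subgroup (Inn G) (AutoGroup G)"
    unfolding AutoGroup_def
    by (rule Bij.subgroup_incl)
      (use Inn_subset_auto subgroup_auto c.img_is_subgroup in \<open>auto simp: Inn_def\<close>)
  show ?thesis
  proof (rule Aut.normal_invI[OF sub])
    fix f a
    assume f: "f \<in> Inn G" and a: "a \<in> carrier (AutoGroup G)"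
    from f obtain g where g: "g \<in> carrier G" "f = (\<lambda>h\<in>carrier G. g \<otimes> h \<otimes> inv g)"
      by (auto simp: Inn_def)
    have aBij: "a \<in> Bij (carrier G)" and ahom: "a \<in> hom G G" using a by (auto simp: carr auto_def)
    interpret a: group_hom G G a using ahom by unfold_locales
    define k where "k = (\<lambda>h\<in>carrier G. a g \<otimes> h \<otimes> inv (a g))"
    have k: "k \<in> Inn G" using g by (auto simp: k_def Inn_def)
    have fA: "f \<in> carrier (AutoGroup G)" and kA: "k \<in> carrier (AutoGroup G)"
      using f k sub subgroup.subset by blast+
    have mult: "x \<otimes>\<^bsub>AutoGroup G\<^esub> y = compose (carrier G) x y"
      if "x \<in> carrier (AutoGroup G)" "y \<in> carrier (AutoGroup G)" for x y
      using that by (simp add: carr auto_def) (simp add: AutoGroup_def BijGroup_def)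
    have "compose (carrier G) a f = compose (carrier G) k a"
      using g by (auto simp: compose_def k_def fun_eq_iff restrict_def)
    then have "a \<otimes>\<^bsub>AutoGroup G\<^esub> f = k \<otimes>\<^bsub>AutoGroup G\<^esub> a"
      using a fA kA by (simp add: mult)
    then have "a \<otimes>\<^bsub>AutoGroup G\<^esub> f \<otimes>\<^bsub>AutoGroup G\<^esub> inv\<^bsub>AutoGroup G\<^esub> a = k"
      using a fA kA by (metis Aut.inv_solve_right' Aut.m_closed)
    then show "a \<otimes>\<^bsub>AutoGroup G\<^esub> f \<otimes>\<^bsub>AutoGroup G\<^esub> inv\<^bsub>AutoGroup G\<^esub> a \<in> Inn G"
      using k by simp
  qed
qed

lemma group_OutGroup: "group (OutGroup G)"
  unfolding OutGroup_def by (rule normal.factorgroup_is_group[OF Inn_normal])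

end

end

theory Submission
  imports Defs "HOL-Library.Function_Algebras"
begin

text \<open>
  Inverting the generators in a set \<open>S\<close> of vertices gives, as \<open>S\<close> varies, a subgroup
  \<open>(\<int>/2)\<^sup>n\<close> of \<open>Out(A\<^sub>\<Gamma>)\<close>, where \<open>n\<close> is the number of vertices of \<open>\<Gamma>\<close>. So it suffices that an
  elementary abelian 2-subgroup of \<open>Out(A\<^sub>\<Gamma>)\<close> has rank at most \<open>n\<close>, for every graph
  (\<open>out_elementary_abelian_2_card\<close>). Exponent sums define a homomorphism from \<open>Out(A\<^sub>\<Gamma>)\<close> to
  \<open>GL\<^sub>n(\<int>)\<close>. Commuting involutions are simultaneously diagonalisable over \<open>\<real>\<close>, so there are at most
  \<open>2\<^sup>n\<close> of them (\<open>commuting_involutions_card\<close>), and what remains is that the kernel of this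
  homomorphism has no element of order 2: if an endomorphism \<open>\<phi>\<close> of \<open>A\<^sub>\<Gamma>\<close> preserves all exponent sums
  and \<open>\<phi>\<^sup>2\<close> is conjugation by some \<open>g\<close>, then \<open>\<phi>\<close> is inner (\<open>square_inner_imp_inner\<close>).

  The tool for this are polynomial functions \<open>A\<^sub>\<Gamma> \<rightarrow> \<int>\<close>, the functions whose linear extension to the
  group ring kills a power of the augmentation ideal. An endomorphism that preserves exponent sums
  acts unipotently on them: passing from \<open>f\<close> to \<open>f \<circ> \<phi> - f\<close> lowers the degree. Since there is no
  2-torsion in \<open>\<int>\<close>, a unipotent \<open>\<phi>\<close> fixes every polynomial function that \<open>\<phi>\<^sup>2\<close> fixes, and two
  unipotent endomorphisms with the same square agree on all polynomial functions. Polynomial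
  functions are abundant: they include the coefficients of the Magnus expansion
  \<open>v \<mapsto> 1 + X\<^sub>v\<close>, in power series whose variables commute when the vertices are adjacent. These
  coefficients separate the elements of \<open>A\<^sub>\<Gamma>\<close>, and summed over a class of words closed under
  rotation they give functions that are constant on conjugacy classes.

  Let \<open>x\<close> be the product of all generators. Polynomial class functions are fixed by \<open>\<phi>\<^sup>2\<close>, hence by
  \<open>\<phi>\<close>, and they force \<open>\<phi> x\<close> to be conjugate to \<open>x\<close> (\<open>conjugate_coxeter\<close>). After composing \<open>\<phi>\<close>
  with an inner automorphism, \<open>\<phi> x = x\<close>, and therefore \<open>g\<close> commutes with \<open>x\<close>. An element that
  commutes with \<open>x\<close> is determined by its exponent sums (\<open>commutes_coxeter_balanced\<close>). The exponent
  sums of \<open>g\<close> agree at non-adjacent vertices, and those at vertices that are not central are even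
  (\<open>even_exp_sum_of_square_inner\<close>). So they are realised by \<open>h\<^sup>2z\<close> with \<open>h\<close> commuting with \<open>x\<close>
  and \<open>z\<close> central, whence \<open>g = h\<^sup>2z\<close>. Now \<open>\<phi>\<close> and conjugation by \<open>h\<close> have the same square, so they
  agree on polynomial functions, and hence coincide.
\<close>

section \<open>Polynomial functions on a group\<close>

text \<open>Degree less than \<open>k\<close>: all \<open>k\<close>-fold differences under left translation vanish on the carrier. The
  zero function is the only one at index \<open>0\<close>, and index \<open>1\<close> gives the constants.\<close>

primrec polynomial_fun :: "('g, 'm) monoid_scheme \<Rightarrow> nat \<Rightarrow> ('g \<Rightarrow> int) \<Rightarrow> bool" where
  "polynomial_fun G 0 f \<longleftrightarrow> (\<forall>b\<in>carrier G. f b = 0)"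
| "polynomial_fun G (Suc k) f \<longleftrightarrow> (\<forall>a\<in>carrier G. polynomial_fun G k (\<lambda>b. f (a \<otimes>\<^bsub>G\<^esub> b) - f b))"

definition conj_by :: "('g, 'm) monoid_scheme \<Rightarrow> 'g \<Rightarrow> 'g \<Rightarrow> 'g" where
  "conj_by G g a = g \<otimes>\<^bsub>G\<^esub> a \<otimes>\<^bsub>G\<^esub> inv\<^bsub>G\<^esub> g"

context group
begin

lemma conj_by_closed [simp]: "g \<in> carrier G \<Longrightarrow> a \<in> carrier G \<Longrightarrow> conj_by G g a \<in> carrier G"
  by (simp add: conj_by_def)

lemma conj_by_one [simp]: "a \<in> carrier G \<Longrightarrow> conj_by G \<one> a = a"
  by (simp add: conj_by_def)

lemma conj_by_conj_by:
  "g \<in> carrier G \<Longrightarrow> h \<in> carrier G \<Longrightarrow> a \<in> carrier G \<Longrightarrow>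
    conj_by G g (conj_by G h a) = conj_by G (g \<otimes> h) a"
  by (simp add: conj_by_def m_assoc inv_mult_group)

lemma conj_by_hom: "g \<in> carrier G \<Longrightarrow> conj_by G g \<in> hom G G"
  by (rule homI) (simp_all add: conj_by_def m_assoc flip: m_assoc[of "inv g" g])

lemma hom_conj_by:
  "\<phi> \<in> hom G G \<Longrightarrow> g \<in> carrier G \<Longrightarrow> a \<in> carrier G \<Longrightarrow>
    \<phi> (conj_by G g a) = conj_by G (\<phi> g) (\<phi> a)"
  using group_hom.hom_inv[of G G \<phi> g] hom_in_carrier[of \<phi> G G]
  by (simp add: conj_by_def hom_mult group_hom_def group_hom_axioms_def is_group)

lemma polynomial_fun_cong:
  "(\<And>b. b \<in> carrier G \<Longrightarrow> f b = h b) \<Longrightarrow> polynomial_fun G k f \<longleftrightarrow> polynomial_fun G k h"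
proof (induction k arbitrary: f h)
  case (Suc k)
  have "polynomial_fun G k (\<lambda>b. f (a \<otimes> b) - f b) \<longleftrightarrow> polynomial_fun G k (\<lambda>b. h (a \<otimes> b) - h b)"
    if "a \<in> carrier G" for a
    by (rule Suc.IH) (simp add: Suc.prems that)
  then show ?case by simp
qed simp

lemma polynomial_fun_zero [simp]: "polynomial_fun G k (\<lambda>b. 0)"
  by (induction k) auto

lemma polynomial_fun_lincomb:
  "polynomial_fun G k f \<Longrightarrow> polynomial_fun G k h \<Longrightarrow> polynomial_fun G k (\<lambda>b. c * f b + d * h b)"
proof (induction k arbitrary: f h)
  case (Suc k)
  have "polynomial_fun G k (\<lambda>b. c * (f (a \<otimes> b) - f b) + d * (h (a \<otimes> b) - h b))"
    if "a \<in> carrier G" for a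
    by (rule Suc.IH) (use Suc.prems that in auto)
  then show ?case by (simp add: algebra_simps)
qed simp

lemma polynomial_fun_add:
  "polynomial_fun G k f \<Longrightarrow> polynomial_fun G k h \<Longrightarrow> polynomial_fun G k (\<lambda>b. f b + h b)"
  using polynomial_fun_lincomb[of k f h 1 1] by simp

lemma polynomial_fun_diff:
  "polynomial_fun G k f \<Longrightarrow> polynomial_fun G k h \<Longrightarrow> polynomial_fun G k (\<lambda>b. f b - h b)"
  using polynomial_fun_lincomb[of k f h 1 "-1"] by simp

lemma polynomial_fun_halve: "polynomial_fun G k (\<lambda>b. 2 * f b) \<Longrightarrow> polynomial_fun G k f"
proof (induction k arbitrary: f)
  case (Suc k)
  have "polynomial_fun G k (\<lambda>b. 2 * (f (a \<otimes> b) - f b))" if "a \<in> carrier G" for a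
    using Suc.prems that by (simp add: algebra_simps)
  then show ?case using Suc.IH by simp
qed simp

lemma polynomial_fun_Suc: "polynomial_fun G k f \<Longrightarrow> polynomial_fun G (Suc k) f"
  by (induction k arbitrary: f) auto

lemma polynomial_fun_translate:
  assumes "polynomial_fun G k f" "a \<in> carrier G"
  shows "polynomial_fun G k (\<lambda>b. f (a \<otimes> b))"
proof (cases k)
  case (Suc j)
  have "polynomial_fun G j (\<lambda>b. f (a \<otimes> b) - f b)"
    using assms by (simp add: Suc)
  then have "polynomial_fun G k (\<lambda>b. f (a \<otimes> b) - f b)"
    unfolding Suc by (rule polynomial_fun_Suc)
  from polynomial_fun_add[OF this assms(1)] show ?thesis by simp
qed (use assms in simp)

text \<open>A homomorphism maps the augmentation ideal into itself, so it pulls polynomial functions back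
  without raising the degree.\<close>

lemma polynomial_fun_hom:
  assumes "\<phi> \<in> hom G G"
  shows "polynomial_fun G k f \<Longrightarrow> polynomial_fun G k (\<lambda>b. f (\<phi> b))"
proof (induction k arbitrary: f)
  case 0
  then show ?case using assms by (simp add: hom_in_carrier)
next
  case (Suc k)
  show ?case unfolding polynomial_fun.simps
  proof
    fix a assume a: "a \<in> carrier G"
    then have "polynomial_fun G k (\<lambda>b. f (\<phi> a \<otimes> b) - f b)"
      using Suc.prems assms by (simp add: hom_in_carrier)
    from Suc.IH[OF this] show "polynomial_fun G k (\<lambda>b. f (\<phi> (a \<otimes> b)) - f (\<phi> b))"
      using polynomial_fun_cong[of "\<lambda>b. f (\<phi> (a \<otimes> b)) - f (\<phi> b)" "\<lambda>b. f (\<phi> a \<otimes> \<phi> b) - f (\<phi> b)" k]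
        assms a by (simp add: hom_mult)
  qed
qed

text \<open>What is used of an element \<open>c\<close> such that \<open>c - 1\<close> lies in the square of the augmentation ideal.\<close>

definition second_order :: "'a \<Rightarrow> bool" where
  "second_order c \<longleftrightarrow> c \<in> carrier G \<and>
    (\<forall>k f. polynomial_fun G (Suc (Suc k)) f \<longrightarrow> polynomial_fun G k (\<lambda>b. f (c \<otimes> b) - f b))"

lemma second_orderD:
  "second_order c \<Longrightarrow> polynomial_fun G (Suc (Suc k)) f \<Longrightarrow>
    polynomial_fun G k (\<lambda>b. f (c \<otimes> b) - f b)"
  unfolding second_order_def by blast

definition unipotent :: "('a \<Rightarrow> 'a) \<Rightarrow> bool" where
  "unipotent \<phi> \<longleftrightarrow> \<phi> \<in> hom G G \<and>
    (\<forall>k f. polynomial_fun G (Suc k) f \<longrightarrow> polynomial_fun G k (\<lambda>b. f (\<phi> b) - f b))"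

text \<open>Writing \<open>\<phi> a = c a\<close>, the difference of \<open>f \<circ> \<phi> - f\<close> along \<open>a\<close> splits into the same expression for
  the difference of \<open>f\<close> along \<open>a\<close>, which has lower degree, and a difference of \<open>f\<close> along \<open>c\<close>,
  which drops the degree by two.\<close>

lemma unipotentI:
  assumes \<phi>: "\<phi> \<in> hom G G"
    and so: "\<And>a. a \<in> carrier G \<Longrightarrow> second_order (\<phi> a \<otimes> inv a)"
  shows "unipotent \<phi>"
proof -
  have \<phi>c: "\<phi> a \<in> carrier G" if "a \<in> carrier G" for a using \<phi> that by (rule hom_in_carrier)
  have "polynomial_fun G k (\<lambda>b. f (\<phi> b) - f b)" if "polynomial_fun G (Suc k) f" for k f
    using that
  proof (induction k arbitrary: f)
    case 0
    have const: "f b = f \<one>" if "b \<in> carrier G" for b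
    proof -
      have "f (b \<otimes> \<one>) - f \<one> = 0" using 0 that by (simp only: polynomial_fun.simps one_closed Ball_def)
      then show ?thesis using that by simp
    qed
    have "f (\<phi> b) - f b = 0" if "b \<in> carrier G" for b
      by (simp only: const[OF that] const[OF \<phi>c[OF that]] diff_self)
    then show ?case by simp
  next
    case (Suc k)
    show ?case unfolding polynomial_fun.simps
    proof
      fix a assume a: "a \<in> carrier G"
      define c where "c = \<phi> a \<otimes> inv a"
      have c: "c \<in> carrier G" "c \<otimes> a = \<phi> a" using a \<phi> by (simp_all add: c_def m_assoc \<phi>c)
      have 1: "polynomial_fun G k (\<lambda>b. (f (a \<otimes> \<phi> b) - f (\<phi> b)) - (f (a \<otimes> b) - f b))"
        by (rule Suc.IH[of "\<lambda>b. f (a \<otimes> b) - f b"])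
          (use Suc.prems a in \<open>simp only: polynomial_fun.simps(2)[of _ "Suc k"] Ball_def\<close>)
      have "polynomial_fun G k (\<lambda>b. f (c \<otimes> b) - f b)"
        unfolding c_def by (rule second_orderD[OF so[OF a] Suc.prems])
      from polynomial_fun_translate[OF this a]
      have "polynomial_fun G k (\<lambda>b. f (c \<otimes> (a \<otimes> b)) - f (a \<otimes> b))" .
      from polynomial_fun_hom[OF \<phi> this]
      have 2: "polynomial_fun G k (\<lambda>b. f (c \<otimes> (a \<otimes> \<phi> b)) - f (a \<otimes> \<phi> b))" .
      from polynomial_fun_add[OF 1 2]
      show "polynomial_fun G k (\<lambda>b. f (\<phi> (a \<otimes> b)) - f (a \<otimes> b) - (f (\<phi> b) - f b))"
        by (rule polynomial_fun_cong[THEN iffD1, rotated])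
           (use a c \<phi> in \<open>simp add: hom_mult m_assoc[symmetric] \<phi>c\<close>)
    qed
  qed
  then show ?thesis using \<phi> by (simp add: unipotent_def)
qed

lemma unipotent_lowers:
  "unipotent \<phi> \<Longrightarrow> polynomial_fun G (Suc k) f \<Longrightarrow> polynomial_fun G k (\<lambda>b. f (\<phi> b) - f b)"
  by (simp add: unipotent_def)

text \<open>The error \<open>d = f \<circ> \<phi> - f\<close> satisfies \<open>d \<circ> \<phi> = - d\<close>, so \<open>- 2 d = d \<circ> \<phi> - d\<close> has smaller degree
  than \<open>d\<close>. Repeating this brings the degree down to that of the zero function.\<close>

lemma unipotent_involution_fixes:
  assumes u: "unipotent \<phi>" and f: "polynomial_fun G k f"
    and ff: "\<And>a. a \<in> carrier G \<Longrightarrow> f (\<phi> (\<phi> a)) = f a"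
    and a: "a \<in> carrier G"
  shows "f (\<phi> a) = f a"
proof -
  have \<phi>: "\<phi> \<in> hom G G" using u by (simp add: unipotent_def)
  define d where "d b = f (\<phi> b) - f b" for b
  have "polynomial_fun G k d" unfolding d_def
    by (rule polynomial_fun_diff[OF polynomial_fun_hom[OF \<phi> f] f])
  moreover have "polynomial_fun G (k - j) d" if "polynomial_fun G k d" for j
  proof (induction j)
    case (Suc j)
    show ?case
    proof (cases "k - j")
      case 0
      then show ?thesis using Suc by (metis diff_is_0_eq le_SucI)
    next
      case (Suc i)
      then have "polynomial_fun G i (\<lambda>b. d (\<phi> b) - d b)"
        using Suc.IH unipotent_lowers[OF u] by metis
      from polynomial_fun_lincomb[OF this polynomial_fun_zero, of "-1" 0]
      have "polynomial_fun G i (\<lambda>b. 2 * d b)"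
        by (rule polynomial_fun_cong[THEN iffD1, rotated]) (simp add: d_def ff)
      then show ?thesis using polynomial_fun_halve Suc
        by (metis Suc_diff_Suc diff_Suc_1 zero_less_Suc zero_less_diff)
    qed
  qed (use that in simp)
  ultimately have "polynomial_fun G (k - k) d" by blast
  then show ?thesis using a by (simp add: d_def)
qed

text \<open>Unipotent operators have at most one square root. With \<open>U\<close> and \<open>H\<close> the operators of composition
  with \<open>\<phi>\<close> and \<open>\<eta>\<close> and \<open>D = U - H\<close>, the equation \<open>U\<^sup>2 = H\<^sup>2\<close> reads \<open>U D + D H = 0\<close>, that is
  \<open>2 D = - ((U - 1) D + D (H - 1))\<close>. So if \<open>D\<close> lowers degrees by \<open>j\<close>, it lowers them by \<open>j + 1\<close>.\<close>

lemma unipotent_square_eq: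
  assumes \<phi>: "unipotent \<phi>" and \<eta>: "unipotent \<eta>"
    and eq: "\<And>a. a \<in> carrier G \<Longrightarrow> \<phi> (\<phi> a) = \<eta> (\<eta> a)"
    and f: "polynomial_fun G k f" and a: "a \<in> carrier G"
  shows "f (\<phi> a) = f (\<eta> a)"
proof -
  have h: "\<phi> \<in> hom G G" "\<eta> \<in> hom G G" using \<phi> \<eta> by (simp_all add: unipotent_def)
  have "polynomial_fun G k (\<lambda>b. f (\<phi> b) - f (\<eta> b))" if "polynomial_fun G (k + j) f" for j k f
    using that
  proof (induction j arbitrary: k f)
    case 0
    then have f: "polynomial_fun G k f" by simp
    show ?case
      by (rule polynomial_fun_diff[OF polynomial_fun_hom[OF h(1) f] polynomial_fun_hom[OF h(2) f]])
  next
    case (Suc j)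
    have "polynomial_fun G (Suc k) (\<lambda>b. f (\<phi> b) - f (\<eta> b))"
      using Suc.IH[of "Suc k" f] Suc.prems by simp
    note 1 = unipotent_lowers[OF \<phi> this]
    have "polynomial_fun G (k + j) (\<lambda>b. f (\<eta> b) - f b)"
      using unipotent_lowers[OF \<eta>] Suc.prems by simp
    note 2 = Suc.IH[OF this]
    from polynomial_fun_lincomb[OF 1 2, of "-1" "-1"]
    have "polynomial_fun G k (\<lambda>b. 2 * (f (\<phi> b) - f (\<eta> b)))"
      by (rule polynomial_fun_cong[THEN iffD1, rotated]) (simp add: eq)
    then show ?case by (rule polynomial_fun_halve)
  qed
  from this[of 0 k f] f a show ?thesis by simp
qed

end

section \<open>Right-angled Artin groups: generators and exponent sums\<close>

context graph
begin

abbreviation "V \<equiv> verts G"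
abbreviation "A \<equiv> raag G"
abbreviation mult_raag (infixl "\<cdot>" 70) where "a \<cdot> b \<equiv> a \<otimes>\<^bsub>raag G\<^esub> b"

definition commutations :: "('a word \<times> 'a word) set" where
  "commutations = {([(u, True), (v, True)], [(v, True), (u, True)]) | u v. u \<rightarrow>\<^bsub>G\<^esub> v}"

definition cls :: "'a word \<Rightarrow> 'a word set" where
  "cls w = word_rel V commutations `` {w}"

definition gen :: "'a \<Rightarrow> 'a word set" where
  "gen v = cls [(v, True)]"

interpretation raag: group A by (rule group_raag)

lemma raag_eq: "A = presented_group V commutations"
  by (simp add: raag_def commutations_def)

lemma adj_sym: "u \<rightarrow>\<^bsub>G\<^esub> v \<Longrightarrow> v \<rightarrow>\<^bsub>G\<^esub> u"
  using arcs_ends_symmetric[OF sym_arcs] by simp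

lemma adj_irrefl: "\<not> v \<rightarrow>\<^bsub>G\<^esub> v"
  using adj_not_same by blast

lemma carrierE:
  assumes "a \<in> carrier A"
  obtains w where "w \<in> words V" "a = cls w"
  using assms by (auto simp: raag_eq carrier_presented_group cls_def)

lemma cls_closed [simp]: "w \<in> words V \<Longrightarrow> cls w \<in> carrier A"
  by (auto simp: raag_eq carrier_presented_group cls_def)

lemma cls_append: "v \<in> words V \<Longrightarrow> w \<in> words V \<Longrightarrow> cls (v @ w) = cls v \<cdot> cls w"
  by (simp add: raag_eq cls_def presented_group_mult)

lemma cls_Nil: "cls [] = \<one>\<^bsub>A\<^esub>"
  by (simp add: raag_eq cls_def one_presented_group)

lemma cls_Cons: "fst a \<in> V \<Longrightarrow> w \<in> words V \<Longrightarrow> cls (a # w) = cls [a] \<cdot> cls w"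
  using cls_append[of "[a]" w] by simp

lemma gen_closed [simp]: "v \<in> V \<Longrightarrow> gen v \<in> carrier A"
  by (simp add: gen_def)

lemma cls_eqI: "(v, w) \<in> word_rel V commutations \<Longrightarrow> cls v = cls w"
  unfolding cls_def by (rule equiv_class_eq[OF equiv_word_rel])

lemma cls_inverse_letter: "v \<in> V \<Longrightarrow> cls [(v, False)] = inv\<^bsub>A\<^esub> gen v"
proof (rule raag.inv_equality[symmetric])
  assume v: "v \<in> V"
  have "([] @ [(v, False), (v, \<not> False)] @ [], [] @ []) \<in> word_rel V commutations"
    by (rule word_rel.cancel) (use v in auto)
  from cls_eqI[OF this] show "cls [(v, False)] \<cdot> gen v = \<one>\<^bsub>A\<^esub>"
    using v cls_append[of "[(v, False)]" "[(v, True)]"] by (simp add: cls_Nil gen_def)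
qed auto

lemma gen_commute: "u \<rightarrow>\<^bsub>G\<^esub> v \<Longrightarrow> gen u \<cdot> gen v = gen v \<cdot> gen u"
proof -
  assume uv: "u \<rightarrow>\<^bsub>G\<^esub> v"
  then have V: "u \<in> V" "v \<in> V" by (auto dest: adj_in_verts)
  have "([] @ [(u, True), (v, True)] @ [], [] @ [(v, True), (u, True)] @ []) \<in> word_rel V commutations"
    by (rule word_rel.relation) (use uv V in \<open>auto simp: commutations_def\<close>)
  from cls_eqI[OF this] show ?thesis
    using V cls_append[of "[(u, True)]" "[(v, True)]"] cls_append[of "[(v, True)]" "[(u, True)]"]
    by (simp add: gen_def)
qed

lemma raag_induct [consumes 1, case_names one gen inv]:
  assumes "a \<in> carrier A" and "P \<one>\<^bsub>A\<^esub>"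
    and gen: "\<And>v b. v \<in> V \<Longrightarrow> b \<in> carrier A \<Longrightarrow> P b \<Longrightarrow> P (gen v \<cdot> b)"
    and inv: "\<And>v b. v \<in> V \<Longrightarrow> b \<in> carrier A \<Longrightarrow> P b \<Longrightarrow> P (inv\<^bsub>A\<^esub> gen v \<cdot> b)"
  shows "P a"
proof -
  have "P (cls w)" if "w \<in> words V" for w
    using that
  proof (induction w)
    case Nil
    then show ?case using assms by (simp add: cls_Nil)
  next
    case (Cons a w)
    obtain v b where a: "a = (v, b)" by (cases a)
    have "v \<in> V" "w \<in> words V" using Cons.prems a by auto
    then show ?case using Cons gen[of v "cls w"] inv[of v "cls w"] a cls_Cons[of a w]
      by (cases b) (auto simp: gen_def[symmetric] cls_inverse_letter)
  qed
  then show ?thesis using assms(1) by (auto elim: carrierE)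
qed

definition descend :: "('a word \<Rightarrow> 'c) \<Rightarrow> 'a word set \<Rightarrow> 'c" where
  "descend F a = F (SOME w. w \<in> a)"

lemma descend_cls:
  assumes "\<And>w w'. (w, w') \<in> word_rel V commutations \<Longrightarrow> F w = F w'" "w \<in> words V"
  shows "descend F (cls w) = F w"
proof -
  have "w \<in> cls w" using assms(2) by (auto simp: cls_def intro: word_rel.refl)
  then have "(SOME w'. w' \<in> cls w) \<in> cls w" by (rule someI)
  then show ?thesis using assms(1) by (auto simp: descend_def cls_def)
qed

definition letter_exp :: "'a \<Rightarrow> 'a \<times> bool \<Rightarrow> int" where
  "letter_exp u a = (if fst a = u then if snd a then 1 else -1 else 0)"

definition word_exp :: "'a \<Rightarrow> 'a word \<Rightarrow> int" where
  "word_exp u w = sum_list (map (letter_exp u) w)"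

definition exp_sum :: "'a \<Rightarrow> 'a word set \<Rightarrow> int" where
  "exp_sum u = descend (word_exp u)"

lemma word_exp_simps [simp]:
  "word_exp u [] = 0" "word_exp u (a # w) = letter_exp u a + word_exp u w"
  "word_exp u (w @ w') = word_exp u w + word_exp u w'"
  by (simp_all add: word_exp_def)

lemma word_exp_cong: "(w, w') \<in> word_rel V commutations \<Longrightarrow> word_exp u w = word_exp u w'"
  by (induction rule: word_rel.induct) (auto simp: letter_exp_def commutations_def)

lemma exp_sum_cls: "w \<in> words V \<Longrightarrow> exp_sum u (cls w) = word_exp u w"
  unfolding exp_sum_def by (rule descend_cls) (rule word_exp_cong)

lemma exp_sum_mult [simp]:
  "a \<in> carrier A \<Longrightarrow> b \<in> carrier A \<Longrightarrow> exp_sum u (a \<cdot> b) = exp_sum u a + exp_sum u b"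
  by (auto elim!: carrierE simp: exp_sum_cls simp flip: cls_append)

lemma exp_sum_one [simp]: "exp_sum u \<one>\<^bsub>A\<^esub> = 0"
  using exp_sum_cls[of "[]"] by (simp add: cls_Nil)

lemma exp_sum_inv [simp]: "a \<in> carrier A \<Longrightarrow> exp_sum u (inv\<^bsub>A\<^esub> a) = - exp_sum u a"
  using exp_sum_mult[of a "inv\<^bsub>A\<^esub> a" u] by simp

lemma exp_sum_gen [simp]: "v \<in> V \<Longrightarrow> exp_sum u (gen v) = (if v = u then 1 else 0)"
  by (simp add: gen_def exp_sum_cls letter_exp_def)

lemma exp_sum_conj_by [simp]:
  "g \<in> carrier A \<Longrightarrow> a \<in> carrier A \<Longrightarrow> exp_sum u (conj_by A g a) = exp_sum u a"
  by (simp add: conj_by_def)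

lemma exp_sum_int_pow [simp]:
  assumes "a \<in> carrier A" shows "exp_sum u (a [^]\<^bsub>A\<^esub> (k::int)) = k * exp_sum u a"
proof -
  have nat: "exp_sum u (a [^]\<^bsub>A\<^esub> n) = int n * exp_sum u a" for n :: nat
    by (induction n) (use assms in \<open>auto simp: algebra_simps\<close>)
  show ?thesis using assms
    by (cases k rule: int_cases2)
      (simp_all add: int_pow_int raag.int_pow_neg nat)
qed

text \<open>Modulo the square of the augmentation ideal, \<open>a \<mapsto> a - 1\<close> is additive. So \<open>c - 1\<close> is there the
  sum of the \<open>v - 1\<close>, each taken as often as the exponent sum of \<open>v\<close> in \<open>c\<close> says.\<close>

lemma second_order_exp_sum:
  assumes "c \<in> carrier A" and "\<And>v. v \<in> V \<Longrightarrow> exp_sum v c = 0"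
  shows "raag.second_order c"
proof -
  have "polynomial_fun A k (\<lambda>b. f (c \<cdot> b) - f b)" if f: "polynomial_fun A (Suc (Suc k)) f" for k f
  proof -
    have D: "polynomial_fun A (Suc k) (\<lambda>b. f (a \<cdot> b) - f b)" if "a \<in> carrier A" for a
      using f that by simp
    have DD: "polynomial_fun A k (\<lambda>b. (f (a \<cdot> (a' \<cdot> b)) - f (a' \<cdot> b)) - (f (a \<cdot> b) - f b))"
      if "a \<in> carrier A" "a' \<in> carrier A" for a a'
      using D[OF that(1)] that by simp
    have "polynomial_fun A k
        (\<lambda>b. (f (c \<cdot> b) - f b) - (\<Sum>v\<in>V. exp_sum v c * (f (gen v \<cdot> b) - f b)))"
      using assms(1)
    proof (induction c rule: raag_induct)
      case one
      show ?case
        by (rule raag.polynomial_fun_cong[THEN iffD1, OF _ raag.polynomial_fun_zero]) simp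
    next
      case (gen v a)
      have sum: "(\<Sum>w\<in>V. exp_sum w (gen v \<cdot> a) * h w) = h v + (\<Sum>w\<in>V. exp_sum w a * h w)"
        for h
      proof -
        have "(\<Sum>w\<in>V. exp_sum w (gen v \<cdot> a) * h w)
            = (\<Sum>w\<in>V. (if v = w then h w else 0) + exp_sum w a * h w)"
          using gen by (intro sum.cong) (auto simp: algebra_simps)
        then show ?thesis using gen(1) by (simp add: sum.distrib)
      qed
      show ?case
        by (rule raag.polynomial_fun_cong[THEN iffD1, OF _
              raag.polynomial_fun_add[OF DD[of "gen v" a] gen.IH]])
          (use gen in \<open>auto simp: sum raag.m_assoc simp del: exp_sum_mult\<close>)
    next
      case (inv v a)
      have sum: "(\<Sum>w\<in>V. exp_sum w (inv\<^bsub>A\<^esub> gen v \<cdot> a) * h w) = - h v + (\<Sum>w\<in>V. exp_sum w a * h w)"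
        for h
      proof -
        have "(\<Sum>w\<in>V. exp_sum w (inv\<^bsub>A\<^esub> gen v \<cdot> a) * h w)
            = (\<Sum>w\<in>V. (if v = w then - h w else 0) + exp_sum w a * h w)"
          using inv by (intro sum.cong) (auto simp: algebra_simps)
        then show ?thesis using inv(1) by (simp add: sum.distrib)
      qed
      have cancel: "gen v \<cdot> (inv\<^bsub>A\<^esub> gen v \<cdot> b) = b" if "b \<in> carrier A" for b
        using inv(1) that by (simp flip: raag.m_assoc)
      show ?case
        by (rule raag.polynomial_fun_cong[THEN iffD1, OF _
              raag.polynomial_fun_add[OF raag.polynomial_fun_diff[OF
                DD[of "inv\<^bsub>A\<^esub> gen v" a] DD[of "gen v" "inv\<^bsub>A\<^esub> gen v"]] inv.IH]])
          (use inv in \<open>auto simp: sum raag.m_assoc cancel simp del: exp_sum_mult\<close>)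
    qed
    then show ?thesis using assms(2) by simp
  qed
  then show ?thesis using assms(1) by (simp add: raag.second_order_def)
qed

text \<open>The number of pairs of a letter \<open>u\<close> and a later letter \<open>v\<close>, counted with signs. For non-adjacent
  \<open>u\<close> and \<open>v\<close> it is the coefficient of \<open>X\<^sub>u X\<^sub>v\<close> in the Magnus expansion, equivalently the corner
  entry of a homomorphism to the integral Heisenberg group.\<close>

primrec word_cross :: "'a \<Rightarrow> 'a \<Rightarrow> 'a word \<Rightarrow> int" where
  "word_cross u v [] = 0"
| "word_cross u v (a # w) = letter_exp u a * word_exp v w + word_cross u v w"

definition cross :: "'a \<Rightarrow> 'a \<Rightarrow> 'a word set \<Rightarrow> int" where
  "cross u v = descend (word_cross u v)"

lemma word_cross_append [simp]:
  "word_cross u v (w @ w') = word_cross u v w + word_cross u v w' + word_exp u w * word_exp v w'"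
  by (induction w) (auto simp: algebra_simps)

lemma word_cross_cong:
  assumes "u \<noteq> v" "\<not> u \<rightarrow>\<^bsub>G\<^esub> v"
  shows "(w, w') \<in> word_rel V commutations \<Longrightarrow> word_cross u v w = word_cross u v w'"
proof (induction rule: word_rel.induct)
  case (relation p q l r)
  then show ?case using assms adj_sym by (auto simp: letter_exp_def commutations_def)
qed (use assms in \<open>auto simp: letter_exp_def algebra_simps\<close>)

context
  fixes u v
  assumes uv: "u \<noteq> v" "\<not> u \<rightarrow>\<^bsub>G\<^esub> v"
begin

lemma cross_cls: "w \<in> words V \<Longrightarrow> cross u v (cls w) = word_cross u v w"
  unfolding cross_def by (rule descend_cls) (rule word_cross_cong[OF uv])

lemma cross_mult:
  "a \<in> carrier A \<Longrightarrow> b \<in> carrier A \<Longrightarrow>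
    cross u v (a \<cdot> b) = cross u v a + cross u v b + exp_sum u a * exp_sum v b"
  by (auto elim!: carrierE simp: exp_sum_cls cross_cls simp flip: cls_append)

lemma cross_one: "cross u v \<one>\<^bsub>A\<^esub> = 0"
  using cross_cls[of "[]"] by (simp add: cls_Nil)

lemma cross_polynomial: "polynomial_fun A (Suc (Suc (Suc 0))) (cross u v)"
  by (simp add: cross_mult algebra_simps)

end

end

section \<open>The Magnus representation\<close>

text \<open>Power series are used through the functions on words that pair with them. For a function \<open>f\<close> on
  words of vertices, multiplying by \<open>X\<^sub>v\<close> becomes the shift \<open>t \<mapsto> f (v # t)\<close>, so the generator \<open>v\<close>
  acts as \<open>1 + X\<^sub>v\<close> and its inverse as the alternating sum of the powers of \<open>X\<^sub>v\<close>. That sum is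
  finite when \<open>f\<close> vanishes on long words. Commutation of the variables is imposed by restricting to
  functions that do not change when adjacent vertices are swapped.\<close>

primrec letter_act :: "'v \<times> bool \<Rightarrow> ('v list \<Rightarrow> int) \<Rightarrow> 'v list \<Rightarrow> int" where
  "letter_act (v, b) = (\<lambda>f t. if b then f t + f (v # t)
     else \<Sum>j | f (replicate j v @ t) \<noteq> 0. (-1) ^ j * f (replicate j v @ t))"

declare letter_act.simps [simp del]

lemma letter_act_gen [simp]: "letter_act (v, True) f t = f t + f (v # t)"
  by (simp add: letter_act.simps)

definition word_act :: "'v word \<Rightarrow> ('v list \<Rightarrow> int) \<Rightarrow> 'v list \<Rightarrow> int" where
  "word_act = fold letter_act"

definition short_support :: "nat \<Rightarrow> ('v list \<Rightarrow> int) \<Rightarrow> bool" where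
  "short_support n f \<longleftrightarrow> (\<forall>t. n \<le> length t \<longrightarrow> f t = 0)"

lemma word_act_simps [simp]:
  "word_act [] f = f" "word_act (a # w) f = word_act w (letter_act a f)"
  "word_act (w @ w') f = word_act w' (word_act w f)"
  by (simp_all add: word_act_def)

lemma short_support_mono: "short_support m f \<Longrightarrow> m \<le> n \<Longrightarrow> short_support n f"
  by (simp add: short_support_def)

lemma short_support_lincomb:
  "short_support n f \<Longrightarrow> short_support n h \<Longrightarrow> short_support n (\<lambda>t. c * f t + d * h t)"
  by (simp add: short_support_def)

lemma short_support_Cons: "short_support (Suc n) f \<Longrightarrow> short_support n (\<lambda>t. f (v # t))"
  by (simp add: short_support_def)

lemma letter_act_inverse:
  assumes "short_support n f"
  shows "letter_act (v, False) f t = (\<Sum>j<n. (-1) ^ j * f (replicate j v @ t))"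
proof -
  have zero: "f (replicate j v @ t) = 0" if "n \<le> j" for j
    using assms that by (simp add: short_support_def)
  have "{j. f (replicate j v @ t) \<noteq> 0} \<subseteq> {..<n}"
  proof
    fix j assume "j \<in> {j. f (replicate j v @ t) \<noteq> 0}"
    then show "j \<in> {..<n}" using zero[of j] by (cases "n \<le> j") auto
  qed
  then have "(\<Sum>j | f (replicate j v @ t) \<noteq> 0. (-1) ^ j * f (replicate j v @ t))
      = (\<Sum>j<n. (-1) ^ j * f (replicate j v @ t))"
    by (intro sum.mono_neutral_left) auto
  then show ?thesis by (simp add: letter_act.simps)
qed

lemma short_support_letter_act: "short_support n f \<Longrightarrow> short_support n (letter_act a f)"
proof -
  assume f: "short_support n f"
  obtain v b where a: "a = (v, b)" by (cases a)
  have "letter_act a f t = 0" if t: "n \<le> length t" for t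
  proof (cases b)
    case True
    then show ?thesis using f t by (simp add: a short_support_def)
  next
    case False
    then have "letter_act a f t = (\<Sum>j<n. (-1) ^ j * f (replicate j v @ t))"
      using letter_act_inverse[OF f, of v t] by (simp add: a)
    also have "\<dots> = 0"
      by (rule sum.neutral) (use f t in \<open>simp add: short_support_def\<close>)
    finally show ?thesis .
  qed
  then show ?thesis by (simp add: short_support_def)
qed

lemma short_support_word_act: "short_support n f \<Longrightarrow> short_support n (word_act w f)"
  by (induction w arbitrary: f) (auto intro: short_support_letter_act)

lemma letter_act_cancel:
  assumes f: "short_support n f"
  shows "letter_act (v, \<not> b) (letter_act (v, b) f) = f"
proof
  fix t
  have telescope: "(\<Sum>j<m. (-1) ^ j * (x j + x (Suc j))) = x 0 - (-1) ^ m * x m"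
    for m and x :: "nat \<Rightarrow> int"
    by (induction m) (auto simp: algebra_simps)
  have n: "f (replicate n v @ t) = 0" using f by (simp add: short_support_def)
  have *: "(\<Sum>j<n. (-1) ^ j * (f (replicate j v @ t) + f (v # replicate j v @ t))) = f t"
    using telescope[of "\<lambda>j. f (replicate j v @ t)" n] n by simp
  show "letter_act (v, \<not> b) (letter_act (v, b) f) t = f t"
  proof (cases b)
    case True
    then show ?thesis
      using letter_act_inverse[OF short_support_letter_act[OF f, of "(v, True)"], of v t] * by simp
  next
    case False
    have "letter_act (v, \<not> b) (letter_act (v, b) f) t
        = letter_act (v, False) f t + letter_act (v, False) f (v # t)"
      using False by simp
    also have "\<dots> = (\<Sum>j<n. (-1) ^ j * (f (replicate j v @ t) + f (v # replicate j v @ t)))"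
      unfolding letter_act_inverse[OF f]
      by (simp add: sum.distrib[symmetric] distrib_left replicate_app_Cons_same)
    finally show ?thesis using * by simp
  qed
qed

lemma letter_act_lincomb:
  assumes f: "short_support n f" and h: "short_support n h"
  shows "letter_act a (\<lambda>t. c * f t + d * h t) = (\<lambda>t. c * letter_act a f t + d * letter_act a h t)"
proof
  fix t
  obtain v b where a: "a = (v, b)" by (cases a)
  show "letter_act a (\<lambda>t. c * f t + d * h t) t = c * letter_act a f t + d * letter_act a h t"
  proof (cases b)
    case False
    have "letter_act (v, False) (\<lambda>t. c * f t + d * h t) t
        = c * letter_act (v, False) f t + d * letter_act (v, False) h t"
      unfolding letter_act_inverse[OF f] letter_act_inverse[OF h]
        letter_act_inverse[OF short_support_lincomb[OF f h]]
      by (simp add: sum_distrib_left sum.distrib[symmetric] algebra_simps)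
    then show ?thesis using False a by simp
  qed (simp add: a algebra_simps)
qed

lemma word_act_lincomb:
  "short_support n f \<Longrightarrow> short_support n h \<Longrightarrow>
    word_act w (\<lambda>t. c * f t + d * h t) = (\<lambda>t. c * word_act w f t + d * word_act w h t)"
proof (induction w arbitrary: f h)
  case (Cons a w)
  show ?case
    using Cons.IH[OF short_support_letter_act[OF Cons.prems(1), of a]
        short_support_letter_act[OF Cons.prems(2), of a]]
    by (simp add: letter_act_lincomb[OF Cons.prems, of a c d])
qed simp

lemma word_act_add:
  "short_support n f \<Longrightarrow> short_support n h \<Longrightarrow>
    word_act w (\<lambda>t. f t + h t) t = word_act w f t + word_act w h t"
  using word_act_lincomb[of n f h w 1 1] by simp

lemma word_act_diff:
  "short_support n f \<Longrightarrow> short_support n h \<Longrightarrow>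
    word_act w (\<lambda>t. f t - h t) t = word_act w f t - word_act w h t"
  using word_act_lincomb[of n f h w 1 "-1"] by simp

lemma letter_act_append: "letter_act a (\<lambda>t. f (t @ s)) t = letter_act a f (t @ s)"
  by (cases a) (simp add: letter_act.simps)

lemma word_act_append: "word_act w (\<lambda>t. f (t @ s)) t = word_act w f (t @ s)"
proof (induction w arbitrary: f t)
  case (Cons a w)
  have "letter_act a (\<lambda>t. f (t @ s)) = (\<lambda>t. letter_act a f (t @ s))"
    using letter_act_append by blast
  then show ?case using Cons by simp
qed simp

lemma short_support_letter_act_diff:
  assumes f: "short_support (Suc n) f"
  shows "short_support n (\<lambda>t. letter_act a f t - f t)"
proof -
  obtain v b where a: "a = (v, b)" by (cases a)
  have "letter_act a f t - f t = 0" if t: "n \<le> length t" for t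
  proof (cases b)
    case False
    have "letter_act a f t = (\<Sum>j<Suc n. (-1) ^ j * f (replicate j v @ t))"
      using False letter_act_inverse[OF f, of v t] by (simp add: a)
    also have "\<dots> = f t + (\<Sum>j<n. (-1) ^ Suc j * f (replicate (Suc j) v @ t))"
      by (simp add: sum.lessThan_Suc_shift del: sum.lessThan_Suc)
    also have "(\<Sum>j<n. (-1) ^ Suc j * f (replicate (Suc j) v @ t)) = 0"
      by (rule sum.neutral) (use t f in \<open>simp add: short_support_def\<close>)
    finally show ?thesis by simp
  next
    case True
    then show ?thesis using t f by (simp add: short_support_def a)
  qed
  then show ?thesis by (simp add: short_support_def)
qed

text \<open>Every element acts as \<open>1\<close> plus terms of positive degree; this is what makes Magnus coefficients
  polynomial.\<close>

lemma short_support_word_act_diff: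
  "short_support (Suc n) f \<Longrightarrow> short_support n (\<lambda>t. word_act w f t - f t)"
proof (induction w arbitrary: f)
  case (Cons a w)
  have 1: "short_support n (\<lambda>t. word_act w (letter_act a f) t - letter_act a f t)"
    using Cons by (simp add: short_support_letter_act)
  show ?case
    using short_support_lincomb[OF 1 short_support_letter_act_diff[OF Cons.prems, of a], of 1 1] by simp
qed (simp add: short_support_def)

definition swap_invariant :: "('v \<Rightarrow> 'v \<Rightarrow> bool) \<Rightarrow> ('v list \<Rightarrow> int) \<Rightarrow> bool" where
  "swap_invariant r f \<longleftrightarrow> (\<forall>p q u v. r u v \<longrightarrow> f (p @ u # v # q) = f (p @ v # u # q))"

lemma swap_invariantI:
  "(\<And>p q u v. r u v \<Longrightarrow> f (p @ u # v # q) = f (p @ v # u # q)) \<Longrightarrow> swap_invariant r f"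
  unfolding swap_invariant_def by blast

lemma swap_invariantD:
  "swap_invariant r f \<Longrightarrow> r u v \<Longrightarrow> f (p @ u # v # q) = f (p @ v # u # q)"
  unfolding swap_invariant_def by blast

lemma swap_invariant_prepend:
  assumes "swap_invariant r f" shows "swap_invariant r (\<lambda>t. f (s @ t))"
proof (rule swap_invariantI)
  show "f (s @ p @ u # v # q) = f (s @ p @ v # u # q)" if "r u v" for p q u v
    using swap_invariantD[OF assms that, of "s @ p" q]
    by (simp only: append.assoc)
qed

lemma swap_invariant_Cons: "swap_invariant r f \<Longrightarrow> swap_invariant r (\<lambda>t. f (v # t))"
  using swap_invariant_prepend[of r f "[v]"] by simp

lemma swap_invariant_append:
  assumes "swap_invariant r f" shows "swap_invariant r (\<lambda>t. f (t @ s))"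
proof (rule swap_invariantI)
  show "f ((p @ u # v # q) @ s) = f ((p @ v # u # q) @ s)" if "r u v" for p q u v
    using swap_invariantD[OF assms that, of p "q @ s"]
    by (simp only: append.assoc append_Cons)
qed

lemma swap_invariant_lincomb:
  assumes "swap_invariant r f" "swap_invariant r h"
  shows "swap_invariant r (\<lambda>t. c * f t + d * h t)"
proof (rule swap_invariantI)
  show "c * f (p @ u # v # q) + d * h (p @ u # v # q) = c * f (p @ v # u # q) + d * h (p @ v # u # q)"
    if "r u v" for p q u v
    by (simp only: swap_invariantD[OF assms(1) that, of p q] swap_invariantD[OF assms(2) that, of p q])
qed

lemma swap_invariant_letter_act:
  assumes f: "swap_invariant r f" shows "swap_invariant r (letter_act a f)"
proof (rule swap_invariantI)
  fix p q u w assume uw: "r u w"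
  obtain v b where a: "a = (v, b)" by (cases a)
  have *: "f (s @ p @ u # w # q) = f (s @ p @ w # u # q)" for s
    by (rule swap_invariantD[OF swap_invariant_prepend[OF f] uw])
  show "letter_act a f (p @ u # w # q) = letter_act a f (p @ w # u # q)"
    unfolding a letter_act.simps *
    using *[of "[]"] *[of "[v]"] by (simp only: append_Nil append_Cons)
qed

lemma swap_invariant_word_act: "swap_invariant r f \<Longrightarrow> swap_invariant r (word_act w f)"
  by (induction w arbitrary: f) (auto intro: swap_invariant_letter_act)

context graph
begin

interpretation raag: group A by (rule group_raag)

lemma word_act_cong:
  assumes "(w, w') \<in> word_rel V commutations"
  shows "swap_invariant (dominates G) f \<Longrightarrow> short_support n f \<Longrightarrow> word_act w f = word_act w' f"
  using assms
proof (induction arbitrary: f rule: word_rel.induct)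
  case (cancel p q s b)
  have "letter_act (s, \<not> b) (letter_act (s, b) (word_act p f)) = word_act p f"
    by (rule letter_act_cancel[OF short_support_word_act[OF cancel.prems(2)]])
  then show ?case by simp
next
  case (relation p q l r)
  obtain u v where uv: "u \<rightarrow>\<^bsub>G\<^esub> v" "l = [(u, True), (v, True)]" "r = [(v, True), (u, True)]"
    using relation.hyps(3) by (auto simp: commutations_def)
  have "word_act p f (u # v # t) = word_act p f (v # u # t)" for t
    using swap_invariantD[OF swap_invariant_word_act[OF relation.prems(1)] uv(1), of p "[]"] by simp
  then have "letter_act (v, True) (letter_act (u, True) (word_act p f))
      = letter_act (u, True) (letter_act (v, True) (word_act p f))"
    by (simp add: fun_eq_iff)
  then show ?case using uv by simp
qed auto

text \<open>The value at the empty word pairs \<open>f\<close> with the Magnus expansion of the group element; for the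
  indicator of a word it is a coefficient of that expansion.\<close>

definition magnus :: "('a list \<Rightarrow> int) \<Rightarrow> 'a word set \<Rightarrow> int" where
  "magnus f = descend (\<lambda>w. word_act w f [])"

definition admissible :: "nat \<Rightarrow> ('a list \<Rightarrow> int) \<Rightarrow> bool" where
  "admissible n f \<longleftrightarrow> swap_invariant (dominates G) f \<and> short_support n f"

lemma magnus_cls:
  "admissible n f \<Longrightarrow> w \<in> words V \<Longrightarrow> magnus f (cls w) = word_act w f []"
  unfolding magnus_def admissible_def
  by (rule descend_cls) (auto dest: word_act_cong)

lemma magnus_one: "admissible n f \<Longrightarrow> magnus f \<one>\<^bsub>A\<^esub> = f []"
  using magnus_cls[of n f "[]"] by (simp add: cls_Nil)

lemma admissible_lincomb:
  "admissible n f \<Longrightarrow> admissible n h \<Longrightarrow> admissible n (\<lambda>t. c * f t + d * h t)"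
  by (simp add: admissible_def swap_invariant_lincomb short_support_lincomb)

lemma admissible_mono: "admissible m f \<Longrightarrow> m \<le> n \<Longrightarrow> admissible n f"
  by (auto simp: admissible_def intro: short_support_mono)

lemma admissible_word_act: "admissible n f \<Longrightarrow> admissible n (word_act w f)"
  by (simp add: admissible_def swap_invariant_word_act short_support_word_act)

lemma admissible_word_act_diff:
  "admissible (Suc n) f \<Longrightarrow> admissible n (\<lambda>t. word_act w f t - f t)"
  using swap_invariant_lincomb[of _ "word_act w f" f 1 "-1"]
  by (simp add: admissible_def swap_invariant_word_act short_support_word_act_diff)

lemma admissible_Cons: "admissible (Suc n) f \<Longrightarrow> admissible n (\<lambda>t. f (v # t))"
  by (simp add: admissible_def swap_invariant_Cons short_support_Cons)

lemma magnus_polynomial: "admissible n f \<Longrightarrow> polynomial_fun A n (magnus f)"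
proof (induction n arbitrary: f)
  case 0
  have "f = (\<lambda>t. 0)" using 0 by (auto simp: admissible_def short_support_def)
  moreover have "word_act w (\<lambda>t. 0) = (\<lambda>t. 0)" for w :: "'a word"
    using word_act_lincomb[of 0 "\<lambda>t. 0" "\<lambda>t. 0" w 0 0] by (simp add: short_support_def)
  ultimately show ?case using 0 by (auto elim!: carrierE simp: magnus_cls)
next
  case (Suc n)
  show ?case unfolding polynomial_fun.simps
  proof
    fix a assume "a \<in> carrier A"
    then obtain w where w: "w \<in> words V" "a = cls w" by (rule carrierE)
    note d = admissible_word_act_diff[OF Suc.prems, of w]
    from Suc.IH[OF d]
    show "polynomial_fun A n (\<lambda>b. magnus f (a \<cdot> b) - magnus f b)"
    proof (rule raag.polynomial_fun_cong[THEN iffD1, rotated])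
      fix b assume "b \<in> carrier A"
      then obtain w' where w': "w' \<in> words V" "b = cls w'" by (rule carrierE)
      have "short_support (Suc n) (word_act w f)" "short_support (Suc n) f"
        using Suc.prems by (simp_all add: admissible_def short_support_word_act)
      note word_act_diff[OF this, of w' "[]"]
      then show "magnus (\<lambda>t. word_act w f t - f t) b = magnus f (a \<cdot> b) - magnus f b"
        using w w' magnus_cls[OF d, of w'] magnus_cls[OF Suc.prems, of w'] magnus_cls[OF Suc.prems, of "w @ w'"]
        by (simp add: cls_append)
    qed
  qed
qed

lemma magnus_mult:
  assumes "admissible n f" "w \<in> words V" "b \<in> carrier A"
  shows "magnus f (cls w \<cdot> b) = magnus (word_act w f) b"
proof -
  obtain w' where w': "w' \<in> words V" "b = cls w'" using assms(3) by (rule carrierE)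
  then show ?thesis
    using assms magnus_cls[OF assms(1), of "w @ w'"] magnus_cls[OF admissible_word_act[OF assms(1)], of w' w]
    by (simp add: cls_append)
qed

lemma magnus_lincomb:
  assumes "admissible n f" "admissible n h" "b \<in> carrier A"
  shows "magnus (\<lambda>t. c * f t + d * h t) b = c * magnus f b + d * magnus h b"
proof -
  obtain w' where w': "w' \<in> words V" "b = cls w'" using assms(3) by (rule carrierE)
  have "short_support n f" "short_support n h" using assms by (auto simp: admissible_def)
  note word_act_lincomb[OF this, of w' c d]
  then show ?thesis
    using w' magnus_cls[OF assms(1)] magnus_cls[OF assms(2)]
      magnus_cls[OF admissible_lincomb[OF assms(1,2), of c d]] by simp
qed

text \<open>Moving a positive letter from the front to the back replaces the shift \<open>f (v # t)\<close> by
  \<open>f (t @ [v])\<close>. This settles commutation with generators; for inverses conjugate by the generator.\<close>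

lemma magnus_cyclic:
  assumes f: "admissible n f" and cyc: "\<And>s t. f (s @ t) = f (t @ s)"
    and ab: "a \<in> carrier A" "b \<in> carrier A"
  shows "magnus f (a \<cdot> b) = magnus f (b \<cdot> a)"
proof -
  have flip: "magnus f (gen v \<cdot> b) = magnus f (b \<cdot> gen v)" if v: "v \<in> V" and b: "b \<in> carrier A" for v b
  proof -
    obtain w where w: "w \<in> words V" "b = cls w" using b by (rule carrierE)
    have sh: "short_support n f" "short_support n (\<lambda>t. f (v # t))"
      using f by (auto simp: admissible_def short_support_def)
    have "magnus f (gen v \<cdot> b) = word_act ((v, True) # w) f []"
      using v w magnus_cls[OF f, of "(v, True) # w"] cls_append[of "[(v, True)]" w] by (simp add: gen_def)
    also have "\<dots> = word_act w f [] + word_act w (\<lambda>t. f (t @ [v])) []"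
    proof -
      have "letter_act (v, True) f = (\<lambda>t. f t + f (v # t))" by auto
      then show ?thesis using word_act_add[OF sh, of w "[]"] cyc[of "[v]"] by simp
    qed
    also have "\<dots> = word_act (w @ [(v, True)]) f []"
      using word_act_append[of w f "[v]" "[]"] by simp
    also have "\<dots> = magnus f (b \<cdot> gen v)"
      using v w magnus_cls[OF f, of "w @ [(v, True)]"] by (simp add: gen_def cls_append)
    finally show ?thesis .
  qed
  show ?thesis
    using ab
  proof (induction a arbitrary: b rule: raag_induct)
    case (gen v a)
    then show ?case using flip[of v "a \<cdot> b"] gen.IH[of "b \<cdot> gen v"] by (simp add: raag.m_assoc)
  next
    case (inv v a)
    define i where "i = inv\<^bsub>A\<^esub> gen v"
    have i: "i \<in> carrier A" "i \<cdot> gen v = \<one>\<^bsub>A\<^esub>" "gen v \<cdot> i = \<one>\<^bsub>A\<^esub>"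
      using inv(1) by (simp_all add: i_def)
    have "magnus f (i \<cdot> a \<cdot> b) = magnus f ((i \<cdot> a \<cdot> b \<cdot> i) \<cdot> gen v)"
      using i inv by (simp add: raag.m_assoc)
    also have "\<dots> = magnus f (gen v \<cdot> (i \<cdot> a \<cdot> b \<cdot> i))"
      using i inv flip[of v "i \<cdot> a \<cdot> b \<cdot> i"] by simp
    also have "gen v \<cdot> (i \<cdot> a \<cdot> b \<cdot> i) = a \<cdot> (b \<cdot> i)"
    proof -
      have "gen v \<cdot> (i \<cdot> z) = z" if "z \<in> carrier A" for z
        using i inv(1) that by (simp flip: raag.m_assoc)
      then show ?thesis using i inv by (simp add: raag.m_assoc)
    qed
    also have "magnus f \<dots> = magnus f (b \<cdot> (i \<cdot> a))"
      using i inv inv.IH[of "b \<cdot> i"] by (simp add: raag.m_assoc)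
    finally show ?case by (simp add: i_def)
  qed simp
qed

end

section \<open>Words in syllables of minimal length\<close>

lemma (in group) commutes_int_pow:
  assumes "x \<otimes> y = y \<otimes> x" "x \<in> carrier G" "y \<in> carrier G"
  shows "x [^] (k::int) \<otimes> y = y \<otimes> x [^] k"
proof -
  have "conj_by G y x = x"
    using assms by (simp add: conj_by_def m_assoc flip: assms(1))
  then have *: "conj_by G y (x [^] k) = x [^] k"
    using hom_int_pow[OF conj_by_hom[OF assms(3)] assms(2) is_group is_group, of k] by simp
  have "y \<otimes> x [^] k = conj_by G y (x [^] k) \<otimes> y"
    using assms(2,3) by (simp add: conj_by_def m_assoc)
  then show ?thesis by (simp only: *)
qed

context graph
begin

interpretation raag: group A by (rule group_raag)

primrec syl_value :: "('a \<times> int) list \<Rightarrow> 'a word set" where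
  "syl_value [] = \<one>\<^bsub>A\<^esub>"
| "syl_value (a # s) = gen (fst a) [^]\<^bsub>A\<^esub> snd a \<cdot> syl_value s"

definition syllables :: "('a \<times> int) list set" where
  "syllables = lists (V \<times> UNIV)"

lemma syllables_simps [simp]:
  "[] \<in> syllables" "a # s \<in> syllables \<longleftrightarrow> fst a \<in> V \<and> s \<in> syllables"
  "s @ s' \<in> syllables \<longleftrightarrow> s \<in> syllables \<and> s' \<in> syllables"
  by (auto simp: syllables_def mem_Times_iff)

lemma syl_value_closed [simp]: "s \<in> syllables \<Longrightarrow> syl_value s \<in> carrier A"
  by (induction s) auto

lemma syl_value_append:
  "s \<in> syllables \<Longrightarrow> s' \<in> syllables \<Longrightarrow> syl_value (s @ s') = syl_value s \<cdot> syl_value s'"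
  by (induction s) (auto simp: raag.m_assoc)

lemma syllables_exist: "a \<in> carrier A \<Longrightarrow> \<exists>s\<in>syllables. syl_value s = a"
proof (induction rule: raag_induct)
  case one
  show ?case by (rule bexI[of _ "[]"]) auto
next
  case (gen v b)
  then obtain s where "s \<in> syllables" "syl_value s = b" by blast
  then show ?case using gen by (intro bexI[of _ "(v, 1) # s"]) auto
next
  case (inv v b)
  then obtain s where "s \<in> syllables" "syl_value s = b" by blast
  then show ?case using inv raag.int_pow_neg[of "gen v" 1] by (intro bexI[of _ "(v, -1) # s"]) auto
qed

lemma exp_sum_syl_value:
  "s \<in> syllables \<Longrightarrow> exp_sum u (syl_value s) = (\<Sum>a\<leftarrow>s. if fst a = u then snd a else 0)"
  by (induction s) auto

text \<open>If \<open>X\<^sub>v\<^sup>2\<close> may be ignored, then \<open>v\<^sup>k\<close> expands to \<open>1 + k X\<^sub>v\<close>, also for negative \<open>k\<close>.\<close>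

lemma magnus_gen_pow:
  assumes f: "admissible n f" and sq: "\<And>t. f (v # v # t) = 0"
    and v: "v \<in> V" and b: "b \<in> carrier A"
  shows "magnus f (gen v [^]\<^bsub>A\<^esub> (k::int) \<cdot> b) = magnus f b + k * magnus (\<lambda>t. f (v # t)) b"
proof -
  have f': "admissible n (\<lambda>t. f (v # t))"
    using admissible_Cons[OF admissible_mono[OF f, of "Suc n"]] by simp
  define h where "h j = (\<lambda>t. 1 * f t + j * f (v # t))" for j
  have h: "admissible n (h j)" for j
    unfolding h_def by (rule admissible_lincomb[OF f f'])
  have step: "magnus (h j) (gen v \<cdot> c) = magnus (h (j + 1)) c" if "c \<in> carrier A" for j c
  proof -
    have "word_act [(v, True)] (h j) = h (j + 1)"
      by (auto simp: h_def sq algebra_simps)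
    then show ?thesis using magnus_mult[OF h, of "[(v, True)]" c j] v that by (simp add: gen_def)
  qed
  have pow: "magnus (h j) (gen v [^]\<^bsub>A\<^esub> (m::nat) \<cdot> c) = magnus (h (j + int m)) c"
    if "c \<in> carrier A" for j m c
    using that
  proof (induction m arbitrary: c)
    case (Suc m)
    have "magnus (h j) (gen v [^]\<^bsub>A\<^esub> Suc m \<cdot> c) = magnus (h j) (gen v [^]\<^bsub>A\<^esub> m \<cdot> (gen v \<cdot> c))"
      using v Suc.prems by (simp add: raag.m_assoc)
    also have "\<dots> = magnus (h (j + int m)) (gen v \<cdot> c)" using v Suc.prems by (intro Suc.IH) auto
    also have "\<dots> = magnus (h (j + int (Suc m))) c" using step[OF Suc.prems] by (simp add: algebra_simps)
    finally show ?case .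
  qed simp
  have "h 0 = f" by (simp add: fun_eq_iff h_def)
  then have h0: "magnus (h 0) = magnus f" by simp
  have cancel: "z \<cdot> (inv\<^bsub>A\<^esub> z \<cdot> b) = b" if "z \<in> carrier A" for z
    using that b raag.m_assoc[of z "inv\<^bsub>A\<^esub> z" b] by simp
  have "magnus f (gen v [^]\<^bsub>A\<^esub> k \<cdot> b) = magnus (h k) b"
  proof (cases k rule: int_cases2)
    case (nonneg m)
    then show ?thesis using pow[OF b, of 0 m] h0 by (simp add: int_pow_int)
  next
    case (nonpos m)
    define z where "z = gen v [^]\<^bsub>A\<^esub> m"
    have z: "z \<in> carrier A" using v by (simp add: z_def)
    have "gen v [^]\<^bsub>A\<^esub> k = inv\<^bsub>A\<^esub> z" "k + int m = 0"
      using nonpos v by (simp_all add: raag.int_pow_neg_int z_def)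
    then show ?thesis
      using pow[of "inv\<^bsub>A\<^esub> z \<cdot> b" k m] b z cancel[OF z]
      by (simp only: h0 z_def[symmetric] raag.m_closed raag.inv_closed)
  qed
  then show ?thesis using magnus_lincomb[OF f f' b, of 1 k] by (simp add: h_def)
qed

definition square_free :: "('a list \<Rightarrow> int) \<Rightarrow> bool" where
  "square_free f \<longleftrightarrow> (\<forall>p v q. f (p @ v # v # q) = 0)"

text \<open>The product of the factors \<open>1 + k X\<^sub>v\<close> has, in the top degree, only the product of all the
  variables, with the product of the exponents as its coefficient. Terms of lower degree are
  invisible to \<open>f\<close>.\<close>

lemma magnus_syl_value:
  assumes "admissible n f" "square_free f" "s \<in> syllables"
    and "\<And>t. length t < length s \<Longrightarrow> f t = 0"
  shows "magnus f (syl_value s) = prod_list (map snd s) * f (map fst s)"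
  using assms
proof (induction s arbitrary: f)
  case Nil
  then show ?case by (simp add: magnus_one)
next
  case (Cons a s)
  obtain v k where a: "a = (v, k)" by (cases a)
  let ?f' = "\<lambda>t. f (v # t)"
  have f': "admissible n ?f'"
    using admissible_Cons[OF admissible_mono[OF Cons.prems(1), of "Suc n"]] by simp
  have sq': "square_free ?f'" using Cons.prems(2) unfolding square_free_def by (metis append_Cons)
  have sq: "f (v # v # t) = 0" for t
    using Cons.prems(2) unfolding square_free_def by (metis append_Nil)
  have "magnus f (syl_value (a # s)) = magnus f (syl_value s) + k * magnus ?f' (syl_value s)"
    using magnus_gen_pow[OF Cons.prems(1) sq, of "syl_value s" k] Cons.prems(3) by (simp add: a)
  also have "magnus f (syl_value s) = prod_list (map snd s) * f (map fst s)"
    by (rule Cons.IH) (use Cons.prems in auto)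
  also have "f (map fst s) = 0" by (rule Cons.prems(4)) simp
  also have "magnus ?f' (syl_value s) = prod_list (map snd s) * ?f' (map fst s)"
    by (rule Cons.IH) (use f' sq' Cons.prems in auto)
  finally show ?case by (simp add: a)
qed

text \<open>A syllable with exponent \<open>0\<close> could be dropped, and two neighbouring syllables at the same vertex
  could be merged.\<close>

lemma minimal_syllables:
  assumes s: "s \<in> syllables" "P (syl_value s)"
    and min: "\<And>s'. s' \<in> syllables \<Longrightarrow> P (syl_value s') \<Longrightarrow> length s \<le> length s'"
  shows "0 \<notin> snd ` set s" and "map fst s \<noteq> p @ v # v # q"
proof -
  show "0 \<notin> snd ` set s"
  proof
    assume "0 \<in> snd ` set s"
    then obtain u where "(u, 0) \<in> set s" by auto
    then obtain p q where s_eq: "s = p @ (u, 0) # q" by (auto simp: in_set_conv_decomp)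
    then have "syl_value s = syl_value (p @ q)" using s(1) by (simp add: syl_value_append)
    then show False using min[of "p @ q"] s s_eq by auto
  qed
  show "map fst s \<noteq> p @ v # v # q"
  proof
    assume "map fst s = p @ v # v # q"
    then obtain p' q' k l where s_eq: "s = p' @ (v, k) # (v, l) # q'"
      by (auto simp: map_eq_append_conv map_eq_Cons_conv)
    then have "syl_value s = syl_value (p' @ (v, k + l) # q')"
      using s(1) by (simp add: syl_value_append raag.int_pow_mult raag.m_assoc)
    then show False using min[of "p' @ (v, k + l) # q'"] s s_eq by auto
  qed
qed

definition swap_step :: "'a list \<Rightarrow> 'a list \<Rightarrow> bool" where
  "swap_step t t' \<longleftrightarrow> (\<exists>p q u v. u \<rightarrow>\<^bsub>G\<^esub> v \<and> t = p @ u # v # q \<and> t' = p @ v # u # q)"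

text \<open>The classes generated by these steps are the cyclic words in partially commuting letters.\<close>

definition cyc_step :: "'a list \<Rightarrow> 'a list \<Rightarrow> bool" where
  "cyc_step t t' \<longleftrightarrow> swap_step t t' \<or> (\<exists>p q. t = p @ q \<and> t' = q @ p)"

lemma swap_step_sym: "swap_step t t' \<Longrightarrow> swap_step t' t"
  unfolding swap_step_def using adj_sym by blast

lemma cyc_step_sym: "cyc_step t t' \<Longrightarrow> cyc_step t' t"
  unfolding cyc_step_def using swap_step_sym by blast

lemma cyc_step_length: "cyc_step t t' \<Longrightarrow> length t' = length t"
  by (auto simp: cyc_step_def swap_step_def)

lemma swap_cyc_steps: "swap_step\<^sup>*\<^sup>* t t' \<Longrightarrow> cyc_step\<^sup>*\<^sup>* t t'"
  by (rule rtranclp_mono[THEN predicate2D]) (auto simp: cyc_step_def)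

lemma cyc_steps_length: "cyc_step\<^sup>*\<^sup>* t t' \<Longrightarrow> length t' = length t"
  by (induction rule: rtranclp_induct) (simp_all add: cyc_step_length)

lemma swap_step_lift:
  assumes "s \<in> syllables" "swap_step (map fst s) t"
  shows "\<exists>s'\<in>syllables. map fst s' = t \<and> syl_value s' = syl_value s"
proof -
  obtain p q u v where uv: "u \<rightarrow>\<^bsub>G\<^esub> v" "map fst s = p @ u # v # q" "t = p @ v # u # q"
    using assms(2) by (auto simp: swap_step_def)
  then obtain p' q' k l where s_eq: "s = p' @ (u, k) # (v, l) # q'" "map fst p' = p" "map fst q' = q"
    by (auto simp: map_eq_append_conv map_eq_Cons_conv)
  have V: "u \<in> V" "v \<in> V" and pq: "p' \<in> syllables" "q' \<in> syllables" using assms(1) s_eq by auto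
  let ?x = "gen u [^]\<^bsub>A\<^esub> k" and ?y = "gen v [^]\<^bsub>A\<^esub> l"
  have 1: "?x \<cdot> gen v = gen v \<cdot> ?x"
    by (rule raag.commutes_int_pow) (use V gen_commute[OF uv(1)] in auto)
  have "?y \<cdot> ?x = ?x \<cdot> ?y"
    by (rule raag.commutes_int_pow) (use V 1 in auto)
  then have "?x \<cdot> (?y \<cdot> z) = ?y \<cdot> (?x \<cdot> z)" if "z \<in> carrier A" for z
    using V that by (simp flip: raag.m_assoc)
  then have "syl_value (p' @ (v, l) # (u, k) # q') = syl_value s"
    using pq V by (simp add: s_eq syl_value_append)
  then show ?thesis using pq V s_eq uv by (intro bexI[of _ "p' @ (v, l) # (u, k) # q'"]) auto
qed

lemma swap_steps_lift:
  assumes "swap_step\<^sup>*\<^sup>* (map fst s) t" "s \<in> syllables"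
  shows "\<exists>s'\<in>syllables. map fst s' = t \<and> syl_value s' = syl_value s"
  using assms
proof (induction rule: rtranclp_induct)
  case (step t t')
  then show ?case using swap_step_lift by metis
qed auto

lemma cyc_steps_lift:
  assumes "cyc_step\<^sup>*\<^sup>* (map fst s) t" "s \<in> syllables"
  shows "\<exists>s'\<in>syllables. map fst s' = t \<and> (\<exists>h\<in>carrier A. syl_value s' = conj_by A h (syl_value s))"
  using assms
proof (induction rule: rtranclp_induct)
  case base
  then show ?case by (intro bexI[of _ s] conjI bexI[of _ "\<one>\<^bsub>A\<^esub>"]) auto
next
  case (step t t')
  then obtain r h where r: "r \<in> syllables" "map fst r = t" "h \<in> carrier A"
      "syl_value r = conj_by A h (syl_value s)"
    by blast
  show ?case
  proof (cases "swap_step t t'")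
    case True
    then obtain r' where "r' \<in> syllables" "map fst r' = t'" "syl_value r' = syl_value r"
      using swap_step_lift[of r t'] r by blast
    then show ?thesis using r by auto
  next
    case False
    then obtain p q where pq: "t = p @ q" "t' = q @ p" using step.hyps(2) by (auto simp: cyc_step_def)
    then obtain p' q' where r_eq: "r = p' @ q'" "map fst p' = p" "map fst q' = q"
      using r(2) by (auto simp: map_eq_append_conv)
    have in_syl: "p' \<in> syllables" "q' \<in> syllables" using r(1) r_eq by auto
    let ?i = "inv\<^bsub>A\<^esub> syl_value p'"
    have "syl_value (q' @ p') = conj_by A ?i (syl_value r)"
      using in_syl by (simp add: r_eq syl_value_append conj_by_def) (simp flip: raag.m_assoc)
    also have "\<dots> = conj_by A (?i \<cdot> h) (syl_value s)"
      using in_syl r step.prems by (simp add: raag.conj_by_conj_by)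
    finally show ?thesis
      using in_syl r r_eq pq by (intro bexI[of _ "q' @ p'"] conjI bexI[of _ "?i \<cdot> h"]) auto
  qed
qed

lemma class_indicator_admissible:
  assumes "\<And>t t'. swap_step t t' \<Longrightarrow> C t \<longleftrightarrow> C t'" "\<And>t. C t \<Longrightarrow> length t < n"
  shows "admissible n (\<lambda>t. of_bool (C t))"
proof -
  have swap: "C (p @ u # v # q) \<longleftrightarrow> C (p @ v # u # q)" if "u \<rightarrow>\<^bsub>G\<^esub> v" for p q u v
    by (rule assms(1)) (use that in \<open>auto simp: swap_step_def\<close>)
  then have "swap_invariant (dominates G) (\<lambda>t. of_bool (C t))"
    by (intro swap_invariantI arg_cong[of _ _ of_bool] swap)
  moreover have "short_support n (\<lambda>t. of_bool (C t))"
    using assms(2) by (auto simp: short_support_def not_le[symmetric])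
  ultimately show ?thesis by (simp add: admissible_def)
qed

text \<open>This is used with \<open>P\<close> singling out one element, with the class of words reachable by swaps, and
  with \<open>P\<close> a conjugacy class, with the class of words reachable by swaps and rotations. All moves
  lift to syllables, so by minimality no word of the class contains a square, and the coefficient
  is the product of non-zero exponents.\<close>

lemma magnus_class_indicator:
  assumes s: "s \<in> syllables" "P (syl_value s)"
    and min: "\<And>s'. s' \<in> syllables \<Longrightarrow> P (syl_value s') \<Longrightarrow> length s \<le> length s'"
    and C: "C (map fst s)" "\<And>t t'. swap_step t t' \<Longrightarrow> C t \<longleftrightarrow> C t'"
    and len: "\<And>t. C t \<Longrightarrow> length t = length s"
    and lift: "\<And>t. C t \<Longrightarrow> \<exists>s'\<in>syllables. map fst s' = t \<and> P (syl_value s')"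
  shows "admissible (Suc (length s)) (\<lambda>t. of_bool (C t))"
    and "square_free (\<lambda>t. of_bool (C t))"
    and "magnus (\<lambda>t. of_bool (C t)) (syl_value s) \<noteq> 0"
proof -
  let ?f = "\<lambda>t. of_bool (C t) :: int"
  show adm: "admissible (Suc (length s)) ?f"
    by (rule class_indicator_admissible) (use C(2) len in auto)
  have "\<not> C (p @ v # v # q)" for p v q
  proof
    assume *: "C (p @ v # v # q)"
    then obtain s' where s': "s' \<in> syllables" "map fst s' = p @ v # v # q" "P (syl_value s')"
      using lift by blast
    have "length s' = length s" using len[OF *] s'(2) by (metis length_map)
    then show False
      using minimal_syllables(2)[of s' P p v q] s' min by metis
  qed
  then show sq: "square_free ?f" by (simp add: square_free_def)
  have "magnus ?f (syl_value s) = prod_list (map snd s) * ?f (map fst s)"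
    by (rule magnus_syl_value[OF adm sq s(1)]) (use len in auto)
  moreover have "prod_list (map snd s) \<noteq> 0"
    using minimal_syllables(1)[of s P] s min by (auto simp: prod_list_zero_iff)
  ultimately show "magnus ?f (syl_value s) \<noteq> 0" using C(1) by simp
qed

lemma exists_minimal_syllables:
  assumes "s \<in> syllables" "P (syl_value s)"
  obtains s' where "s' \<in> syllables" "P (syl_value s')"
    "\<And>r. r \<in> syllables \<Longrightarrow> P (syl_value r) \<Longrightarrow> length s' \<le> length r"
  using ex_has_least_nat[of "\<lambda>s. s \<in> syllables \<and> P (syl_value s)" s length] assms by blast

text \<open>Injectivity of the Magnus expansion: writing \<open>a\<close> with as few syllables as possible exhibits a
  coefficient that does not vanish.\<close>

lemma swap_class_separates:
  assumes "a \<in> carrier A" "a \<noteq> \<one>\<^bsub>A\<^esub>"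
  shows "\<exists>t. t \<noteq> [] \<and> set t \<subseteq> V \<and> magnus (\<lambda>t'. of_bool (swap_step\<^sup>*\<^sup>* t t')) a \<noteq> 0"
proof -
  obtain s0 where s0: "s0 \<in> syllables" "syl_value s0 = a" using syllables_exist[OF assms(1)] by blast
  obtain s where s: "s \<in> syllables" "syl_value s = a"
      and min: "\<And>r. r \<in> syllables \<Longrightarrow> syl_value r = a \<Longrightarrow> length s \<le> length r"
    by (rule exists_minimal_syllables[of s0 "\<lambda>b. b = a"]) (use s0 in auto)
  have "magnus (\<lambda>t. of_bool (swap_step\<^sup>*\<^sup>* (map fst s) t)) (syl_value s) \<noteq> 0"
  proof (rule magnus_class_indicator(3)[where P = "\<lambda>b. b = a"])
    show "swap_step\<^sup>*\<^sup>* (map fst s) t \<longleftrightarrow> swap_step\<^sup>*\<^sup>* (map fst s) t'" if "swap_step t t'" for t t'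
      using that swap_step_sym by (meson rtranclp.rtrancl_into_rtrancl)
    show "length t = length s" if "swap_step\<^sup>*\<^sup>* (map fst s) t" for t
      using cyc_steps_length[OF swap_cyc_steps[OF that]] by simp
    show "\<exists>s'\<in>syllables. map fst s' = t \<and> syl_value s' = a" if "swap_step\<^sup>*\<^sup>* (map fst s) t" for t
      using swap_steps_lift[OF that s(1)] s(2) by simp
  qed (use s min in auto)
  moreover have "s \<noteq> []" using s assms(2) by auto
  moreover have "fst ` set s \<subseteq> V" using s by (auto simp: syllables_def)
  ultimately show ?thesis using s(2) by (intro exI[of _ "map fst s"]) simp
qed

text \<open>When \<open>vs\<close> lists every vertex once, this is the analogue of a Coxeter element.\<close>

definition coxeter :: "'a list \<Rightarrow> 'a word set" where
  "coxeter vs = syl_value (map (\<lambda>v. (v, 1)) vs)"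

lemma unit_syllables: "set vs \<subseteq> V \<Longrightarrow> map (\<lambda>v. (v, 1)) vs \<in> syllables"
  by (induction vs) auto

lemma unit_exponents:
  assumes "s \<in> syllables" "distinct (map fst s)" "\<And>v. v \<in> V \<Longrightarrow> exp_sum v (syl_value s) = 1"
  shows "s = map (\<lambda>v. (v, 1)) (map fst s)"
proof -
  have "snd a = 1" if a: "a \<in> set s" for a
  proof -
    have "fst a \<in> V" using a assms(1) by (auto simp: syllables_def mem_Times_iff)
    then have "1 = (\<Sum>b\<leftarrow>s. if fst b = fst a then snd b else 0)"
      using assms by (simp add: exp_sum_syl_value)
    also have "\<dots> = (\<Sum>b\<in>set s. if fst b = fst a then snd b else 0)"
      using assms(2) by (simp add: sum_list_distinct_conv_sum_set distinct_map)
    also have "\<dots> = (\<Sum>b\<in>{a}. snd b)"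
      using a assms(2) by (intro sum.mono_neutral_cong_right) (auto simp: distinct_map inj_on_def)
    finally show ?thesis by simp
  qed
  then show ?thesis by (auto intro!: map_idI[symmetric] simp: o_def prod_eq_iff)
qed

text \<open>Take a conjugate of \<open>y\<close> that is shortest in syllables. The indicator of its class of cyclic words
  gives a class function that does not vanish at \<open>y\<close>, hence not at the product of the generators.
  The latter has one syllable per vertex, so the class consists of words at most that long; the
  exponent sums say that every vertex occurs. So the class consists of arrangements of all
  vertices, the given one belongs to it, and following the moves that lead there conjugates \<open>y\<close> into
  an arrangement with exponent sums \<open>1\<close>, which is the given product.\<close>

lemma conjugate_coxeter:
  assumes vs: "distinct vs" "set vs = V" and y: "y \<in> carrier A"
    and exp: "\<And>v. v \<in> V \<Longrightarrow> exp_sum v y = 1"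
    and inv: "\<And>n f. admissible n f \<Longrightarrow> (\<And>s t. f (s @ t) = f (t @ s)) \<Longrightarrow>
      magnus f y = magnus f (coxeter vs)"
  shows "\<exists>h\<in>carrier A. y = conj_by A h (coxeter vs)"
proof -
  define P where "P b \<longleftrightarrow> (\<exists>h\<in>carrier A. b = conj_by A h y)" for b
  obtain s0 where s0: "s0 \<in> syllables" "syl_value s0 = y" using syllables_exist[OF y] by blast
  have "P y" unfolding P_def using y by (intro bexI[of _ "\<one>\<^bsub>A\<^esub>"]) auto
  then obtain s where s: "s \<in> syllables" "P (syl_value s)"
      and min: "\<And>r. r \<in> syllables \<Longrightarrow> P (syl_value r) \<Longrightarrow> length s \<le> length r"
    using exists_minimal_syllables[of s0 P] s0 by blast
  define C where "C = cyc_step\<^sup>*\<^sup>* (map fst s)"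
  define f :: "'a list \<Rightarrow> int" where "f = (\<lambda>t. of_bool (C t))"
  have step: "C t \<longleftrightarrow> C t'" if "cyc_step t t'" for t t'
    using that cyc_step_sym unfolding C_def by (meson rtranclp.rtrancl_into_rtrancl)
  have len: "length t = length s" if "C t" for t
    using cyc_steps_length[of "map fst s" t] that by (simp add: C_def)
  have lift: "\<exists>s'\<in>syllables. map fst s' = t \<and> P (syl_value s')" if t: "C t" for t
  proof -
    obtain r h where r: "r \<in> syllables" "map fst r = t" "h \<in> carrier A"
        "syl_value r = conj_by A h (syl_value s)"
      using cyc_steps_lift[OF t[unfolded C_def] s(1)] by blast
    obtain k where "k \<in> carrier A" "syl_value s = conj_by A k y" using s(2) by (auto simp: P_def)
    then have "P (syl_value r)" unfolding P_def
      using r y by (intro bexI[of _ "h \<cdot> k"]) (auto simp: raag.conj_by_conj_by)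
    then show ?thesis using r by blast
  qed
  have C0: "C (map fst s)" by (simp add: C_def)
  have swapC: "C t \<longleftrightarrow> C t'" if "swap_step t t'" for t t'
    by (rule step) (use that in \<open>simp add: cyc_step_def\<close>)
  note ind = magnus_class_indicator[of s P C, OF s min C0 swapC len lift, folded f_def]
  have cyc: "f (p @ q) = f (q @ p)" for p q
    using step[of "p @ q" "q @ p"] by (auto simp: f_def cyc_step_def)
  have "magnus f (syl_value s) = magnus f y"
  proof -
    obtain k where k: "k \<in> carrier A" "syl_value s = conj_by A k y" using s(2) by (auto simp: P_def)
    have "magnus f (k \<cdot> y \<cdot> inv\<^bsub>A\<^esub> k) = magnus f (inv\<^bsub>A\<^esub> k \<cdot> (k \<cdot> y))"
      by (rule magnus_cyclic[OF ind(1) cyc]) (use k y in auto)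
    then show ?thesis using k y by (simp add: conj_by_def flip: raag.m_assoc)
  qed
  also have "\<dots> = magnus f (coxeter vs)" by (rule inv[OF ind(1) cyc])
  finally have nonzero: "magnus f (coxeter vs) \<noteq> 0" using ind(3) by simp
  have xs: "map (\<lambda>v. (v, 1)) vs \<in> syllables" using vs(2) unit_syllables[of vs] by simp
  have exp': "exp_sum v (syl_value r) = 1" if "v \<in> V" "P (syl_value r)" for v r
  proof -
    obtain h where "h \<in> carrier A" "syl_value r = conj_by A h y" using \<open>P (syl_value r)\<close> by (auto simp: P_def)
    then show ?thesis using exp[OF \<open>v \<in> V\<close>] y by simp
  qed
  have "V \<subseteq> fst ` set s"
  proof
    fix v assume v: "v \<in> V"
    show "v \<in> fst ` set s"
    proof (rule ccontr)
      assume "v \<notin> fst ` set s"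
      then have "map (\<lambda>a. if fst a = v then snd a else 0) s = map (\<lambda>a. 0) s"
        by (intro map_cong) auto
      then have "(\<Sum>a\<leftarrow>s. if fst a = v then snd a else 0) = 0" by (simp only: sum_list_0)
      then show False using exp'[OF v s(2)] s(1) by (simp add: exp_sum_syl_value)
    qed
  qed
  then have "card V \<le> length s"
    using card_mono[of "fst ` set s" V] card_image_le[of "set s" fst] card_length[of s] by simp
  then have short: "length vs \<le> length s" using vs distinct_card by metis
  have "magnus f (coxeter vs) = prod_list (map snd (map (\<lambda>v. (v, 1)) vs)) * f (map fst (map (\<lambda>v. (v, 1::int)) vs))"
    unfolding coxeter_def
    by (rule magnus_syl_value[OF ind(1,2) xs]) (use short len in \<open>auto simp: f_def\<close>)
  then have "C vs" using nonzero by (auto simp: f_def o_def)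
  then obtain r where r: "r \<in> syllables" "map fst r = vs" "P (syl_value r)" using lift by blast
  then have "r = map (\<lambda>v. (v, 1)) vs"
    using unit_exponents[OF r(1)] vs(1) exp'[OF _ r(3)] by simp
  then have "P (coxeter vs)" using r(3) by (simp add: coxeter_def)
  then obtain h where h: "h \<in> carrier A" "coxeter vs = conj_by A h y" by (auto simp: P_def)
  then have "y = conj_by A (inv\<^bsub>A\<^esub> h) (coxeter vs)" using y by (simp add: raag.conj_by_conj_by)
  then show ?thesis using h by blast
qed

end

section \<open>Coefficients at elements of the trace monoid\<close>

lemma letter_act_commute:
  assumes "swap_invariant (\<lambda>_ _. True) f" "short_support n f"
  shows "letter_act a (letter_act b f) = letter_act b (letter_act a f)"
proof -
  define K where "K f \<longleftrightarrow> swap_invariant (\<lambda>_ _. True) f \<and> short_support n f" for f :: "'a list \<Rightarrow> int"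
  have K: "K (letter_act c f)" if "K f" for c f
    using that by (simp add: K_def swap_invariant_letter_act short_support_letter_act)
  have cancel: "letter_act (v, False) (letter_act (v, True) f) = f"
    "letter_act (v, True) (letter_act (v, False) f) = f" if "K f" for v f
    using letter_act_cancel[of n f v True] letter_act_cancel[of n f v False] that by (simp_all add: K_def)
  have pos: "letter_act (u, True) (letter_act (v, True) f) = letter_act (v, True) (letter_act (u, True) f)"
    if "K f" for u v f
  proof
    fix t
    have "f (v # u # t) = f (u # v # t)"
      using that swap_invariantD[of "\<lambda>_ _. True" f v u "[]" t] by (simp add: K_def)
    then show "letter_act (u, True) (letter_act (v, True) f) t
        = letter_act (v, True) (letter_act (u, True) f) t" by simp
  qed
  have neg: "letter_act (u, False) (letter_act b f) = letter_act b (letter_act (u, False) f)"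
    if comm: "\<And>f. K f \<Longrightarrow> letter_act (u, True) (letter_act b f) = letter_act b (letter_act (u, True) f)"
      and f: "K f" for u b f
  proof -
    have "letter_act (u, False) (letter_act b f)
        = letter_act (u, False) (letter_act b (letter_act (u, True) (letter_act (u, False) f)))"
      using f by (simp only: cancel)
    also have "\<dots> = letter_act (u, False) (letter_act (u, True) (letter_act b (letter_act (u, False) f)))"
      by (simp only: comm[OF K[OF f]])
    also have "\<dots> = letter_act b (letter_act (u, False) f)"
      by (simp only: cancel K f)
    finally show ?thesis .
  qed
  have "letter_act (u, c) (letter_act (v, d) f) = letter_act (v, d) (letter_act (u, c) f)"
    if "K f" for u v c d f
  proof -
    have pos': "letter_act (u, c) (letter_act (v, True) f) = letter_act (v, True) (letter_act (u, c) f)"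
      if "K f" for u c v f
    proof (cases c)
      case True
      then show ?thesis by (simp only: pos[OF that])
    next
      case False
      then show ?thesis using neg[OF pos that, of u v] by simp
    qed
    show ?thesis
    proof (cases d)
      case True
      then show ?thesis using pos'[OF that] by simp
    next
      case False
      have "letter_act (v, False) (letter_act (u, c) f) = letter_act (u, c) (letter_act (v, False) f)"
        by (rule neg) (simp_all only: pos' that)
      then show ?thesis using False by simp
    qed
  qed
  then show ?thesis using assms by (cases a; cases b) (simp add: K_def)
qed

lemma word_act_letter_act:
  assumes "swap_invariant (\<lambda>_ _. True) f" "short_support n f"
  shows "letter_act a (word_act w f) = word_act w (letter_act a f)"
  using assms
proof (induction w arbitrary: f)
  case (Cons b w)
  have "letter_act a (word_act w (letter_act b f)) = word_act w (letter_act a (letter_act b f))"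
    using Cons by (simp add: swap_invariant_letter_act short_support_letter_act)
  also have "\<dots> = word_act w (letter_act b (letter_act a f))"
    using letter_act_commute[OF Cons.prems, of a b] by (simp only:)
  finally show ?case by simp
qed simp

context graph
begin

interpretation raag: group A by (rule group_raag)

text \<open>On fully symmetric functions the letters act by commuting operators, so letters and their inverses
  cancel regardless of their positions.\<close>

lemma word_act_balanced:
  assumes f: "swap_invariant (\<lambda>_ _. True) f" "short_support n f"
    and w: "\<And>v. word_exp v w = 0"
  shows "word_act w f = f"
  using w
proof (induction "length w" arbitrary: w rule: less_induct)
  case less
  show ?case
  proof (cases w)
    case (Cons a w')
    obtain v b where a: "a = (v, b)" by (cases a)
    have sign: "if b then 0 \<le> word_exp v r else word_exp v r \<le> 0" if "(v, \<not> b) \<notin> set r" for r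
      using that
    proof (induction r)
      case (Cons c r)
      then show ?case by (cases c) (auto simp: letter_exp_def split: if_splits)
    qed simp
    have "letter_exp v a + word_exp v w' = 0" using less.prems[of v] Cons by simp
    then have "(v, \<not> b) \<in> set w'" using sign[of w'] by (auto simp: a letter_exp_def split: if_splits)
    then obtain p q where pq: "w' = p @ (v, \<not> b) # q" by (auto simp: in_set_conv_decomp)
    have 1: "swap_invariant (\<lambda>_ _. True) (letter_act a f)" "short_support n (letter_act a f)"
      using f by (simp_all add: swap_invariant_letter_act short_support_letter_act)
    have "word_act w f = word_act q (letter_act (v, \<not> b) (word_act p (letter_act a f)))"
      by (simp add: Cons pq)
    also have "\<dots> = word_act q (word_act p (letter_act (v, \<not> b) (letter_act (v, b) f)))"
      using word_act_letter_act[OF 1, of "(v, \<not> b)" p] by (simp add: a)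
    also have "\<dots> = word_act (p @ q) f" by (simp add: letter_act_cancel[OF f(2)])
    also have "\<dots> = f"
    proof (rule less.hyps)
      show "length (p @ q) < length w" by (simp add: Cons pq)
      show "word_exp u (p @ q) = 0" for u
        using less.prems[of u] by (auto simp: Cons pq a letter_exp_def split: if_splits)
    qed
    finally show ?thesis .
  qed simp
qed

text \<open>Equality in the trace monoid, the monoid on \<open>V\<close> in which adjacent vertices commute. Comparing the
  projections to pairs of non-commuting letters makes cancellation from the left and from the right
  evident; that swaps generate this relation is \<open>proj_equiv_iff\<close>. The case \<open>u = v\<close> compares the
  number of occurrences.\<close>

definition proj_equiv :: "'a list \<Rightarrow> 'a list \<Rightarrow> bool" where
  "proj_equiv s t \<longleftrightarrow> (\<forall>u v. \<not> u \<rightarrow>\<^bsub>G\<^esub> v \<longrightarrow>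
    filter (\<lambda>w. w = u \<or> w = v) s = filter (\<lambda>w. w = u \<or> w = v) t)"

lemma proj_equivD:
  "proj_equiv s t \<Longrightarrow> \<not> u \<rightarrow>\<^bsub>G\<^esub> v \<Longrightarrow>
    filter (\<lambda>w. w = u \<or> w = v) s = filter (\<lambda>w. w = u \<or> w = v) t"
  unfolding proj_equiv_def by blast

lemma proj_equiv_refl [simp]: "proj_equiv t t"
  by (simp add: proj_equiv_def)

lemma proj_equiv_sym: "proj_equiv s t \<Longrightarrow> proj_equiv t s"
  by (simp add: proj_equiv_def)

lemma proj_equiv_trans: "proj_equiv r s \<Longrightarrow> proj_equiv s t \<Longrightarrow> proj_equiv r t"
  by (simp add: proj_equiv_def)

lemma proj_equiv_cong:
  assumes "proj_equiv s s'" "proj_equiv t t'"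
  shows "proj_equiv s t \<longleftrightarrow> proj_equiv s' t'"
proof
  assume "proj_equiv s t"
  from proj_equiv_trans[OF proj_equiv_trans[OF proj_equiv_sym[OF assms(1)] this] assms(2)]
  show "proj_equiv s' t'" .
next
  assume "proj_equiv s' t'"
  from proj_equiv_trans[OF proj_equiv_trans[OF assms(1) this] proj_equiv_sym[OF assms(2)]]
  show "proj_equiv s t" .
qed

lemma proj_equiv_Cons [simp]: "proj_equiv (v # s) (v # t) \<longleftrightarrow> proj_equiv s t"
  by (auto simp: proj_equiv_def)

lemma proj_equiv_snoc [simp]: "proj_equiv (s @ [v]) (t @ [v]) \<longleftrightarrow> proj_equiv s t"
  by (auto simp: proj_equiv_def)

lemma swap_step_proj_equiv:
  assumes "swap_step s t" shows "proj_equiv s t"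
proof -
  obtain p q u v where uv: "u \<rightarrow>\<^bsub>G\<^esub> v" "s = p @ u # v # q" "t = p @ v # u # q"
    using assms by (auto simp: swap_step_def)
  have "\<not> ((u = a \<or> u = b) \<and> (v = a \<or> v = b))" if "\<not> a \<rightarrow>\<^bsub>G\<^esub> b" for a b
    using uv(1) that adj_sym adj_irrefl by blast
  then show ?thesis unfolding proj_equiv_def uv by auto
qed

lemma swap_steps_proj_equiv: "swap_step\<^sup>*\<^sup>* s t \<Longrightarrow> proj_equiv s t"
  by (induction rule: rtranclp_induct) (auto intro: proj_equiv_trans swap_step_proj_equiv)

lemma swap_steps_Cons: "swap_step\<^sup>*\<^sup>* s t \<Longrightarrow> swap_step\<^sup>*\<^sup>* (v # s) (v # t)"
proof (induction rule: rtranclp_induct)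
  case (step t t')
  have "swap_step (v # t) (v # t')"
    using step.hyps(2) unfolding swap_step_def by (metis append_Cons)
  then show ?case using step.IH by (meson rtranclp.rtrancl_into_rtrancl)
qed simp

lemma swap_steps_to_front:
  "(\<And>u. u \<in> set p \<Longrightarrow> u \<rightarrow>\<^bsub>G\<^esub> v) \<Longrightarrow> swap_step\<^sup>*\<^sup>* (p @ v # q) (v # p @ q)"
proof (induction p)
  case (Cons u p)
  have "swap_step\<^sup>*\<^sup>* (u # p @ v # q) (u # v # p @ q)"
    using Cons by (intro swap_steps_Cons) auto
  moreover have "swap_step (u # v # p @ q) (v # u # p @ q)"
    unfolding swap_step_def using Cons.prems[of u] by (intro exI[of _ "[]"] exI[of _ "p @ q"]) auto
  ultimately show ?case by simp
qed simp

text \<open>The first letter \<open>v\<close> of \<open>s\<close> occurs in \<open>t\<close>. Every letter before its first occurrence there is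
  adjacent to \<open>v\<close>, as the projection to that letter and \<open>v\<close> shows. So \<open>v\<close> can be swapped to the front.\<close>

lemma proj_equiv_swap_steps: "proj_equiv s t \<Longrightarrow> swap_step\<^sup>*\<^sup>* t s"
proof (induction s arbitrary: t)
  case Nil
  have "w \<notin> set t" for w
  proof -
    have "filter (\<lambda>x. x = w) t = []" using proj_equivD[OF Nil adj_irrefl, of w] by simp
    then show ?thesis by (auto simp: filter_empty_conv)
  qed
  then have "set t = {}" by (intro equals0I) simp
  then show ?case by simp
next
  case (Cons v s)
  have "v # filter (\<lambda>w. w = v) s = filter (\<lambda>w. w = v) t"
    using proj_equivD[OF Cons.prems adj_irrefl, of v] by simp
  then have "v \<in> set (filter (\<lambda>w. w = v) t)" by (metis list.set_intros(1))
  then have "v \<in> set t" by simp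
  then obtain p q where t: "t = p @ v # q" "v \<notin> set p" by (meson split_list_first)
  have "u \<rightarrow>\<^bsub>G\<^esub> v" if u: "u \<in> set p" for u
  proof (rule ccontr)
    assume "\<not> u \<rightarrow>\<^bsub>G\<^esub> v"
    from proj_equivD[OF Cons.prems this]
    have *: "v # filter (\<lambda>w. w = u \<or> w = v) s
        = filter (\<lambda>w. w = u \<or> w = v) p @ v # filter (\<lambda>w. w = u \<or> w = v) q"
      by (simp add: t)
    have ne: "filter (\<lambda>w. w = u \<or> w = v) p \<noteq> []" using u by (auto simp: filter_empty_conv)
    then have "hd (filter (\<lambda>w. w = u \<or> w = v) p) \<in> set (filter (\<lambda>w. w = u \<or> w = v) p)"
      by (rule hd_in_set)
    moreover have "hd (filter (\<lambda>w. w = u \<or> w = v) p) = v"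
      using arg_cong[OF *, of hd] ne by simp
    ultimately show False using t(2) by auto
  qed
  then have front: "swap_step\<^sup>*\<^sup>* t (v # p @ q)" unfolding t(1) by (rule swap_steps_to_front)
  have "proj_equiv (v # s) (v # p @ q)"
    using Cons.prems swap_steps_proj_equiv[OF front] proj_equiv_trans by blast
  then have "swap_step\<^sup>*\<^sup>* (p @ q) s" using Cons.IH by simp
  then show ?case using front swap_steps_Cons[of "p @ q" s v] by (meson rtranclp_trans)
qed

lemma proj_equiv_iff: "proj_equiv s t \<longleftrightarrow> swap_step\<^sup>*\<^sup>* s t"
proof
  assume "proj_equiv s t"
  then show "swap_step\<^sup>*\<^sup>* s t" by (rule proj_equiv_swap_steps[OF proj_equiv_sym])
qed (rule swap_steps_proj_equiv)

lemma proj_equiv_length: "proj_equiv s t \<Longrightarrow> length s = length t"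
  using cyc_steps_length[OF swap_cyc_steps, of s t] by (simp add: proj_equiv_iff)

lemma swap_step_set: "swap_step s t \<Longrightarrow> set s = set t"
  by (auto simp: swap_step_def)

lemma swap_steps_set: "swap_step\<^sup>*\<^sup>* s t \<Longrightarrow> set s = set t"
  by (induction rule: rtranclp_induct) (simp_all add: swap_step_set)

lemma proj_equiv_set: "proj_equiv s t \<Longrightarrow> set s = set t"
  by (simp add: proj_equiv_iff swap_steps_set)

definition trace_ind :: "'a list \<Rightarrow> 'a list \<Rightarrow> int" where
  "trace_ind t = (\<lambda>s. of_bool (proj_equiv t s))"

lemma trace_ind_admissible:
  assumes "length t < n" shows "admissible n (trace_ind t)"
  unfolding trace_ind_def
proof (rule class_indicator_admissible)
  show "proj_equiv t s \<longleftrightarrow> proj_equiv t s'" if "swap_step s s'" for s s'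
    by (rule proj_equiv_cong[OF proj_equiv_refl swap_step_proj_equiv[OF that]])
  show "length s < n" if "proj_equiv t s" for s
    using assms proj_equiv_length[OF that] by simp
qed

lemma trace_ind_Cons: "proj_equiv t (v # t') \<Longrightarrow> (\<lambda>s. trace_ind t (v # s)) = trace_ind t'"
proof -
  assume t: "proj_equiv t (v # t')"
  have "proj_equiv t (v # s) \<longleftrightarrow> proj_equiv (v # t') (v # s)" for s
    by (rule proj_equiv_cong[OF t proj_equiv_refl])
  then show ?thesis by (simp add: trace_ind_def)
qed

lemma trace_ind_Cons_zero: "\<nexists>t'. proj_equiv t (v # t') \<Longrightarrow> (\<lambda>s. trace_ind t (v # s)) = (\<lambda>s. 0)"
  unfolding trace_ind_def by auto

lemma trace_ind_snoc: "proj_equiv t (t' @ [v]) \<Longrightarrow> (\<lambda>s. trace_ind t (s @ [v])) = trace_ind t'"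
proof -
  assume t: "proj_equiv t (t' @ [v])"
  have "proj_equiv t (s @ [v]) \<longleftrightarrow> proj_equiv (t' @ [v]) (s @ [v])" for s
    by (rule proj_equiv_cong[OF t proj_equiv_refl])
  then show ?thesis by (simp add: trace_ind_def)
qed

lemma trace_ind_snoc_zero: "\<nexists>t'. proj_equiv t (t' @ [v]) \<Longrightarrow> (\<lambda>s. trace_ind t (s @ [v])) = (\<lambda>s. 0)"
  unfolding trace_ind_def by auto

lemma magnus_zero: "a \<in> carrier A \<Longrightarrow> magnus (\<lambda>t. 0) a = 0"
  using magnus_polynomial[of 0 "\<lambda>t. 0"]
  by (simp add: admissible_def swap_invariant_def short_support_def)

lemma magnus_constant: "admissible 1 f \<Longrightarrow> a \<in> carrier A \<Longrightarrow> magnus f a = f []"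
proof (elim carrierE)
  fix w assume f: "admissible 1 f" and w: "w \<in> words V" "a = cls w"
  have "word_act w f [] - f [] = 0"
    using admissible_word_act_diff[of 0 f w] f by (simp add: admissible_def short_support_def)
  then show ?thesis using magnus_cls[OF f w(1)] w(2) by simp
qed

definition supported :: "('a list \<Rightarrow> int) \<Rightarrow> bool" where
  "supported f \<longleftrightarrow> (\<forall>t. f t \<noteq> 0 \<longrightarrow> set t \<subseteq> V)"

lemma admissible_proj_equiv:
  assumes "admissible n f" "proj_equiv s t" shows "f s = f t"
proof -
  have step: "f s' = f t'" if "swap_step s' t'" for s' t'
    using that assms(1) by (auto simp: swap_step_def admissible_def dest: swap_invariantD)
  have "swap_step\<^sup>*\<^sup>* s t" using assms(2) by (simp add: proj_equiv_iff)
  then show ?thesis by (induction rule: rtranclp_induct) (simp_all add: step)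
qed

text \<open>A function on the trace monoid with finite support is a linear combination of indicators of single
  elements.\<close>

lemma magnus_decompose:
  assumes "admissible n f" "supported f" "a \<in> carrier A" "magnus f a \<noteq> f []"
  shows "\<exists>t. f t \<noteq> 0 \<and> magnus (trace_ind t) a \<noteq> trace_ind t []"
  using assms
proof (induction "card {t. f t \<noteq> 0}" arbitrary: f rule: less_induct)
  case less
  have "length t \<le> n" if "f t \<noteq> 0" for t
    using that less.prems(1) unfolding admissible_def short_support_def by (meson nat_le_linear)
  then have "{t. f t \<noteq> 0} \<subseteq> {t. set t \<subseteq> V \<and> length t \<le> n}"
    using less.prems(2) by (auto simp: supported_def)
  then have fin: "finite {t. f t \<noteq> 0}"
    by (rule finite_subset) (rule finite_lists_length_le[OF finite_verts])
  have "f \<noteq> (\<lambda>t. 0)" using less.prems(3,4) magnus_zero by auto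
  then obtain t where t: "f t \<noteq> 0" by auto
  show ?case
  proof (cases "magnus (trace_ind t) a = trace_ind t []")
    case True
    have "length t < n"
      using t less.prems(1) unfolding admissible_def short_support_def by (meson not_le)
    note ti = trace_ind_admissible[OF this]
    define f' where "f' = (\<lambda>s. 1 * f s + (- f t) * trace_ind t s)"
    have same: "f s = f t" if "proj_equiv t s" for s
      using admissible_proj_equiv[OF less.prems(1) that] by simp
    have f'_sub: "f s \<noteq> 0" if "f' s \<noteq> 0" for s
      using that same[of s] t by (auto simp: f'_def trace_ind_def)
    have f': "admissible n f'" unfolding f'_def by (rule admissible_lincomb[OF less.prems(1) ti])
    have "f' t = 0" by (simp add: f'_def trace_ind_def)
    then have "{s. f' s \<noteq> 0} \<subset> {s. f s \<noteq> 0}" using f'_sub t by blast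
    then have "card {s. f' s \<noteq> 0} < card {s. f s \<noteq> 0}" by (rule psubset_card_mono[OF fin])
    moreover have "supported f'" using f'_sub less.prems(2) by (auto simp: supported_def)
    moreover have "magnus f' a \<noteq> f' []"
      using magnus_lincomb[OF less.prems(1) ti less.prems(3), of 1 "- f t"] less.prems(4) True
      by (simp add: f'_def)
    ultimately obtain s where "f' s \<noteq> 0" "magnus (trace_ind s) a \<noteq> trace_ind s []"
      using less.hyps[OF _ f' _ less.prems(3)] by blast
    then show ?thesis using f'_sub by blast
  qed (use t in blast)
qed

text \<open>Such a coefficient only depends on the image in the free abelian group on the clique.\<close>

lemma clique_coefficient:
  assumes a: "a \<in> carrier A" and exp: "\<And>v. v \<in> V \<Longrightarrow> exp_sum v a = 0"
    and t: "t \<noteq> []" "\<And>u v. u \<in> set t \<Longrightarrow> v \<in> set t \<Longrightarrow> u \<noteq> v \<Longrightarrow> u \<rightarrow>\<^bsub>G\<^esub> v"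
  shows "magnus (trace_ind t) a = 0"
proof -
  obtain w where w: "w \<in> words V" "a = cls w" using a by (rule carrierE)
  note adm = trace_ind_admissible[of t "Suc (length t)", simplified]
  have "trace_ind t (p @ u # v # q) = trace_ind t (p @ v # u # q)" for p q u v
  proof (cases "u \<in> set t \<and> v \<in> set t")
    case True
    show ?thesis
    proof (cases "u = v")
      case False
      then have "u \<rightarrow>\<^bsub>G\<^esub> v" using True t(2) by blast
      then show ?thesis using adm by (auto simp: admissible_def dest: swap_invariantD)
    qed simp
  next
    case False
    then have "\<not> proj_equiv t (p @ u # v # q)" "\<not> proj_equiv t (p @ v # u # q)"
      using proj_equiv_set by fastforce+
    then show ?thesis by (simp add: trace_ind_def)
  qed
  then have swap: "swap_invariant (\<lambda>_ _. True) (trace_ind t)" by (intro swap_invariantI)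
  have "word_exp v w = 0" for v
  proof (cases "v \<in> V")
    case True
    then show ?thesis using exp w by (simp add: exp_sum_cls)
  next
    case False
    from w(1) show ?thesis using False
      by (induction w) (auto simp: letter_exp_def)
  qed
  then have "word_act w (trace_ind t) = trace_ind t"
    using adm by (intro word_act_balanced[OF swap]) (auto simp: admissible_def)
  then have "magnus (trace_ind t) a = trace_ind t []"
    using magnus_cls[OF adm w(1)] w(2) by simp
  then show ?thesis using t(1) proj_equiv_length[of t "[]"] by (auto simp: trace_ind_def)
qed

end

context graph
begin

interpretation raag: group A by (rule group_raag)

text \<open>The hypotheses say that \<open>lam\<close> is, in degree \<open>k\<close>, the coefficient function of an element of the
  algebra of the trace monoid that commutes with the sum of all variables: \<open>L v t\<close> and \<open>R v t\<close>
  stand for the value of \<open>lam\<close> at \<open>t\<close> with one letter \<open>v\<close> divided off on the left and on the right.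

  By induction on the support, assume that \<open>lam\<close> vanishes on words using fewer vertices. If the
  support is not a clique, pick non-adjacent \<open>a\<close> and \<open>u\<close> in it, and among the words with non-zero
  coefficient a word \<open>s\<close> with the largest number of \<open>a\<close>, and then with the longest block of \<open>a\<close> at
  the front of the projection to \<open>a\<close> and \<open>u\<close>. Comparing coefficients at \<open>a # s\<close> yields a word \<open>s'\<close> with
  non-zero coefficient and \<open>a # s = s' @ [a]\<close> in the trace monoid. As \<open>u\<close> occurs in \<open>s'\<close>, the front block
  of \<open>s'\<close> is longer by one than that of \<open>s\<close>, a contradiction.\<close>

lemma centralizer_combinatorics:
  fixes lam :: "'a list \<Rightarrow> int"
  assumes L: "\<And>v t. L v t \<noteq> 0 \<Longrightarrow> \<exists>s. proj_equiv t (v # s) \<and> L v t = lam s"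
    and L_Cons: "\<And>v t. L v (v # t) = lam t"
    and R: "\<And>v t. R v t \<noteq> 0 \<Longrightarrow> \<exists>s. proj_equiv t (s @ [v]) \<and> R v t = lam s"
    and eq: "\<And>t. length t = Suc k \<Longrightarrow> set t \<subseteq> V \<Longrightarrow> (\<Sum>v\<in>V. L v t) = (\<Sum>v\<in>V. R v t)"
    and clique: "\<And>t. length t = k \<Longrightarrow> set t \<subseteq> V \<Longrightarrow>
      (\<And>u v. u \<in> set t \<Longrightarrow> v \<in> set t \<Longrightarrow> u \<noteq> v \<Longrightarrow> u \<rightarrow>\<^bsub>G\<^esub> v) \<Longrightarrow> lam t = 0"
  shows "length t = k \<Longrightarrow> set t \<subseteq> V \<Longrightarrow> lam t = 0"
proof (induction "card (set t)" arbitrary: t rule: less_induct)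
  case less
  show ?case
  proof (rule ccontr)
    assume t: "lam t \<noteq> 0"
    then obtain a u where au: "a \<in> set t" "u \<in> set t" "a \<noteq> u" "\<not> a \<rightarrow>\<^bsub>G\<^esub> u"
      using clique less.prems by blast
    define good where "good s \<longleftrightarrow> length s = k \<and> set s \<subseteq> set t \<and> lam s \<noteq> 0" for s
    have full: "set s = set t" if "good s" for s
    proof (rule ccontr)
      assume "set s \<noteq> set t"
      then have "card (set s) < card (set t)"
        using that by (intro psubset_card_mono) (auto simp: good_def)
      then show False using less.hyps[of s] that less.prems by (auto simp: good_def)
    qed
    define count where "count s = length (filter (\<lambda>w. w = a) s)" for s
    define proj where "proj s = filter (\<lambda>w. w = a \<or> w = u) s" for s
    define lead where "lead s = length (takeWhile (\<lambda>w. w = a) (proj s))" for s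
    (* orders lexicographically by count, then lead, since lead is at most k *)
    define m where "m s = count s * Suc k + lead s" for s
    have lead_le: "lead s \<le> length s" for s
      unfolding lead_def proj_def using length_takeWhile_le length_filter_le le_trans by blast
    have count_le: "count s \<le> length s" for s unfolding count_def by simp
    have bound: "m s < k * Suc k + Suc k" if "good s" for s
    proof -
      have "length s = k" using that by (simp add: good_def)
      then have "count s * Suc k \<le> k * Suc k" "lead s \<le> k"
        using mult_le_mono1[OF count_le[of s], of "Suc k"] lead_le[of s] by simp_all
      then show ?thesis by (simp add: m_def)
    qed
    have "good t" using t less.prems by (simp add: good_def)
    then obtain s where s: "good s" and max: "\<And>s'. good s' \<Longrightarrow> m s' \<le> m s"
      using ex_has_greatest_nat[of good t m "k * Suc k + Suc k"] bound by blast
    have proj_eq: "proj x = proj y" if "proj_equiv x y" for x y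
      unfolding proj_def by (rule proj_equivD[OF that au(4)])
    have count_eq: "count x = count y" if "proj_equiv x y" for x y
      using proj_equivD[OF that adj_irrefl, of a] by (simp add: count_def)
    have len_s: "length s = k" and set_s: "set s \<subseteq> set t" and lam_s: "lam s \<noteq> 0"
      using s by (simp_all add: good_def)
    have good_I: "good s'" if "proj_equiv (a # s) r" "set r = insert v (set s')"
        "length r = Suc (length s')" "lam s' \<noteq> 0" for s' r v
    proof -
      have "set (a # s) = insert v (set s')" using proj_equiv_set[OF that(1)] that(2) by simp
      moreover have "length s' = k" using proj_equiv_length[OF that(1)] that(3) len_s by simp
      ultimately show ?thesis using au(1) set_s that(4) by (auto simp: good_def)
    qed
    have more: False if s': "good s'" and c: "count s' = Suc (count s)" for s'
    proof -
      have "m s < m s'"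
        using lead_le[of s] len_s by (simp add: m_def c)
      then show False using max[OF s'] by simp
    qed
    have "L v (a # s) = 0" if v: "v \<noteq> a" for v
    proof (rule ccontr)
      assume "L v (a # s) \<noteq> 0"
      then obtain s' where s': "proj_equiv (a # s) (v # s')" "lam s' \<noteq> 0" using L by metis
      have "good s'" by (rule good_I[OF s'(1)]) (use s'(2) in auto)
      moreover have "count s' = Suc (count s)" using count_eq[OF s'(1)] v by (simp add: count_def)
      ultimately show False by (rule more)
    qed
    moreover have a: "a \<in> V" using au(1) less.prems by blast
    ultimately have "(\<Sum>v\<in>V. L v (a # s)) = (\<Sum>v\<in>{a}. L v (a # s))"
      by (intro sum.mono_neutral_right) auto
    also have "\<dots> \<noteq> 0" using lam_s L_Cons by simp
    finally have "(\<Sum>v\<in>V. R v (a # s)) \<noteq> 0"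
      using eq[of "a # s"] len_s set_s less.prems a by auto
    then obtain v where "R v (a # s) \<noteq> 0" by (meson sum.neutral)
    then obtain s' where s': "proj_equiv (a # s) (s' @ [v])" "lam s' \<noteq> 0" using R by metis
    have g': "good s'" by (rule good_I[OF s'(1)]) (use s'(2) in auto)
    show False
    proof (cases "v = a")
      case False
      have "count s' = Suc (count s)" using count_eq[OF s'(1)] False by (simp add: count_def)
      then show False using more[OF g'] by blast
    next
      case True
      have c: "count s' = count s" using count_eq[OF s'(1)] True by (simp add: count_def)
      have p: "a # proj s = proj s' @ [a]" using proj_eq[OF s'(1)] True by (simp add: proj_def)
      have "u \<in> set (proj s')" using full[OF g'] au by (auto simp: proj_def)
      then have "takeWhile (\<lambda>w. w = a) (proj s' @ [a]) = takeWhile (\<lambda>w. w = a) (proj s')"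
        using au(3) by (intro takeWhile_append1) auto
      then have "takeWhile (\<lambda>w. w = a) (proj s') = a # takeWhile (\<lambda>w. w = a) (proj s)"
        using arg_cong[OF p, of "takeWhile (\<lambda>w. w = a)"] by simp
      then have "lead s' = Suc (lead s)" by (simp add: lead_def)
      then have "m s < m s'" by (simp add: m_def c)
      then show False using max[OF g'] by simp
    qed
  qed
qed

lemma supported_word_act_positive:
  assumes "supported f" shows "supported (word_act (map (\<lambda>v. (v, True)) vs) f)"
  using assms
proof (induction vs arbitrary: f)
  case (Cons v vs)
  have "supported (letter_act (v, True) f)"
    unfolding supported_def
  proof (intro allI impI)
    fix t assume "letter_act (v, True) f t \<noteq> 0"
    then have "f t \<noteq> 0 \<or> f (v # t) \<noteq> 0" by auto
    then show "set t \<subseteq> V" using Cons.prems unfolding supported_def by (metis set_subset_Cons subset_trans)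
  qed
  then show ?case using Cons.IH by simp
qed simp

text \<open>Multiplication by \<open>1\<close> plus the sum of the variables in \<open>vs\<close>.\<close>

definition linear_part :: "'a list \<Rightarrow> ('a list \<Rightarrow> int) \<Rightarrow> 'a list \<Rightarrow> int" where
  "linear_part vs f t = f t + (\<Sum>v\<leftarrow>vs. f (v # t))"

lemma linear_part_Nil [simp]: "linear_part [] f = f"
  by (simp add: linear_part_def fun_eq_iff)

lemma linear_part_Cons: "linear_part (v # vs) f t = linear_part vs f t + f (v # t)"
  by (simp add: linear_part_def)

lemma admissible_add: "admissible n f \<Longrightarrow> admissible n h \<Longrightarrow> admissible n (\<lambda>t. f t + h t)"
  using admissible_lincomb[of n f h 1 1] by simp

lemma admissible_linear_part: "admissible (Suc n) f \<Longrightarrow> admissible (Suc n) (linear_part vs f)"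
proof (induction vs)
  case (Cons v vs)
  have "admissible (Suc n) (\<lambda>t. linear_part vs f t + f (v # t))"
    using Cons admissible_mono[OF admissible_Cons[OF Cons.prems, of v], of "Suc n"]
    by (intro admissible_add) auto
  then show ?case by (simp add: linear_part_Cons[abs_def] fun_eq_iff)
qed simp

text \<open>A product of generators expands to \<open>1\<close> plus the sum of its letters plus terms of degree at least
  two, and the latter shorten the support by two.\<close>

lemma higher_part_admissible:
  assumes f: "admissible (Suc (Suc n)) f"
  shows "admissible n (\<lambda>t. word_act (map (\<lambda>v. (v, True)) vs) f t - linear_part vs f t)"
proof (induction vs)
  case Nil
  show ?case using f by (simp add: admissible_def swap_invariant_def short_support_def)
next
  case (Cons v vs)
  let ?W = "map (\<lambda>v. (v, True)) vs"
  let ?f = "\<lambda>t. f (v # t)"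
  have f': "admissible (Suc n) ?f" by (rule admissible_Cons[OF f])
  have "admissible n (\<lambda>t. word_act ?W ?f t - ?f t)" by (rule admissible_word_act_diff[OF f'])
  from admissible_add[OF Cons.IH this]
  have "admissible n (\<lambda>t. (word_act ?W f t + word_act ?W ?f t) - linear_part (v # vs) f t)"
    by (simp add: linear_part_Cons algebra_simps)
  moreover have "letter_act (v, True) f = (\<lambda>t. f t + f (v # t))" by auto
  moreover have "word_act ?W (\<lambda>t. f t + f (v # t)) t = word_act ?W f t + word_act ?W ?f t" for t
    using f admissible_mono[OF f', of "Suc (Suc n)"]
    by (intro word_act_add[of "Suc (Suc n)"]) (auto simp: admissible_def)
  ultimately show ?case by simp
qed

lemma positive_words: "set vs \<subseteq> V \<Longrightarrow> map (\<lambda>v. (v, True)) vs \<in> words V"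
  by (induction vs) auto

lemma coxeter_cls: "set vs \<subseteq> V \<Longrightarrow> coxeter vs = cls (map (\<lambda>v. (v, True)) vs)"
proof (induction vs)
  case (Cons v vs)
  then have "coxeter vs = cls (map (\<lambda>v. (v, True)) vs)" by simp
  then show ?case
    using Cons.prems positive_words[of vs] cls_append[of "[(v, True)]" "map (\<lambda>v. (v, True)) vs"]
    by (simp add: coxeter_def gen_def)
qed (simp add: coxeter_def cls_Nil)

lemma coxeter_closed [simp]: "set vs \<subseteq> V \<Longrightarrow> coxeter vs \<in> carrier A"
  unfolding coxeter_def by (rule syl_value_closed[OF unit_syllables])

lemma magnus_linear_part:
  assumes f: "admissible (Suc n) f" and a: "a \<in> carrier A"
  shows "magnus (linear_part vs f) a = magnus f a + (\<Sum>v\<leftarrow>vs. magnus (\<lambda>t. f (v # t)) a)"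
proof (induction vs)
  case (Cons v vs)
  have f': "admissible (Suc n) (\<lambda>t. f (v # t))"
    by (rule admissible_mono[OF admissible_Cons[OF f]]) simp
  have "linear_part (v # vs) f = (\<lambda>t. 1 * linear_part vs f t + 1 * f (v # t))"
    by (simp add: fun_eq_iff linear_part_Cons)
  then show ?case using magnus_lincomb[OF admissible_linear_part[OF f] f' a, of 1 vs 1] Cons.IH by simp
qed simp

lemma admissible_append: "admissible (n + length s) f \<Longrightarrow> admissible n (\<lambda>t. f (t @ s))"
  by (simp add: admissible_def swap_invariant_append short_support_def)

text \<open>If \<open>a\<close> is not \<open>1\<close>, its Magnus expansion is \<open>1\<close> plus terms of degree at least \<open>k\<close>, for some
  \<open>k \<ge> 1\<close> such that the component \<open>lam\<close> of degree \<open>k\<close> is not \<open>0\<close>. In degree \<open>k + 1\<close>, commuting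
  with the product of the generators means that \<open>lam\<close> commutes with the sum of the variables, and
  since the exponent sums of \<open>a\<close> vanish, so do the coefficients at words in a clique. This is what
  \<open>centralizer_combinatorics\<close> excludes.\<close>

lemma commutes_coxeter_balanced:
  assumes vs: "distinct vs" "set vs = V" and a: "a \<in> carrier A"
    and comm: "a \<cdot> coxeter vs = coxeter vs \<cdot> a"
    and exp: "\<And>v. v \<in> V \<Longrightarrow> exp_sum v a = 0"
  shows "a = \<one>\<^bsub>A\<^esub>"
proof (rule ccontr)
  assume "a \<noteq> \<one>\<^bsub>A\<^esub>"
  define lam where "lam t = magnus (trace_ind t) a" for t
  define Q where "Q t \<longleftrightarrow> t \<noteq> [] \<and> set t \<subseteq> V \<and> lam t \<noteq> 0" for t
  have "\<exists>t. Q t"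
    using swap_class_separates[OF a \<open>a \<noteq> \<one>\<^bsub>A\<^esub>\<close>] by (simp add: Q_def lam_def trace_ind_def proj_equiv_iff)
  then obtain t0 where t0: "Q t0" and least: "\<And>t. Q t \<Longrightarrow> length t0 \<le> length t"
    using ex_has_least_nat[of Q _ length] by blast
  define k where "k = length t0"
  have k: "k \<ge> 1" using t0 by (cases t0) (auto simp: Q_def k_def)
  have low: "magnus f a = f []" if f: "admissible k f" "supported f" for f
  proof (rule ccontr)
    assume "magnus f a \<noteq> f []"
    then obtain t where t: "f t \<noteq> 0" "magnus (trace_ind t) a \<noteq> trace_ind t []"
      using magnus_decompose[OF f a] by blast
    have "t \<noteq> []"
    proof
      assume "t = []"
      then have "admissible 1 (trace_ind t)" using trace_ind_admissible[of t 1] by simp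
      then show False using magnus_constant[OF _ a] t(2) by blast
    qed
    moreover from this have "trace_ind t [] = 0"
      using proj_equiv_length[of t "[]"] by (auto simp: trace_ind_def)
    ultimately have "Q t" using t f(2) by (auto simp: Q_def lam_def supported_def)
    then have "k \<le> length t" using least by (simp add: k_def)
    then show False using t(1) f(1) by (simp add: admissible_def short_support_def)
  qed
  obtain wa where wa: "wa \<in> words V" "a = cls wa" using a by (rule carrierE)
  let ?W = "map (\<lambda>v. (v, True)) vs"
  have W: "?W \<in> words V" "coxeter vs = cls ?W" using vs coxeter_cls[of vs] positive_words[of vs] by simp_all
  have eq: "(\<Sum>v\<in>V. magnus (\<lambda>s. trace_ind t (v # s)) a) = (\<Sum>v\<in>V. magnus (\<lambda>s. trace_ind t (s @ [v])) a)"
    if t: "length t = Suc k" "set t \<subseteq> V" for t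
  proof -
    let ?f = "trace_ind t"
    have f: "admissible (Suc (Suc k)) ?f" using trace_ind_admissible t(1) by simp
    have sf: "supported ?f" using t(2) proj_equiv_set by (auto simp: supported_def trace_ind_def)
    have short: "?f [] = 0" "?f [v] = 0" for v
      using t(1) k proj_equiv_length by (fastforce simp: trace_ind_def)+
    have left: "magnus ?f (coxeter vs \<cdot> a)
        = magnus ?f a + (\<Sum>v\<in>V. magnus (\<lambda>s. ?f (v # s)) a) + word_act ?W ?f []"
    proof -
      define r where "r = (\<lambda>t. word_act ?W ?f t - linear_part vs ?f t)"
      have r: "admissible k r" unfolding r_def by (rule higher_part_admissible[OF f])
      have "supported r"
        unfolding supported_def
      proof (intro allI impI)
        fix s assume "r s \<noteq> 0"
        then have "word_act ?W ?f s \<noteq> 0 \<or> ?f s \<noteq> 0 \<or> (\<Sum>v\<leftarrow>vs. ?f (v # s)) \<noteq> 0"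
          by (auto simp: r_def linear_part_def)
        moreover have "(\<Sum>v\<leftarrow>vs. ?f (v # s)) = 0" if "\<And>v. ?f (v # s) = 0"
          by (simp add: that)
        ultimately have "word_act ?W ?f s \<noteq> 0 \<or> ?f s \<noteq> 0 \<or> (\<exists>v. ?f (v # s) \<noteq> 0)" by blast
        then show "set s \<subseteq> V"
          using supported_word_act_positive[OF sf, of vs] sf unfolding supported_def
          by (metis set_subset_Cons subset_trans)
      qed
      then have "magnus r a = r []" by (rule low[OF r])
      then have 1: "magnus r a = word_act ?W ?f []"
        by (simp add: r_def linear_part_def short)
      have "word_act ?W ?f = (\<lambda>t. 1 * linear_part vs ?f t + 1 * r t)"
        by (simp add: r_def fun_eq_iff)
      then have "magnus (word_act ?W ?f) a = magnus (linear_part vs ?f) a + magnus r a"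
        using magnus_lincomb[OF admissible_linear_part[OF f] admissible_mono[OF r] a, of 1 vs 1] by simp
      then show ?thesis
        using magnus_mult[OF f W(1) a] magnus_linear_part[OF f a, of vs] vs 1
        by (simp add: W(2) sum_list_distinct_conv_sum_set)
    qed
    have right: "magnus ?f (a \<cdot> coxeter vs)
        = magnus ?f a + (\<Sum>v\<in>V. magnus (\<lambda>s. ?f (s @ [v])) a) + word_act ?W ?f []"
    proof -
      define h where "h = word_act wa ?f"
      (* u lives in degrees at most one, where the product of generators acts by its linear part *)
      define u where "u = (\<lambda>t. 1 * h t + (-1) * ?f t)"
      have h: "admissible (Suc (Suc k)) h" unfolding h_def by (rule admissible_word_act[OF f])
      have h_eq: "h p = magnus (\<lambda>t. ?f (t @ p)) a" for p
      proof -
        have "admissible (Suc (Suc k)) (\<lambda>t. ?f (t @ p))"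
          by (rule admissible_append) (rule admissible_mono[OF f], simp)
        then show ?thesis
          using magnus_cls[OF _ wa(1)] word_act_append[of wa ?f p "[]"] by (simp add: h_def wa(2))
      qed
      have "u p = 0" if p: "2 \<le> length p" for p
      proof -
        have "admissible k (\<lambda>t. ?f (t @ p))"
          by (rule admissible_append) (rule admissible_mono[OF f], use p in simp)
        moreover have "supported (\<lambda>t. ?f (t @ p))"
          using sf unfolding supported_def by fastforce
        ultimately show ?thesis using low[of "\<lambda>t. ?f (t @ p)"] by (simp add: u_def h_eq)
      qed
      then have u: "admissible (Suc (Suc 0)) u"
        using admissible_lincomb[OF h f, of 1 "-1"]
        by (auto simp: admissible_def short_support_def u_def numeral_2_eq_2)
      have "word_act ?W u [] = linear_part vs u []"
        using higher_part_admissible[OF u, of vs] by (simp add: admissible_def short_support_def)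
      also have "\<dots> = magnus ?f a + (\<Sum>v\<leftarrow>vs. magnus (\<lambda>s. ?f (s @ [v])) a)"
        by (simp add: linear_part_def u_def h_eq short)
      finally have 1: "word_act ?W u [] = \<dots>" .
      have "h = (\<lambda>t. 1 * ?f t + 1 * u t)" by (simp add: u_def fun_eq_iff)
      then have "word_act ?W h [] = word_act ?W ?f [] + word_act ?W u []"
        using word_act_lincomb[of "Suc (Suc k)" ?f u ?W 1 1] f admissible_mono[OF u, of "Suc (Suc k)"]
        by (simp add: admissible_def)
      moreover have "magnus ?f (a \<cdot> coxeter vs) = word_act ?W h []"
        using magnus_mult[OF f wa(1), of "coxeter vs"] magnus_cls[OF h W(1)] W(1)
        by (simp add: wa(2) W(2) h_def)
      ultimately show ?thesis using vs 1 by (simp add: sum_list_distinct_conv_sum_set)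
    qed
    show ?thesis using left right comm by simp
  qed
  have "lam t0 = 0"
  proof (rule centralizer_combinatorics[of "\<lambda>v t. magnus (\<lambda>s. trace_ind t (v # s)) a" lam
        "\<lambda>v t. magnus (\<lambda>s. trace_ind t (s @ [v])) a" k])
    show "\<exists>s. proj_equiv t (v # s) \<and> magnus (\<lambda>s. trace_ind t (v # s)) a = lam s"
      if "magnus (\<lambda>s. trace_ind t (v # s)) a \<noteq> 0" for v t
      using that trace_ind_Cons trace_ind_Cons_zero magnus_zero[OF a] by (metis lam_def)
    show "\<exists>s. proj_equiv t (s @ [v]) \<and> magnus (\<lambda>s. trace_ind t (s @ [v])) a = lam s"
      if "magnus (\<lambda>s. trace_ind t (s @ [v])) a \<noteq> 0" for v t
      using that trace_ind_snoc trace_ind_snoc_zero magnus_zero[OF a] by (metis lam_def)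
    show "magnus (\<lambda>s. trace_ind (v # t) (v # s)) a = lam t" for v t
      by (simp only: lam_def trace_ind_Cons[OF proj_equiv_refl])
    show "lam t = 0" if "length t = k" "\<And>u v. u \<in> set t \<Longrightarrow> v \<in> set t \<Longrightarrow> u \<noteq> v \<Longrightarrow> u \<rightarrow>\<^bsub>G\<^esub> v" for t
      unfolding lam_def by (rule clique_coefficient[OF a exp _ that(2)]) (use k that(1) in auto)
  qed (use eq t0 in \<open>auto simp: k_def Q_def\<close>)
  then show False using t0 by (simp add: Q_def)
qed

end

context graph
begin

interpretation raag: group A by (rule group_raag)

section \<open>Square roots of inner automorphisms\<close>

text \<open>For the integer-valued \<open>F = cross u v\<close> of degree two, \<open>d = F \<circ> \<phi> - F\<close> has degree one, so
  \<open>d \<circ> \<phi> - d\<close> is constant, and it vanishes at \<open>1\<close>. Hence \<open>F \<circ> \<phi>\<^sup>2 - F = 2 d\<close>. At the generator \<open>v\<close>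
  the left-hand side is the exponent sum of \<open>u\<close> in \<open>g\<close>.\<close>

lemma even_exp_sum_of_square_inner:
  assumes \<phi>: "raag.unipotent \<phi>" and g: "g \<in> carrier A"
    and sq: "\<And>a. a \<in> carrier A \<Longrightarrow> \<phi> (\<phi> a) = conj_by A g a"
    and uv: "u \<noteq> v" "\<not> u \<rightarrow>\<^bsub>G\<^esub> v" and V: "v \<in> V"
  shows "even (exp_sum u g)"
proof -
  have hom: "\<phi> \<in> hom A A" using \<phi> by (simp add: raag.unipotent_def)
  have closed: "\<phi> a \<in> carrier A" if "a \<in> carrier A" for a using hom that by (rule hom_in_carrier)
  let ?F = "cross u v"
  define d where "d b = ?F (\<phi> b) - ?F b" for b
  have d: "polynomial_fun A (Suc (Suc 0)) d"
    unfolding d_def by (rule raag.unipotent_lowers[OF \<phi> cross_polynomial[OF uv]])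
  define e where "e b = d (\<phi> b) - d b" for b
  have e: "polynomial_fun A (Suc 0) e"
    unfolding e_def by (rule raag.unipotent_lowers[OF \<phi> d])
  have "\<phi> \<one>\<^bsub>A\<^esub> = \<one>\<^bsub>A\<^esub>" using hom_one[OF hom raag.is_group raag.is_group] .
  then have "e \<one>\<^bsub>A\<^esub> = 0" by (simp add: e_def d_def)
  have "e b = 0" if b: "b \<in> carrier A" for b
  proof -
    have "e (b \<cdot> \<one>\<^bsub>A\<^esub>) - e \<one>\<^bsub>A\<^esub> = 0" using e b by (simp only: polynomial_fun.simps Ball_def raag.one_closed)
    then show ?thesis using b \<open>e \<one>\<^bsub>A\<^esub> = 0\<close> by simp
  qed
  then have "d (\<phi> (gen v)) = d (gen v)" using V by (simp add: e_def)
  then have "?F (conj_by A g (gen v)) - ?F (gen v) = 2 * d (gen v)"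
    using sq[of "gen v"] V by (simp add: d_def)
  moreover have "?F (conj_by A g (gen v)) - ?F (gen v) = exp_sum u g"
  proof -
    have i: "inv\<^bsub>A\<^esub> g \<in> carrier A" using g by simp
    have "0 = ?F (g \<cdot> inv\<^bsub>A\<^esub> g)" using g cross_one[OF uv] by simp
    also have "\<dots> = ?F g + ?F (inv\<^bsub>A\<^esub> g) + exp_sum u g * exp_sum v (inv\<^bsub>A\<^esub> g)"
      by (rule cross_mult[OF uv g i])
    finally have 1: "?F (inv\<^bsub>A\<^esub> g) = - ?F g + exp_sum u g * exp_sum v g" using g by simp
    have "?F (conj_by A g (gen v)) = ?F (g \<cdot> gen v) + ?F (inv\<^bsub>A\<^esub> g)
        + exp_sum u (g \<cdot> gen v) * exp_sum v (inv\<^bsub>A\<^esub> g)"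
      unfolding conj_by_def by (rule cross_mult[OF uv]) (use g V in auto)
    also have "?F (g \<cdot> gen v) = ?F g + ?F (gen v) + exp_sum u g * exp_sum v (gen v)"
      by (rule cross_mult[OF uv]) (use g V in auto)
    finally show ?thesis using 1 g V uv by simp
  qed
  ultimately show ?thesis by simp
qed

lemma commutes_with_generators:
  assumes c: "c \<in> carrier A" and gen: "\<And>v. v \<in> V \<Longrightarrow> gen v \<cdot> c = c \<cdot> gen v" and a: "a \<in> carrier A"
  shows "a \<cdot> c = c \<cdot> a"
  using a
proof (induction a rule: raag_induct)
  case one
  then show ?case using c by simp
next
  case (gen v b)
  have "gen v \<cdot> b \<cdot> c = gen v \<cdot> c \<cdot> b" using gen c by (simp add: raag.m_assoc)
  also have "\<dots> = c \<cdot> (gen v \<cdot> b)" using gen c assms(2)[OF gen(1)] by (simp add: raag.m_assoc)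
  finally show ?case .
next
  case (inv v b)
  let ?i = "inv\<^bsub>A\<^esub> gen v"
  have "gen v [^]\<^bsub>A\<^esub> (-1::int) \<cdot> c = c \<cdot> gen v [^]\<^bsub>A\<^esub> (-1::int)"
    by (rule raag.commutes_int_pow[OF assms(2)]) (use inv c in auto)
  then have i: "?i \<cdot> c = c \<cdot> ?i" using raag.int_pow_neg[of "gen v" 1] inv by simp
  have "?i \<cdot> b \<cdot> c = ?i \<cdot> c \<cdot> b" using inv c by (simp add: raag.m_assoc)
  also have "\<dots> = c \<cdot> (?i \<cdot> b)" using inv c i by (simp add: raag.m_assoc)
  finally show ?case .
qed

lemma coxeter_Cons: "v \<in> V \<Longrightarrow> coxeter (v # vs) = gen v \<cdot> coxeter vs"
  by (simp add: coxeter_def)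

lemma coxeter_Nil: "coxeter [] = \<one>\<^bsub>A\<^esub>"
  by (simp add: coxeter_def)

lemma commutes_coxeter:
  assumes "b \<in> carrier A"
  shows "set vs \<subseteq> V \<Longrightarrow> (\<And>v. v \<in> set vs \<Longrightarrow> b \<cdot> gen v = gen v \<cdot> b) \<Longrightarrow> b \<cdot> coxeter vs = coxeter vs \<cdot> b"
proof (induction vs)
  case (Cons v vs)
  have V: "v \<in> V" "set vs \<subseteq> V" using Cons.prems by auto
  have "b \<cdot> (gen v \<cdot> coxeter vs) = gen v \<cdot> b \<cdot> coxeter vs"
    using Cons.prems(2)[of v] assms V by (simp flip: raag.m_assoc)
  also have "\<dots> = gen v \<cdot> coxeter vs \<cdot> b" using Cons assms V by (simp add: raag.m_assoc)
  finally show ?case using V by (simp add: coxeter_Cons)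
qed (use assms in \<open>simp add: coxeter_Nil\<close>)

lemma coxeter_split:
  assumes "set vs \<subseteq> V" "\<And>u v. u \<in> set vs \<Longrightarrow> v \<in> set vs \<Longrightarrow> P u \<Longrightarrow> \<not> P v \<Longrightarrow> u \<rightarrow>\<^bsub>G\<^esub> v"
  shows "coxeter vs = coxeter (filter P vs) \<cdot> coxeter (filter (\<lambda>v. \<not> P v) vs)"
  using assms
proof (induction vs)
  case (Cons v vs)
  have V: "v \<in> V" "set vs \<subseteq> V" "set (filter P vs) \<subseteq> V" "set (filter (\<lambda>v. \<not> P v) vs) \<subseteq> V"
    using Cons.prems by auto
  have IH: "coxeter vs = coxeter (filter P vs) \<cdot> coxeter (filter (\<lambda>v. \<not> P v) vs)"
    by (rule Cons.IH) (use Cons.prems in auto)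
  show ?case
  proof (cases "P v")
    case True
    then show ?thesis using V IH by (simp add: coxeter_Cons raag.m_assoc)
  next
    case False
    have "gen v \<cdot> coxeter (filter P vs) = coxeter (filter P vs) \<cdot> gen v"
    proof (rule commutes_coxeter)
      show "gen v \<cdot> gen u = gen u \<cdot> gen v" if "u \<in> set (filter P vs)" for u
        using gen_commute[OF Cons.prems(2)[of u v]] that False by simp
    qed (use V in auto)
    then show ?thesis using V False IH by (simp add: coxeter_Cons flip: raag.m_assoc)
  qed
qed (simp add: coxeter_Nil)

lemma exp_sum_coxeter:
  "distinct vs \<Longrightarrow> set vs \<subseteq> V \<Longrightarrow> exp_sum u (coxeter vs) = (if u \<in> set vs then 1 else 0)"
  by (induction vs) (auto simp: coxeter_Nil coxeter_Cons)

lemma commutes_mult: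
  assumes "a \<cdot> x = x \<cdot> a" "b \<cdot> x = x \<cdot> b" "a \<in> carrier A" "b \<in> carrier A" "x \<in> carrier A"
  shows "(a \<cdot> b) \<cdot> x = x \<cdot> (a \<cdot> b)"
proof -
  have "(a \<cdot> b) \<cdot> x = a \<cdot> (x \<cdot> b)" using assms by (simp add: raag.m_assoc)
  also have "\<dots> = x \<cdot> (a \<cdot> b)" using assms by (simp flip: raag.m_assoc)
  finally show ?thesis .
qed

text \<open>Vertices with different values of \<open>m\<close> are adjacent. So the product of all generators splits into
  commuting factors, one for each value of \<open>m\<close>, and raising each factor to its value gives \<open>h\<close>.\<close>

lemma commuting_element_exists:
  assumes vs: "distinct vs" "set vs = V"
    and m: "\<And>u v. u \<in> V \<Longrightarrow> v \<in> V \<Longrightarrow> u \<noteq> v \<Longrightarrow> \<not> u \<rightarrow>\<^bsub>G\<^esub> v \<Longrightarrow> m u = m v"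
  shows "\<exists>h\<in>carrier A. h \<cdot> coxeter vs = coxeter vs \<cdot> h \<and> (\<forall>v\<in>V. exp_sum v h = m v)"
proof -
  have x: "coxeter vs \<in> carrier A" using vs by simp
  have "\<exists>h\<in>carrier A. h \<cdot> coxeter vs = coxeter vs \<cdot> h \<and>
      (\<forall>v\<in>V. exp_sum v h = (if m v \<in> C then m v else 0))" if "finite C" for C
    using that
  proof (induction C)
    case empty
    show ?case using x by (intro bexI[of _ "\<one>\<^bsub>A\<^esub>"]) auto
  next
    case (insert c C)
    then obtain h where h: "h \<in> carrier A" "h \<cdot> coxeter vs = coxeter vs \<cdot> h"
        "\<forall>v\<in>V. exp_sum v h = (if m v \<in> C then m v else 0)" by blast
    let ?y = "coxeter (filter (\<lambda>v. m v = c) vs)" and ?z = "coxeter (filter (\<lambda>v. m v \<noteq> c) vs)"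
    have y: "?y \<in> carrier A" and z: "?z \<in> carrier A" using vs by auto
    have adj: "u \<rightarrow>\<^bsub>G\<^esub> v" if "u \<in> set vs" "v \<in> set vs" "m u \<noteq> m v" for u v
      using m[of u v] that vs(2) by blast
    have "coxeter vs = ?y \<cdot> ?z"
      by (rule coxeter_split) (use vs(2) in \<open>auto intro: adj\<close>)
    moreover have "coxeter vs = ?z \<cdot> coxeter (filter (\<lambda>v. \<not> m v \<noteq> c) vs)"
      by (rule coxeter_split) (use vs(2) in \<open>auto intro: adj\<close>)
    ultimately have split: "coxeter vs = ?y \<cdot> ?z" "coxeter vs = ?z \<cdot> ?y" by simp_all
    have "?y \<cdot> coxeter vs = coxeter vs \<cdot> ?y"
      using y z by (subst split(2), subst split(1)) (simp add: raag.m_assoc)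
    then have yc: "?y [^]\<^bsub>A\<^esub> c \<cdot> coxeter vs = coxeter vs \<cdot> ?y [^]\<^bsub>A\<^esub> c"
      using y x by (rule raag.commutes_int_pow)
    have "exp_sum v (h \<cdot> ?y [^]\<^bsub>A\<^esub> c) = (if m v \<in> insert c C then m v else 0)" if "v \<in> V" for v
      using that h y vs insert.hyps(2) by (auto simp: exp_sum_coxeter)
    then show ?case
      using h y x yc by (intro bexI[of _ "h \<cdot> ?y [^]\<^bsub>A\<^esub> c"] conjI commutes_mult) auto
  qed
  from this[of "m ` V"] show ?thesis by auto
qed

lemma central_element_exists:
  assumes "finite C" "C \<subseteq> V" "\<And>v w. v \<in> C \<Longrightarrow> w \<in> V \<Longrightarrow> w \<noteq> v \<Longrightarrow> v \<rightarrow>\<^bsub>G\<^esub> w"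
  shows "\<exists>z\<in>carrier A. (\<forall>a\<in>carrier A. a \<cdot> z = z \<cdot> a) \<and>
    (\<forall>v\<in>V. exp_sum v z = (if v \<in> C then m v else 0))"
  using assms
proof (induction C)
  case empty
  show ?case by (intro bexI[of _ "\<one>\<^bsub>A\<^esub>"]) auto
next
  case (insert c C)
  then obtain z where z: "z \<in> carrier A" "\<forall>a\<in>carrier A. a \<cdot> z = z \<cdot> a"
      "\<forall>v\<in>V. exp_sum v z = (if v \<in> C then m v else 0)" by auto
  let ?p = "gen c [^]\<^bsub>A\<^esub> m c"
  have c: "c \<in> V" using insert.prems by simp
  have "gen v \<cdot> gen c = gen c \<cdot> gen v" if "v \<in> V" for v
    using gen_commute[of c v] insert.prems(2)[of c v] that by (cases "v = c") auto
  then have "a \<cdot> gen c = gen c \<cdot> a" if "a \<in> carrier A" for a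
    using commutes_with_generators[of "gen c" a] c that by simp
  then have p: "a \<cdot> ?p = ?p \<cdot> a" if "a \<in> carrier A" for a
    using raag.commutes_int_pow[of "gen c" a "m c"] c that by simp
  have "(z \<cdot> ?p) \<cdot> a = a \<cdot> (z \<cdot> ?p)" if "a \<in> carrier A" for a
    by (rule commutes_mult) (use that z p c in auto)
  then show ?case
    using z c insert.hyps(2) by (intro bexI[of _ "z \<cdot> ?p"] conjI ballI) auto
qed

lemma unipotent_exp_sum:
  assumes "\<phi> \<in> hom A A"
    and "\<And>a v. a \<in> carrier A \<Longrightarrow> v \<in> V \<Longrightarrow> exp_sum v (\<phi> a) = exp_sum v a"
  shows "raag.unipotent \<phi>"
proof (rule raag.unipotentI[OF assms(1)])
  fix a assume a: "a \<in> carrier A"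
  have "\<phi> a \<in> carrier A" using assms(1) a by (rule hom_in_carrier)
  then show "raag.second_order (\<phi> a \<cdot> inv\<^bsub>A\<^esub> a)"
    using a assms(2) by (intro second_order_exp_sum) auto
qed

lemma polynomial_functions_separate:
  assumes "a \<in> carrier A" "b \<in> carrier A" and eq: "\<And>k f. polynomial_fun A k f \<Longrightarrow> f a = f b"
  shows "a = b"
proof (rule ccontr)
  assume "a \<noteq> b"
  then have "inv\<^bsub>A\<^esub> b \<cdot> a \<noteq> \<one>\<^bsub>A\<^esub>" using assms(1,2) by (metis raag.inv_closed raag.inv_equality raag.inv_inv)
  then obtain t where t: "t \<noteq> []" "magnus (\<lambda>t'. of_bool (swap_step\<^sup>*\<^sup>* t t')) (inv\<^bsub>A\<^esub> b \<cdot> a) \<noteq> 0"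
    using swap_class_separates[of "inv\<^bsub>A\<^esub> b \<cdot> a"] assms(1,2) by auto
  then have t2: "magnus (trace_ind t) (inv\<^bsub>A\<^esub> b \<cdot> a) \<noteq> 0" by (simp add: trace_ind_def proj_equiv_iff)
  note adm = trace_ind_admissible[of t "Suc (length t)", simplified]
  have "polynomial_fun A (Suc (length t)) (\<lambda>c. magnus (trace_ind t) (inv\<^bsub>A\<^esub> b \<cdot> c))"
    by (rule raag.polynomial_fun_translate[OF magnus_polynomial[OF adm]]) (use assms in simp)
  from eq[OF this] have "magnus (trace_ind t) (inv\<^bsub>A\<^esub> b \<cdot> a) = magnus (trace_ind t) \<one>\<^bsub>A\<^esub>"
    using assms by simp
  also have "\<dots> = 0"
    using magnus_one[OF adm] t(1) proj_equiv_length[of t "[]"] by (auto simp: trace_ind_def)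
  finally show False using t2 by simp
qed

text \<open>In other words, the kernel of the action of outer automorphisms on exponent sums has no
  2-torsion: such a \<open>\<phi>\<close> represents a class in this kernel whose square is trivial.\<close>

theorem square_inner_imp_inner:
  assumes \<phi>: "\<phi> \<in> hom A A"
    and exp: "\<And>a v. a \<in> carrier A \<Longrightarrow> v \<in> V \<Longrightarrow> exp_sum v (\<phi> a) = exp_sum v a"
    and g: "g \<in> carrier A" and sq: "\<And>a. a \<in> carrier A \<Longrightarrow> \<phi> (\<phi> a) = conj_by A g a"
  shows "\<exists>h\<in>carrier A. \<forall>a\<in>carrier A. \<phi> a = conj_by A h a"
proof -
  obtain vs where vs: "distinct vs" "set vs = V" using finite_distinct_list[OF finite_verts] by blast
  define x where "x = coxeter vs"
  have x: "x \<in> carrier A" using vs by (simp add: x_def)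
  have exp_x: "exp_sum v x = 1" if "v \<in> V" for v using that vs by (simp add: x_def exp_sum_coxeter)
  have closed: "\<phi> a \<in> carrier A" if "a \<in> carrier A" for a using \<phi> that by (rule hom_in_carrier)
  have u: "raag.unipotent \<phi>" by (rule unipotent_exp_sum[OF \<phi> exp])
  have "\<exists>h\<in>carrier A. \<phi> x = conj_by A h (coxeter vs)"
  proof (rule conjugate_coxeter[OF vs closed[OF x]])
    show "exp_sum v (\<phi> x) = 1" if "v \<in> V" for v using exp[OF x that] exp_x[OF that] by simp
    fix n f assume f: "admissible n f" "\<And>s t. f (s @ t) = f (t @ s)"
    have "magnus f (\<phi> (\<phi> a)) = magnus f a" if a: "a \<in> carrier A" for a
    proof -
      have "magnus f (g \<cdot> a \<cdot> inv\<^bsub>A\<^esub> g) = magnus f (inv\<^bsub>A\<^esub> g \<cdot> (g \<cdot> a))"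
        by (rule magnus_cyclic[OF f]) (use g a in auto)
      then show ?thesis using a g sq[OF a] by (simp add: conj_by_def flip: raag.m_assoc)
    qed
    from raag.unipotent_involution_fixes[OF u magnus_polynomial[OF f(1)] this x]
    show "magnus f (\<phi> x) = magnus f (coxeter vs)" by (simp add: x_def)
  qed
  then obtain k where k: "k \<in> carrier A" "\<phi> x = conj_by A k x" by (auto simp: x_def)
  (* compose with an inner automorphism, so that x becomes a fixed point *)
  define i where "i = inv\<^bsub>A\<^esub> k"
  have i: "i \<in> carrier A" "k \<cdot> i = \<one>\<^bsub>A\<^esub>" "i \<cdot> k = \<one>\<^bsub>A\<^esub>" using k by (simp_all add: i_def)
  define \<psi> where "\<psi> = conj_by A i \<circ> \<phi>"
  have \<psi>: "\<psi> \<in> hom A A"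
    unfolding \<psi>_def by (rule hom_compose[OF \<phi> raag.conj_by_hom[OF i(1)]])
  have exp_\<psi>: "exp_sum v (\<psi> a) = exp_sum v a" if "a \<in> carrier A" "v \<in> V" for a v
    using that i closed exp by (simp add: \<psi>_def)
  define g' where "g' = i \<cdot> \<phi> i \<cdot> g"
  have g': "g' \<in> carrier A" using i g closed by (simp add: g'_def)
  have sq': "\<psi> (\<psi> a) = conj_by A g' a" if a: "a \<in> carrier A" for a
    using a i g closed raag.hom_conj_by[OF \<phi> i(1) closed[OF a]]
    by (simp add: \<psi>_def sq raag.conj_by_conj_by g'_def raag.m_assoc)
  have "\<psi> x = x" using k i x by (simp add: \<psi>_def raag.conj_by_conj_by)
  then have "conj_by A g' x = x" using sq'[OF x] by simp
  then have comm: "g' \<cdot> x = x \<cdot> g'"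
    using g' x by (metis conj_by_def raag.inv_solve_right raag.m_closed)
  have u': "raag.unipotent \<psi>" by (rule unipotent_exp_sum[OF \<psi> exp_\<psi>])
  have even: "even (exp_sum u g')" if "u \<noteq> v" "\<not> u \<rightarrow>\<^bsub>G\<^esub> v" "v \<in> V" for u v
    by (rule even_exp_sum_of_square_inner[OF u' g' sq' that])
  have const: "exp_sum u g' = exp_sum v g'" if uv: "u \<noteq> v" "\<not> u \<rightarrow>\<^bsub>G\<^esub> v" and "u \<in> V" "v \<in> V" for u v
    using arg_cong[OF comm, of "cross u v"] that g' x exp_x by (simp add: cross_mult[OF uv])
  define central where "central v \<longleftrightarrow> (\<forall>w\<in>V. w \<noteq> v \<longrightarrow> v \<rightarrow>\<^bsub>G\<^esub> w)" for v
  (* the exponent sums wanted of a square root of g' modulo the centre *)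
  define m where "m v = (if central v then 0 else exp_sum v g' div 2)" for v
  have m_const: "m u = m v" if "u \<in> V" "v \<in> V" "u \<noteq> v" "\<not> u \<rightarrow>\<^bsub>G\<^esub> v" for u v
  proof -
    have "\<not> central u" using that by (auto simp: central_def)
    moreover have "\<not> central v" using that adj_sym[of v u] by (auto simp: central_def)
    ultimately show ?thesis using const[of u v] that by (simp add: m_def)
  qed
  have "\<exists>h\<in>carrier A. h \<cdot> coxeter vs = coxeter vs \<cdot> h \<and> (\<forall>v\<in>V. exp_sum v h = m v)"
    by (rule commuting_element_exists[OF vs m_const])
  then
  obtain h where h: "h \<in> carrier A" "h \<cdot> x = x \<cdot> h" "\<And>v. v \<in> V \<Longrightarrow> exp_sum v h = m v"
    unfolding x_def by auto
  obtain z where z: "z \<in> carrier A" "\<And>a. a \<in> carrier A \<Longrightarrow> a \<cdot> z = z \<cdot> a"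
      "\<And>v. v \<in> V \<Longrightarrow> exp_sum v z = (if central v then exp_sum v g' else 0)"
  proof -
    have "\<exists>z\<in>carrier A. (\<forall>a\<in>carrier A. a \<cdot> z = z \<cdot> a) \<and>
        (\<forall>v\<in>V. exp_sum v z = (if v \<in> {v \<in> V. central v} then exp_sum v g' else 0))"
      by (rule central_element_exists) (auto simp: central_def)
    then show ?thesis using that by auto
  qed
  define s where "s = h \<cdot> h \<cdot> z"
  have s: "s \<in> carrier A" using h z by (simp add: s_def)
  have sx: "s \<cdot> x = x \<cdot> s"
    unfolding s_def by (intro commutes_mult) (use h z x in auto)
  have "inv\<^bsub>A\<^esub> s \<cdot> g' = \<one>\<^bsub>A\<^esub>"
  proof (rule commutes_coxeter_balanced[OF vs])
    have "s [^]\<^bsub>A\<^esub> (-1::int) \<cdot> x = x \<cdot> s [^]\<^bsub>A\<^esub> (-1::int)"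
      by (rule raag.commutes_int_pow[OF sx s x])
    then have "inv\<^bsub>A\<^esub> s \<cdot> x = x \<cdot> inv\<^bsub>A\<^esub> s" using raag.int_pow_neg[of s 1] s by simp
    then show "inv\<^bsub>A\<^esub> s \<cdot> g' \<cdot> coxeter vs = coxeter vs \<cdot> (inv\<^bsub>A\<^esub> s \<cdot> g')"
      unfolding x_def[symmetric] using comm s g' x by (intro commutes_mult) auto
    fix v assume v: "v \<in> V"
    have "exp_sum v g' = exp_sum v s"
    proof (cases "central v")
      case True
      then show ?thesis using v h(1) h(3)[OF v] z(1) z(3)[OF v] by (simp add: s_def m_def)
    next
      case False
      then obtain w where "w \<in> V" "w \<noteq> v" "\<not> v \<rightarrow>\<^bsub>G\<^esub> w" by (auto simp: central_def)
      then have "even (exp_sum v g')" using even[of v w] by auto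
      then have "exp_sum v g' = exp_sum v g' div 2 + exp_sum v g' div 2" by presburger
      then show ?thesis using False v h(1) h(3)[OF v] z(1) z(3)[OF v] by (simp add: s_def m_def)
    qed
    then show "exp_sum v (inv\<^bsub>A\<^esub> s \<cdot> g') = 0" using s g' by simp
  qed (use s g' in simp)
  then have g'_eq: "g' = s" using s g' by (metis raag.inv_closed raag.inv_equality raag.inv_inv)
  have conj_z: "conj_by A z b = b" if b: "b \<in> carrier A" for b
  proof -
    have "conj_by A z b = b \<cdot> z \<cdot> inv\<^bsub>A\<^esub> z" by (simp only: conj_by_def z(2)[OF b])
    also have "\<dots> = b" using z(1) b by (simp add: raag.m_assoc)
    finally show ?thesis .
  qed
  have "\<psi> (\<psi> a) = conj_by A h (conj_by A h a)" if a: "a \<in> carrier A" for a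
  proof -
    have "conj_by A (h \<cdot> h \<cdot> z) a = conj_by A (h \<cdot> h) (conj_by A z a)"
      using h(1) z(1) a by (simp add: raag.conj_by_conj_by)
    then show ?thesis
      using sq'[OF a] conj_z[OF a] h(1) a by (simp add: g'_eq s_def raag.conj_by_conj_by)
  qed
  moreover have "raag.unipotent (conj_by A h)"
    by (rule unipotent_exp_sum[OF raag.conj_by_hom[OF h(1)]]) (use h in simp)
  ultimately have "f (\<psi> a) = f (conj_by A h a)" if "polynomial_fun A k f" "a \<in> carrier A" for k f a
    using raag.unipotent_square_eq[OF u' _ _ that(1), of "conj_by A h" a] that(2) by simp
  then have inner: "\<psi> a = conj_by A h a" if "a \<in> carrier A" for a
    using that h hom_in_carrier[OF \<psi>] by (intro polynomial_functions_separate) auto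
  have "\<phi> a = conj_by A (k \<cdot> h) a" if a: "a \<in> carrier A" for a
  proof -
    have "\<phi> a = conj_by A k (\<psi> a)" using k i a closed by (simp add: \<psi>_def raag.conj_by_conj_by)
    then show ?thesis using inner[OF a] h k a by (simp add: raag.conj_by_conj_by)
  qed
  then show ?thesis using h k by blast
qed

end

section \<open>Commuting involutions\<close>

text \<open>From any spanning set, splitting a vector \<open>e\<close> into \<open>e + L i e\<close> and \<open>e - L i e\<close> for one \<open>i\<close> after
  the other produces a spanning set of common eigenvectors. On a basis of such vectors an involution
  is determined by the set of basis vectors that it fixes.\<close>

lemma (in vector_space) commuting_involutions_card:
  fixes L :: "'i \<Rightarrow> 'b \<Rightarrow> 'b"
  assumes T: "finite T" and I: "finite I" and two: "(2::'a) \<noteq> 0"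
    and add: "\<And>i x y. L i (x + y) = L i x + L i y"
    and smult: "\<And>i c x. L i (scale c x) = scale c (L i x)"
    and closed: "\<And>i x. i \<in> I \<Longrightarrow> x \<in> span T \<Longrightarrow> L i x \<in> span T"
    and invol: "\<And>i x. i \<in> I \<Longrightarrow> x \<in> span T \<Longrightarrow> L i (L i x) = x"
    and comm: "\<And>i j x. i \<in> I \<Longrightarrow> j \<in> I \<Longrightarrow> x \<in> span T \<Longrightarrow> L i (L j x) = L j (L i x)"
    and inj: "\<And>i j. i \<in> I \<Longrightarrow> j \<in> I \<Longrightarrow> (\<And>x. x \<in> span T \<Longrightarrow> L i x = L j x) \<Longrightarrow> i = j"
  shows "card I \<le> 2 ^ card T"
proof -
  have neg: "L i (- x) = - L i x" for i x
    using smult[of i "-1" x] by simp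
  have diff: "L i (x - y) = L i x - L i y" for i x y
    using add[of i x "- y"] neg by simp
  define E where "E J = {x \<in> span T. \<forall>j\<in>J. L j x = x \<or> L j x = - x}" for J
  have "span T \<subseteq> span (E J)" if "finite J" "J \<subseteq> I" for J
    using that
  proof (induction J)
    case empty
    show ?case by (simp add: E_def span_superset)
  next
    case (insert i J)
    have "E J \<subseteq> span (E (insert i J))"
    proof
      fix e assume e: "e \<in> E J"
      then have eT: "e \<in> span T" by (simp add: E_def)
      have i: "i \<in> I" using insert.prems by simp
      have ie: "L i e \<in> span T" "L i (L i e) = e" using closed invol i eT by auto
      have j: "L j (L i e) = L i (L j e)" if "j \<in> J" for j
        using comm[of j i e] that insert.prems eT by auto
      have "e + L i e \<in> E (insert i J)"
        using e j ie by (auto simp: E_def span_add add neg)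
      moreover have "e - L i e \<in> E (insert i J)"
        using e j ie by (auto simp: E_def span_diff diff neg)
      ultimately have "(e + L i e) + (e - L i e) \<in> span (E (insert i J))"
        by (intro span_add span_base)
      moreover have "(e + L i e) + (e - L i e) = scale 2 e"
        using scale_left_distrib[of 1 1 e] by simp
      ultimately have "scale 2 e \<in> span (E (insert i J))" by (simp only:)
      then have "scale (inverse 2) (scale 2 e) \<in> span (E (insert i J))" by (rule span_scale)
      moreover have "scale (inverse 2) (scale 2 e) = e" using two by simp
      ultimately show "e \<in> span (E (insert i J))" by (simp only:)
    qed
    then have "span (E J) \<subseteq> span (E (insert i J))" by (rule span_minimal[OF _ subspace_span])
    then show ?case using insert by blast
  qed
  then have gen: "span T \<subseteq> span (E I)" using I by blast
  obtain B where B: "B \<subseteq> E I" "independent B" "E I \<subseteq> span B"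
    by (rule maximal_independent_subset)
  have TB: "span T \<subseteq> span B" using gen span_minimal[OF B(3) subspace_span] by blast
  have "B \<subseteq> span T" using B(1) by (auto simp: E_def)
  then have cardB: "finite B" "card B \<le> card T" using independent_span_bound[OF T B(2)] by auto
  define s where "s i = {b \<in> B. L i b = b}" for i
  have "inj_on s I"
  proof (rule inj_onI)
    fix i j assume ij: "i \<in> I" "j \<in> I" "s i = s j"
    have "L i b = L j b" if b: "b \<in> B" for b
    proof -
      have "L i b = b \<or> L i b = - b" "L j b = b \<or> L j b = - b" using b B(1) ij by (auto simp: E_def)
      moreover have "L i b = b \<longleftrightarrow> L j b = b" using ij(3) b by (auto simp: s_def)
      ultimately show ?thesis by metis
    qed
    moreover have "subspace {x. L i x = L j x}"
    proof (rule subspaceI)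
      show "0 \<in> {x. L i x = L j x}" using smult[of i 0 0] smult[of j 0 0] by simp
    qed (simp_all add: add smult)
    ultimately have "L i x = L j x" if "x \<in> span B" for x
      using span_induct[OF that, of "\<lambda>x. L i x = L j x"] by blast
    then show "i = j" using inj[OF ij(1,2)] TB by blast
  qed
  then have "card I = card (s ` I)" by (simp add: card_image)
  also have "\<dots> \<le> card (Pow B)" using cardB by (intro card_mono) (auto simp: s_def)
  also have "\<dots> \<le> 2 ^ card T" using cardB by (simp add: card_Pow power_increasing)
  finally show ?thesis .
qed

section \<open>Outer automorphisms\<close>

definition out_class :: "('g, 'm) monoid_scheme \<Rightarrow> ('g \<Rightarrow> 'g) \<Rightarrow> ('g \<Rightarrow> 'g) set" where
  "out_class G \<psi> = Inn G #>\<^bsub>AutoGroup G\<^esub> \<psi>"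

context group
begin

lemma auto_iff: "\<psi> \<in> auto G \<longleftrightarrow> \<psi> \<in> hom G G \<and> \<psi> \<in> extensional (carrier G) \<and> bij_betw \<psi> (carrier G) (carrier G)"
  by (auto simp: auto_def Bij_def)

lemma carrier_OutGroup: "carrier (OutGroup G) = out_class G ` auto G"
  by (auto simp: OutGroup_def out_class_def FactGroup_def RCOSETS_def AutoGroup_def)

lemma auto_compose: "\<psi> \<in> auto G \<Longrightarrow> \<chi> \<in> auto G \<Longrightarrow> compose (carrier G) \<psi> \<chi> \<in> auto G"
  using group.subgroup_self[OF AutoGroup] monoid.m_closed[OF group.is_monoid[OF AutoGroup], of \<psi> \<chi>]
  by (simp add: AutoGroup_def BijGroup_def auto_def)

lemma out_class_mult:
  assumes "\<psi> \<in> auto G" "\<chi> \<in> auto G"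
  shows "out_class G \<psi> \<otimes>\<^bsub>OutGroup G\<^esub> out_class G \<chi> = out_class G (compose (carrier G) \<psi> \<chi>)"
  using normal.rcos_sum[OF Inn_normal, of \<psi> \<chi>] assms
  by (simp add: OutGroup_def out_class_def FactGroup_def AutoGroup_def BijGroup_def auto_def)

lemma out_class_one: "out_class G (\<lambda>a\<in>carrier G. a) = \<one>\<^bsub>OutGroup G\<^esub>"
proof -
  have "(\<lambda>a\<in>carrier G. a) \<in> Inn G"
    unfolding Inn_def by (rule image_eqI[of _ _ \<one>]) auto
  then show ?thesis
    using group.coset_join2[OF AutoGroup, of "\<lambda>a\<in>carrier G. a" "Inn G"] id_in_auto
      normal_imp_subgroup[OF Inn_normal]
    by (simp add: out_class_def OutGroup_def FactGroup_def AutoGroup_def)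
qed

lemma out_class_eqD:
  assumes eq: "out_class G \<psi> = out_class G \<chi>" and \<psi>: "\<psi> \<in> auto G" and \<chi>: "\<chi> \<in> auto G"
  shows "\<exists>g\<in>carrier G. \<forall>a\<in>carrier G. \<psi> a = conj_by G g (\<chi> a)"
proof -
  have "\<psi> \<in> out_class G \<chi>"
    using group.rcos_self[OF AutoGroup, of \<psi> "Inn G"] normal_imp_subgroup[OF Inn_normal] eq \<psi>
    by (simp add: out_class_def AutoGroup_def)
  then obtain i where i: "i \<in> Inn G" "\<psi> = i \<otimes>\<^bsub>AutoGroup G\<^esub> \<chi>"
    by (auto simp: out_class_def r_coset_def)
  obtain g where g: "g \<in> carrier G" "i = (\<lambda>a\<in>carrier G. conj_by G g a)"
    using i(1) by (auto simp: Inn_def conj_by_def)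
  have "i \<in> auto G" using i(1) Inn_subset_auto by blast
  then have "\<psi> = compose (carrier G) i \<chi>"
    using i(2) \<chi> by (simp add: AutoGroup_def BijGroup_def auto_def)
  moreover have "\<chi> a \<in> carrier G" if "a \<in> carrier G" for a
    using \<chi> that by (auto simp: auto_iff intro: hom_in_carrier)
  ultimately have "\<psi> a = conj_by G g (\<chi> a)" if "a \<in> carrier G" for a
    using that g by (simp add: compose_def)
  then show ?thesis using g(1) by blast
qed

lemma out_class_inner:
  assumes \<psi>: "\<psi> \<in> auto G" and g: "g \<in> carrier G" and eq: "\<And>a. a \<in> carrier G \<Longrightarrow> \<psi> a = conj_by G g a"
  shows "out_class G \<psi> = \<one>\<^bsub>OutGroup G\<^esub>"
proof -
  have "\<psi> = (\<lambda>a\<in>carrier G. g \<otimes> a \<otimes> inv g)"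
    using \<psi> eq by (intro extensionalityI[of _ "carrier G"]) (auto simp: auto_iff conj_by_def)
  then have "\<psi> \<in> Inn G" using g by (auto simp: Inn_def)
  then show ?thesis
    using group.coset_join2[OF AutoGroup, of \<psi> "Inn G"] \<psi> normal_imp_subgroup[OF Inn_normal]
    by (simp add: out_class_def OutGroup_def FactGroup_def AutoGroup_def)
qed

end

context graph
begin

interpretation raag: group A by (rule group_raag)

definition flip_word :: "'a set \<Rightarrow> 'a word \<Rightarrow> 'a word" where
  "flip_word S = map (\<lambda>(s, b). (s, b \<noteq> (s \<in> S)))"

definition inversion :: "'a set \<Rightarrow> 'a word set \<Rightarrow> 'a word set" where
  "inversion S = (\<lambda>a\<in>carrier A. flip_word S ` a)"

lemma flip_word_simps [simp]:
  "flip_word S [] = []" "flip_word S (w @ w') = flip_word S w @ flip_word S w'"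
  "flip_word S ((s, b) # w) = (s, b \<noteq> (s \<in> S)) # flip_word S w"
  by (simp_all add: flip_word_def)

lemma flip_word_words [simp]: "flip_word S w \<in> words V \<longleftrightarrow> w \<in> words V"
  by (induction w) (auto simp: flip_word_def)

lemma flip_word_flip_word: "flip_word S (flip_word T w) = flip_word (sym_diff S T) w"
  by (induction w) auto

lemma flip_word_empty: "flip_word {} w = w"
  by (induction w) auto

lemma cls_letter: "v \<in> V \<Longrightarrow> cls [(v, b)] = gen v [^]\<^bsub>A\<^esub> (if b then 1 else -1 :: int)"
  using raag.int_pow_neg[of "gen v" 1] by (auto simp: gen_def[symmetric] cls_inverse_letter)

lemma cls_eqD: "cls v = cls w \<Longrightarrow> v \<in> words V \<Longrightarrow> w \<in> words V \<Longrightarrow> (v, w) \<in> word_rel V commutations"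
  unfolding cls_def using eq_equiv_class_iff[OF equiv_word_rel] by blast

text \<open>Adjacent generators commute also after one or both have been inverted.\<close>

lemma flip_word_rel:
  "(v, w) \<in> word_rel V commutations \<Longrightarrow> (flip_word S v, flip_word S w) \<in> word_rel V commutations"
proof (induction rule: word_rel.induct)
  case (cancel u v s b)
  have "(b \<noteq> (s \<in> S)) = (\<not> ((\<not> b) \<noteq> (s \<in> S)))" by blast
  then show ?case
    using word_rel.cancel[of "flip_word S u" V "flip_word S v" s "b \<noteq> (s \<in> S)" commutations] cancel by simp
next
  case (relation u v l r)
  obtain x y where xy: "x \<rightarrow>\<^bsub>G\<^esub> y" "l = [(x, True), (y, True)]" "r = [(y, True), (x, True)]"
    using relation.hyps(3) by (auto simp: commutations_def)
  have V: "x \<in> V" "y \<in> V" using relation.hyps(4) xy by auto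
  let ?x = "[(x, x \<notin> S)]" and ?y = "[(y, y \<notin> S)]"
  have "gen x [^]\<^bsub>A\<^esub> k \<cdot> gen y = gen y \<cdot> gen x [^]\<^bsub>A\<^esub> k" for k :: int
    by (rule raag.commutes_int_pow) (use V gen_commute[OF xy(1)] in auto)
  then have "gen y [^]\<^bsub>A\<^esub> j \<cdot> gen x [^]\<^bsub>A\<^esub> k = gen x [^]\<^bsub>A\<^esub> k \<cdot> gen y [^]\<^bsub>A\<^esub> j" for j k :: int
    by (intro raag.commutes_int_pow) (use V in auto)
  then have "cls (?x @ ?y) = cls (?y @ ?x)"
    using V cls_append[of ?x ?y] cls_append[of ?y ?x] by (simp add: cls_letter)
  then have "(?x @ ?y, ?y @ ?x) \<in> word_rel V commutations" by (rule cls_eqD) (use V in auto)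
  from word_rel_append_left[OF word_rel_append_right[OF this, of "flip_word S v"], of "flip_word S u"]
  show ?case using relation.hyps xy by simp
qed (auto intro: word_rel.refl word_rel.sym word_rel.trans)

lemma inversion_cls:
  assumes w: "w \<in> words V" shows "inversion S (cls w) = cls (flip_word S w)"
proof -
  have "flip_word S ` cls w = cls (flip_word S w)"
  proof
    show "flip_word S ` cls w \<subseteq> cls (flip_word S w)" using flip_word_rel by (auto simp: cls_def)
    show "cls (flip_word S w) \<subseteq> flip_word S ` cls w"
    proof
      fix v assume "v \<in> cls (flip_word S w)"
      then have "(flip_word S (flip_word S w), flip_word S v) \<in> word_rel V commutations"
        using flip_word_rel by (auto simp: cls_def)
      then have "flip_word S v \<in> cls w" by (simp add: flip_word_flip_word flip_word_empty cls_def)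
      moreover have "v = flip_word S (flip_word S v)" by (simp add: flip_word_flip_word flip_word_empty)
      ultimately show "v \<in> flip_word S ` cls w" by blast
    qed
  qed
  then show ?thesis using w by (simp add: inversion_def)
qed

lemma inversion_closed: "a \<in> carrier A \<Longrightarrow> inversion S a \<in> carrier A"
  by (auto elim!: carrierE simp: inversion_cls)

lemma inversion_inversion: "a \<in> carrier A \<Longrightarrow> inversion S (inversion T a) = inversion (sym_diff S T) a"
  by (auto elim!: carrierE simp: inversion_cls flip_word_flip_word)

lemma inversion_empty: "inversion {} = (\<lambda>a\<in>carrier A. a)"
  by (simp add: inversion_def flip_word_empty)

lemma inversion_auto: "inversion S \<in> auto A"
proof -
  have "inversion S \<in> hom A A"
  proof (rule homI)
    show "inversion S (a \<cdot> b) = inversion S a \<cdot> inversion S b"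
      if a: "a \<in> carrier A" and b: "b \<in> carrier A" for a b
    proof -
      obtain v where "v \<in> words V" "a = cls v" using a by (rule carrierE)
      moreover obtain w where "w \<in> words V" "b = cls w" using b by (rule carrierE)
      ultimately show ?thesis by (simp add: inversion_cls flip: cls_append)
    qed
  qed (rule inversion_closed)
  moreover have "bij_betw (inversion S) (carrier A) (carrier A)"
    by (rule bij_betwI[of _ _ _ "inversion S"])
      (simp_all add: inversion_closed inversion_inversion inversion_empty)
  ultimately show ?thesis by (simp add: raag.auto_iff inversion_def)
qed

lemma exp_sum_inversion_gen: "v \<in> V \<Longrightarrow> exp_sum v (inversion S (gen v)) = (if v \<in> S then -1 else 1)"
  by (simp add: gen_def inversion_cls exp_sum_cls letter_exp_def)

lemma compose_inversion: "compose (carrier A) (inversion S) (inversion T) = inversion (sym_diff S T)"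
  by (rule extensionalityI[of _ "carrier A"])
    (simp_all add: compose_def inversion_inversion inversion_def[of "sym_diff S T"])

lemma inversion_not_inner:
  assumes "S \<subseteq> V" "out_class A (inversion S) = \<one>\<^bsub>OutGroup A\<^esub>" shows "S = {}"
proof (rule ccontr)
  assume "S \<noteq> {}"
  then obtain v where v: "v \<in> S" "v \<in> V" using assms(1) by blast
  have "out_class A (inversion S) = out_class A (inversion {})"
    using assms(2) raag.out_class_one by (simp add: inversion_empty)
  from raag.out_class_eqD[OF this inversion_auto inversion_auto]
  obtain g where g: "g \<in> carrier A" "\<And>a. a \<in> carrier A \<Longrightarrow> inversion S a = conj_by A g (inversion {} a)"
    by blast
  have "exp_sum v (inversion S (gen v)) = exp_sum v (inversion {} (gen v))"
    using g v by (simp add: inversion_closed)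
  then show False using v by (simp add: exp_sum_inversion_gen)
qed

text \<open>A function \<open>f\<close> on the vertices extends uniquely to a homomorphism \<open>A \<rightarrow> \<real>\<close>; this is composition
  of that homomorphism with \<open>\<psi>\<close>, again described by its values on generators. It is the transpose of
  the matrix that \<open>\<psi>\<close> induces on exponent sums.\<close>

definition linearize :: "('a word set \<Rightarrow> 'a word set) \<Rightarrow> ('a \<Rightarrow> real) \<Rightarrow> 'a \<Rightarrow> real" where
  "linearize \<psi> f v = (if v \<in> V then \<Sum>u\<in>V. of_int (exp_sum u (\<psi> (gen v))) * f u else 0)"

lemma linearize_hom:
  assumes \<psi>: "\<psi> \<in> hom A A" and a: "a \<in> carrier A"
  shows "(\<Sum>v\<in>V. of_int (exp_sum v a) * linearize \<psi> f v) = (\<Sum>u\<in>V. of_int (exp_sum u (\<psi> a)) * f u)"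
    (is "?l a = ?r a")
proof -
  interpret \<psi>: group_hom A A \<psi> using \<psi> by unfold_locales
  have l: "?l (a \<cdot> b) = ?l a + ?l b" if "a \<in> carrier A" "b \<in> carrier A" for a b
    using that by (simp add: algebra_simps sum.distrib)
  have r: "?r (a \<cdot> b) = ?r a + ?r b" if "a \<in> carrier A" "b \<in> carrier A" for a b
    using that by (simp add: algebra_simps sum.distrib)
  have gen: "?l (gen v) = ?r (gen v)" if "v \<in> V" for v
  proof -
    have "?l (gen v) = (\<Sum>w\<in>V. if v = w then linearize \<psi> f w else 0)"
      using that by (intro sum.cong) auto
    then show ?thesis using that by (simp add: linearize_def)
  qed
  have inv_gen: "?l (inv\<^bsub>A\<^esub> gen v) = ?r (inv\<^bsub>A\<^esub> gen v)" if "v \<in> V" for v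
  proof -
    have "?l (inv\<^bsub>A\<^esub> gen v) = - ?l (gen v)" "?r (inv\<^bsub>A\<^esub> gen v) = - ?r (gen v)"
      using that by (simp_all add: sum_negf)
    then show ?thesis using gen[OF that] by simp
  qed
  show ?thesis
    using a
  proof (induction a rule: raag_induct)
    case one
    show ?case by simp
  next
    case (gen v b)
    then show ?case using l[of "gen v" b] r[of "gen v" b] \<open>\<And>v. v \<in> V \<Longrightarrow> ?l (gen v) = ?r (gen v)\<close> by simp
  next
    case (inv v b)
    then show ?case using l[of "inv\<^bsub>A\<^esub> gen v" b] r[of "inv\<^bsub>A\<^esub> gen v" b] inv_gen by simp
  qed
qed

lemma linearize_linearize:
  assumes "\<psi> \<in> hom A A" "\<chi> \<in> hom A A"
  shows "linearize \<chi> (linearize \<psi> f) = linearize (\<psi> \<circ> \<chi>) f"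
proof
  fix v
  have "v \<in> V \<Longrightarrow> \<chi> (gen v) \<in> carrier A" using assms(2) by (auto intro: hom_in_carrier)
  then show "linearize \<chi> (linearize \<psi> f) v = linearize (\<psi> \<circ> \<chi>) f v"
    using linearize_hom[OF assms(1), of "\<chi> (gen v)" f] by (simp add: linearize_def[of \<chi>] linearize_def[of "\<psi> \<circ> \<chi>"])
qed

lemma linearize_cong:
  assumes "\<And>u v. v \<in> V \<Longrightarrow> exp_sum u (\<psi> (gen v)) = exp_sum u (\<chi> (gen v))"
  shows "linearize \<psi> = linearize \<chi>"
  using assms by (simp add: linearize_def fun_eq_iff)

definition delta :: "'a \<Rightarrow> 'a \<Rightarrow> real" where
  "delta u v = of_bool (v = u)"

interpretation real_fun: vector_space "\<lambda>(c::real) (f::'a \<Rightarrow> real) v. c * f v"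
  by unfold_locales (simp_all add: fun_eq_iff algebra_simps)

lemma span_delta: "real_fun.span (delta ` V) = {f. \<forall>v. v \<notin> V \<longrightarrow> f v = 0}"
proof
  show "real_fun.span (delta ` V) \<subseteq> {f. \<forall>v. v \<notin> V \<longrightarrow> f v = 0}"
    by (rule real_fun.span_minimal) (auto simp: delta_def real_fun.subspace_def)
  show "{f. \<forall>v. v \<notin> V \<longrightarrow> f v = 0} \<subseteq> real_fun.span (delta ` V)"
  proof
    fix f :: "'a \<Rightarrow> real" assume f: "f \<in> {f. \<forall>v. v \<notin> V \<longrightarrow> f v = 0}"
    have "(\<Sum>u\<in>V. (\<lambda>v. f u * delta u v)) \<in> real_fun.span (delta ` V)"
      by (intro real_fun.span_sum real_fun.span_scale real_fun.span_base) auto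
    moreover have "(\<Sum>u\<in>V. (\<lambda>v. f u * delta u v)) v = f v" for v
    proof -
      have "(\<Sum>u\<in>V. (\<lambda>v. f u * delta u v)) v = (\<Sum>u\<in>V. f u * delta u v)"
      proof -
        have "(\<Sum>u\<in>F. (\<lambda>v. f u * delta u v)) v = (\<Sum>u\<in>F. f u * delta u v)" if "finite F" for F
          using that by induction auto
        then show ?thesis by simp
      qed
      also have "\<dots> = (\<Sum>u\<in>V. if v = u then f u else 0)"
        by (intro sum.cong) (auto simp: delta_def)
      also have "\<dots> = f v" using f by simp
      finally show ?thesis .
    qed
    ultimately show "f \<in> real_fun.span (delta ` V)" by (metis ext)
  qed
qed

lemma sum_delta: "u \<in> V \<Longrightarrow> (\<Sum>v\<in>V. c v * delta u v) = c u"
proof -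
  assume u: "u \<in> V"
  have "(\<Sum>v\<in>V. c v * delta u v) = (\<Sum>v\<in>V. if u = v then c v else 0)"
    by (intro sum.cong) (auto simp: delta_def)
  then show ?thesis using u by simp
qed

text \<open>Representatives \<open>\<psi> S\<close> of the classes \<open>c S\<close> act on functions on \<open>V\<close> by commuting involutions.
  Two of them acting in the same way differ by a class that acts trivially on exponent sums and has
  trivial square, so this class is trivial.\<close>

theorem out_elementary_abelian_2_card:
  fixes c :: "'c set \<Rightarrow> ('a word set \<Rightarrow> 'a word set) set"
  assumes W: "finite W"
    and closed: "\<And>S. S \<subseteq> W \<Longrightarrow> c S \<in> carrier (OutGroup A)"
    and mult: "\<And>S T. S \<subseteq> W \<Longrightarrow> T \<subseteq> W \<Longrightarrow> c S \<otimes>\<^bsub>OutGroup A\<^esub> c T = c (sym_diff S T)"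
    and empty: "c {} = \<one>\<^bsub>OutGroup A\<^esub>"
    and trivial: "\<And>S. S \<subseteq> W \<Longrightarrow> c S = \<one>\<^bsub>OutGroup A\<^esub> \<Longrightarrow> S = {}"
  shows "card W \<le> card V"
proof -
  have "\<exists>\<chi>. \<chi> \<in> auto A \<and> c S = out_class A \<chi>" if "S \<subseteq> W" for S
    using closed[OF that] by (auto simp: raag.carrier_OutGroup)
  then obtain \<psi> where \<psi>: "\<And>S. S \<subseteq> W \<Longrightarrow> \<psi> S \<in> auto A" "\<And>S. S \<subseteq> W \<Longrightarrow> c S = out_class A (\<psi> S)"
    by metis
  have hom: "\<psi> S \<in> hom A A" if "S \<subseteq> W" for S using \<psi>(1)[OF that] by (simp add: raag.auto_iff)
  have \<psi>c: "\<psi> S a \<in> carrier A" if "S \<subseteq> W" "a \<in> carrier A" for S a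
    using hom[OF that(1)] that(2) by (rule hom_in_carrier)
  have sd: "sym_diff S T \<subseteq> W" if "S \<subseteq> W" "T \<subseteq> W" for S T using that by blast
  have comp: "\<exists>g\<in>carrier A. \<forall>a\<in>carrier A. \<psi> S (\<psi> T a) = conj_by A g (\<psi> (sym_diff S T) a)"
    if ST: "S \<subseteq> W" "T \<subseteq> W" for S T
  proof -
    have "out_class A (compose (carrier A) (\<psi> S) (\<psi> T)) = out_class A (\<psi> (sym_diff S T))"
      using mult[OF ST] \<psi> ST sd[OF ST] by (simp add: raag.out_class_mult)
    from raag.out_class_eqD[OF this raag.auto_compose[OF \<psi>(1)[OF ST(1)] \<psi>(1)[OF ST(2)]] \<psi>(1)[OF sd[OF ST]]]
    show ?thesis by (simp add: compose_def)
  qed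
  have "out_class A (\<psi> {}) = out_class A (\<lambda>a\<in>carrier A. a)"
    using empty \<psi>(2)[of "{}"] raag.out_class_one by simp
  from raag.out_class_eqD[OF this \<psi>(1) raag.id_in_auto]
  obtain g0 where g0: "g0 \<in> carrier A" "\<And>a. a \<in> carrier A \<Longrightarrow> \<psi> {} a = conj_by A g0 a"
    by auto
  define L where "L S = linearize (\<psi> S)" for S
  have L_comp: "L S (L T f) = L (sym_diff T S) f" if ST: "S \<subseteq> W" "T \<subseteq> W" for S T f
  proof -
    obtain g where "g \<in> carrier A" "\<And>a. a \<in> carrier A \<Longrightarrow> \<psi> T (\<psi> S a) = conj_by A g (\<psi> (sym_diff T S) a)"
      using comp[OF ST(2,1)] by blast
    then have "linearize (\<psi> T \<circ> \<psi> S) = linearize (\<psi> (sym_diff T S))"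
      using \<psi>c sd ST by (intro linearize_cong) simp
    then show ?thesis using linearize_linearize[OF hom hom, of T S f] ST by (simp add: L_def)
  qed
  have L_empty: "L {} f = f" if f: "f \<in> real_fun.span (delta ` V)" for f
  proof
    fix v
    have "(\<Sum>u\<in>V. of_int (exp_sum u (gen v)) * f u) = f v" if v: "v \<in> V"
    proof -
      have "(\<Sum>u\<in>V. of_int (exp_sum u (gen v)) * f u) = (\<Sum>u\<in>V. if v = u then f u else 0)"
        using v by (intro sum.cong) auto
      then show ?thesis using v by simp
    qed
    then show "L {} f v = f v" using f g0 by (simp add: L_def linearize_def span_delta)
  qed
  have L_span: "L S f \<in> real_fun.span (delta ` V)" for S f
    by (simp add: span_delta L_def linearize_def)
  have "card (Pow W) \<le> 2 ^ card (delta ` V)"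
  proof (rule real_fun.commuting_involutions_card[of _ _ L])
    show "L S (f + h) = L S f + L S h" for S f h
      by (simp add: L_def linearize_def fun_eq_iff algebra_simps sum.distrib)
    show "L S (\<lambda>v. k * f v) = (\<lambda>v. k * L S f v)" for S k f
      by (simp add: L_def linearize_def fun_eq_iff sum_distrib_left mult.left_commute)
    show "L S (L S f) = f" if "S \<in> Pow W" "f \<in> real_fun.span (delta ` V)" for S f
      using L_comp[of S S f] L_empty that by simp
    show "L S (L T f) = L T (L S f)" if "S \<in> Pow W" "T \<in> Pow W" for S T f
      using L_comp[of S T f] L_comp[of T S f] that by (simp add: Un_commute)
    fix S T assume "S \<in> Pow W" "T \<in> Pow W"
      and eq: "\<And>f. f \<in> real_fun.span (delta ` V) \<Longrightarrow> L S f = L T f"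
    then have ST: "S \<subseteq> W" "T \<subseteq> W" by auto
    define R where "R = sym_diff S T"
    have R: "R \<subseteq> W" using sd[OF ST] by (simp add: R_def)
    have L_R: "L R f = f" if f: "f \<in> real_fun.span (delta ` V)" for f
    proof -
      have "L R f = L T (L S f)" using L_comp[OF ST(2,1), of f] by (simp add: R_def)
      also have "\<dots> = L T (L T f)" using eq[OF f] by simp
      also have "\<dots> = f" using L_comp[OF ST(2,2), of f] L_empty[OF f] by simp
      finally show ?thesis .
    qed
    have "exp_sum u (\<psi> R a) = exp_sum u a" if a: "a \<in> carrier A" and u: "u \<in> V" for a u
    proof -
      have "delta u \<in> real_fun.span (delta ` V)" using u by (intro real_fun.span_base) simp
      then have "linearize (\<psi> R) (delta u) = delta u" using L_R by (simp add: L_def)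
      then have "real_of_int (exp_sum u a) = of_int (exp_sum u (\<psi> R a))"
        using linearize_hom[OF hom[OF R] a, of "delta u"] u by (simp add: sum_delta)
      then show ?thesis by simp
    qed
    moreover obtain g where g: "g \<in> carrier A" "\<And>a. a \<in> carrier A \<Longrightarrow> \<psi> R (\<psi> R a) = conj_by A g (\<psi> {} a)"
      using comp[OF R R] by auto
    have "\<psi> R (\<psi> R a) = conj_by A (g \<cdot> g0) a" if "a \<in> carrier A" for a
      using g g0 that by (simp add: raag.conj_by_conj_by)
    ultimately have "\<exists>h\<in>carrier A. \<forall>a\<in>carrier A. \<psi> R a = conj_by A h a"
      using g(1) g0(1) by (intro square_inner_imp_inner[OF hom[OF R]]) auto
    then have "c R = \<one>\<^bsub>OutGroup A\<^esub>"
      using raag.out_class_inner[OF \<psi>(1)[OF R]] \<psi>(2)[OF R] by auto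
    then have "R = {}" using trivial[OF R] by simp
    then show "S = T" by (auto simp: R_def)
  qed (use W L_span in auto)
  then have "(2::nat) ^ card W \<le> 2 ^ card (delta ` V)" using W by (simp add: card_Pow)
  then have "card W \<le> card (delta ` V)" by simp
  also have "\<dots> \<le> card V" by (rule card_image_le) simp
  finally show ?thesis .
qed

end

theorem theorem4p1:
  fixes \<Gamma> :: "('v, 'e) pre_digraph" and \<Gamma>' :: "('w, 'f) pre_digraph"
  assumes "graph \<Gamma>" and "graph \<Gamma>'"
    and "card (verts \<Gamma>') < card (verts \<Gamma>)"
  shows "\<not> (\<exists>\<phi> \<in> hom (OutGroup (raag \<Gamma>)) (OutGroup (raag \<Gamma>')).
    inj_on \<phi> (carrier (OutGroup (raag \<Gamma>))))"
proof
  assume "\<exists>\<phi> \<in> hom (OutGroup (raag \<Gamma>)) (OutGroup (raag \<Gamma>')).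
    inj_on \<phi> (carrier (OutGroup (raag \<Gamma>)))"
  then obtain \<phi> where \<phi>: "\<phi> \<in> hom (OutGroup (raag \<Gamma>)) (OutGroup (raag \<Gamma>'))"
    "inj_on \<phi> (carrier (OutGroup (raag \<Gamma>)))" by blast
  interpret \<Gamma>: graph \<Gamma> by fact
  interpret \<Gamma>': graph \<Gamma>' by fact
  interpret A: group "raag \<Gamma>" by (rule group_raag)
  interpret A': group "raag \<Gamma>'" by (rule group_raag)
  interpret \<phi>: group_hom "OutGroup (raag \<Gamma>)" "OutGroup (raag \<Gamma>')" \<phi>
    using \<phi>(1) A.group_OutGroup A'.group_OutGroup by (simp add: group_hom_def group_hom_axioms_def)
  define i where "i S = out_class (raag \<Gamma>) (\<Gamma>.inversion S)" for S
  have i: "i S \<in> carrier (OutGroup (raag \<Gamma>))" for S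
    using \<Gamma>.inversion_auto by (simp add: i_def A.carrier_OutGroup)
  have mult: "i S \<otimes>\<^bsub>OutGroup (raag \<Gamma>)\<^esub> i T = i (sym_diff S T)" for S T
    by (simp add: i_def A.out_class_mult \<Gamma>.inversion_auto \<Gamma>.compose_inversion)
  have "card (verts \<Gamma>) \<le> card (verts \<Gamma>')"
  proof (rule \<Gamma>'.out_elementary_abelian_2_card[of _ "\<lambda>S. \<phi> (i S)"])
    show "\<phi> (i S) \<otimes>\<^bsub>OutGroup (raag \<Gamma>')\<^esub> \<phi> (i T) = \<phi> (i (sym_diff S T))" for S T
      using i mult by (metis \<phi>.hom_mult)
    show "\<phi> (i {}) = \<one>\<^bsub>OutGroup (raag \<Gamma>')\<^esub>"
      using A.out_class_one by (simp add: i_def \<Gamma>.inversion_empty)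
    show "S = {}" if "S \<subseteq> verts \<Gamma>" "\<phi> (i S) = \<one>\<^bsub>OutGroup (raag \<Gamma>')\<^esub>" for S
    proof (rule \<Gamma>.inversion_not_inner[OF that(1)])
      have "\<phi> (i S) = \<phi> \<one>\<^bsub>OutGroup (raag \<Gamma>)\<^esub>" using that(2) by simp
      then have "i S = \<one>\<^bsub>OutGroup (raag \<Gamma>)\<^esub>"
        by (rule inj_onD[OF \<phi>(2)]) (use i in simp_all)
      then show "out_class (raag \<Gamma>) (\<Gamma>.inversion S) = \<one>\<^bsub>OutGroup (raag \<Gamma>)\<^esub>" by (simp add: i_def)
    qed
  qed (use i in auto)
  then show False using assms(3) by simp
qed

end
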